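(* Let $\Sigma_1,\Sigma_2$ be $0$-asymptotically stable systems and let $\gamma,\delta>0$. Then $\Sigma_2$ is $(\gamma,\delta)$-similar to $\Sigma_1$ if and only if there exist a (symmetric) positive definite matrix $X$, a matrix $\Pi$, and positive scalars $\tilde\eta$ and $\tilde\mu$ such that $$\begin{bmatrix}AX+B\Pi+(AX+B\Pi)^T&E&(CX+D\Pi)^T \\ E^T&-\tilde Q(\gamma,\delta,\tilde\mu)&0 \\ CX+D\Pi&0&-\tilde R(\tilde\eta)\end{bmatrix}\prec0,$$ where $$A=\begin{bmatrix}A_1&0 \\ 0&A_2\end{bmatrix},\ B=\begin{bmatrix}0 \\ E_2\end{bmatrix},\ E=\begin{bmatrix}B_1&0&E_1 \\ 0&B_2&0\end{bmatrix},\ C=\begin{bmatrix}C_1&-C_2 \\ 0&0\end{bmatrix},\ D=\begin{bmatrix}0 \\ I\end{bmatrix},$$ $$\tilde Q(\gamma,\delta,\tilde\mu)=\begin{bmatrix}(\gamma+\delta)I&-\gamma I&0 \\ -\gamma I&(\gamma+\delta)I&0 \\ 0&0&\tilde\mu I\end{bmatrix},\qquad\tilde R(\tilde\eta)=\begin{bmatrix}I&0 \\ 0&\tilde\eta I\end{bmatrix}.$$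
   Context: For $i=1,2$, $\Sigma_i$ is the continuous-time linear system $\dot x_i=A_ix_i+B_iu_i+E_id_i$, $y_i=C_ix_i$ with real constant matrices, state $x_i\in\mathbb{R}^{n_i}$, input $u_i\in\mathbb{R}^{m}$, disturbance $d_i\in\mathbb{R}^{q_i}$ and output $y_i\in\mathbb{R}^{p}$ (same $m$ and $p$ for both systems). It is $0$-asymptotically stable if $A_i$ is Hurwitz. $\mathcal{L}_2$ is the space of measurable (vector-valued) functions $u$ on $[0,\infty)$ with $\|u\|^2=\int_0^\infty|u(t)|^2\,dt<\infty$. $y_i(t;t_0,x_{i,0},u_i,d_i)$ denotes the output at time $t$ for $x_i(t_0)=x_{i,0}$, input $u_i$, disturbance $d_i$. Definition. For $\gamma,\delta>0$, $\Sigma_2$ is $(\gamma,\delta)$-similar to $\Sigma_1$ ($\Sigma_1\preccurlyeq_{\gamma,\delta}\Sigma_2$) if there exist constants $\varepsilon,\eta,\mu>0$ such that for all $u_1,u_2\in\mathcal{L}_2$ and all $d_1\in\mathcal{L}_2$ there exists $d_2\in\mathcal{L}_2$ with $$\|y_1-y_2\|^2\le\gamma\|u_1-u_2\|^2+(\delta-\varepsilon)\left\|\begin{bmatrix}u_1 \\ u_2\end{bmatrix}\right\|^2+(\mu-\varepsilon)\|d_1\|^2-\eta\|d_2\|^2,$$ where $y_i(t)=y_i(t;0,0,u_i,d_i)$. Block sizes: in $\tilde Q$ the diagonal blocks have sizes $m,m,q_1$; in $\tilde R$ they have sizes $p,q_2$; in $C$ and $D$ the row blocks have sizes $p,q_2$,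 and the identity in $D$ is $q_2\times q_2$. $X$ is $(n_1+n_2)\times(n_1+n_2)$ and $\Pi$ is $q_2\times(n_1+n_2)$. $M\prec0$ means $M$ is negative definite. *)

theory Defs
  imports "HOL-Analysis.Analysis"
begin

section \<open>Signals\<close>

text \<open>Signals are total functions on the reals; only their values on the half-line \<open>[0,\<infinity>)\<close> matter.\<close>

definition L2 :: "(real \<Rightarrow> real^'k) set" where
  "L2 = {u. u \<in> borel_measurable (lebesgue_on {0..}) \<and>
            integrable (lebesgue_on {0..}) (\<lambda>t. (norm (u t))\<^sup>2)}"

definition L2norm :: "(real \<Rightarrow> real^'k) \<Rightarrow> real" where
  "L2norm u = sqrt (integral\<^sup>L (lebesgue_on {0..}) (\<lambda>t. (norm (u t))\<^sup>2))"

definition stack :: "real^'a \<Rightarrow> real^'b \<Rightarrow> real^('a + 'b)" where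
  "stack v w = (\<chi> i. case i of Inl a \<Rightarrow> v $ a | Inr b \<Rightarrow> w $ b)"


section \<open>Linear systems\<close>

text \<open>\<open>x' = A x + B u + E d\<close>, \<open>y = C x\<close>; the dimensions of state, input, disturbance and output
  are the cardinalities of the index types \<open>'n\<close>, \<open>'m\<close>, \<open>'q\<close> and \<open>'p\<close>.\<close>

record ('n::finite, 'm::finite, 'q::finite, 'p::finite) lti =
  matA :: "real^'n^'n"
  matB :: "real^'m^'n"
  matE :: "real^'q^'n"
  matC :: "real^'n^'p"

definition hurwitz :: "real^'n^'n \<Rightarrow> bool" where
  "hurwitz A \<longleftrightarrow>
     (\<forall>(l::complex) (v::complex^'n). v \<noteq> 0 \<longrightarrow>
        (\<chi> i j. complex_of_real (A $ i $ j)) *v v = l *s v \<longrightarrow> Re l < 0)"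

definition zero_asymptotically_stable ::
  "('n::finite, 'm::finite, 'q::finite, 'p::finite) lti \<Rightarrow> bool" where
  "zero_asymptotically_stable S \<longleftrightarrow> hurwitz (matA S)"

text \<open>Inputs and disturbances are merely (square) integrable, so solutions are meant in the sense
  of Caratheodory: \<open>x\<close> is absolutely continuous and satisfies the differential equation almost
  everywhere, that is, it satisfies the integral equation below (with the Lebesgue integral).\<close>

definition is_state_trajectory ::
  "('n::finite, 'm::finite, 'q::finite, 'p::finite) lti
     \<Rightarrow> real \<Rightarrow> real^'n \<Rightarrow> (real \<Rightarrow> real^'m) \<Rightarrow> (real \<Rightarrow> real^'q)
     \<Rightarrow> (real \<Rightarrow> real^'n) \<Rightarrow> bool" where
  "is_state_trajectory S t0 x0 u d x \<longleftrightarrow>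
     (\<forall>t\<ge>t0.
        (\<lambda>s. matA S *v x s + matB S *v u s + matE S *v d s) absolutely_integrable_on {t0..t} \<and>
        x t = x0 + integral {t0..t} (\<lambda>s. matA S *v x s + matB S *v u s + matE S *v d s))"

text \<open>For \<open>u\<close>, \<open>d\<close> in \<open>L2\<close> and \<open>t0 \<ge> 0\<close> a trajectory exists and any two of them agree on \<open>[t0,\<infinity>)\<close>,
  but not before \<open>t0\<close>, where nothing is required; hence the description of the single value at
  \<open>t\<close> instead of the whole trajectory.\<close>

definition lti_state ::
  "('n::finite, 'm::finite, 'q::finite, 'p::finite) lti
     \<Rightarrow> real \<Rightarrow> real \<Rightarrow> real^'n \<Rightarrow> (real \<Rightarrow> real^'m) \<Rightarrow> (real \<Rightarrow> real^'q)
     \<Rightarrow> real^'n" where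
  "lti_state S t t0 x0 u d = (THE v. \<exists>x. is_state_trajectory S t0 x0 u d x \<and> x t = v)"

definition lti_output ::
  "('n::finite, 'm::finite, 'q::finite, 'p::finite) lti
     \<Rightarrow> real \<Rightarrow> real \<Rightarrow> real^'n \<Rightarrow> (real \<Rightarrow> real^'m) \<Rightarrow> (real \<Rightarrow> real^'q)
     \<Rightarrow> real^'p" where
  "lti_output S t t0 x0 u d = matC S *v lti_state S t t0 x0 u d"

text \<open>\<open>S2\<close> is \<open>(\<gamma>,\<delta>)\<close>-similar to \<open>S1\<close>. The inequality presupposes \<open>\<parallel>y1 - y2\<parallel> < \<infinity>\<close>; since the
  Bochner integral of a non-integrable function is 0, this has to be required explicitly.\<close>

definition similar ::
  "real \<Rightarrow> real \<Rightarrow> ('n1::finite, 'm::finite, 'q1::finite, 'p::finite) lti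
   \<Rightarrow> ('n2::finite, 'm, 'q2::finite, 'p) lti \<Rightarrow> bool" where
  "similar \<gamma> \<delta> S1 S2 \<longleftrightarrow>
     (\<exists>\<epsilon>>0. \<exists>\<eta>>0. \<exists>\<mu>>0. \<forall>u1\<in>L2. \<forall>u2\<in>L2. \<forall>d1\<in>L2. \<exists>d2\<in>L2.
        let e = (\<lambda>t. lti_output S1 t 0 0 u1 d1 - lti_output S2 t 0 0 u2 d2) in
        e \<in> L2 \<and>
        (L2norm e)\<^sup>2 \<le> \<gamma> * (L2norm (\<lambda>t. u1 t - u2 t))\<^sup>2
          + (\<delta> - \<epsilon>) * (L2norm (\<lambda>t. stack (u1 t) (u2 t)))\<^sup>2
          + (\<mu> - \<epsilon>) * (L2norm d1)\<^sup>2 - \<eta> * (L2norm d2)\<^sup>2)"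


section \<open>Block matrices and definiteness\<close>

definition hcat :: "'a^'c1^'r \<Rightarrow> 'a^'c2^'r \<Rightarrow> 'a^('c1 + 'c2)^'r" where
  "hcat M N = (\<chi> i j. case j of Inl a \<Rightarrow> M $ i $ a | Inr b \<Rightarrow> N $ i $ b)"

definition vcat :: "'a^'c^'r1 \<Rightarrow> 'a^'c^'r2 \<Rightarrow> 'a^'c^('r1 + 'r2)" where
  "vcat M N = (\<chi> i. case i of Inl a \<Rightarrow> M $ a | Inr b \<Rightarrow> N $ b)"

abbreviation block_row3 ::
  "'a^'c1^'r \<Rightarrow> 'a^'c2^'r \<Rightarrow> 'a^'c3^'r \<Rightarrow> 'a^('c1 + 'c2 + 'c3)^'r" where
  "block_row3 M N P \<equiv> hcat M (hcat N P)"

abbreviation block_col3 ::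
  "'a^'c^'r1 \<Rightarrow> 'a^'c^'r2 \<Rightarrow> 'a^'c^'r3 \<Rightarrow> 'a^'c^('r1 + 'r2 + 'r3)" where
  "block_col3 M N P \<equiv> vcat M (vcat N P)"

definition positive_definite :: "real^'k^'k \<Rightarrow> bool" where
  "positive_definite M \<longleftrightarrow> transpose M = M \<and> (\<forall>v. v \<noteq> 0 \<longrightarrow> v \<bullet> (M *v v) > 0)"

definition negative_definite :: "real^'k^'k \<Rightarrow> bool" where
  "negative_definite M \<longleftrightarrow> transpose M = M \<and> (\<forall>v. v \<noteq> 0 \<longrightarrow> v \<bullet> (M *v v) < 0)"


section \<open>The matrices of the linear matrix inequality\<close>

text \<open>Here \<open>mat k\<close> is \<open>k\<close> times the identity matrix.\<close>

definition lmiA ::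
  "('n1::finite, 'm::finite, 'q1::finite, 'p::finite) lti
   \<Rightarrow> ('n2::finite, 'm, 'q2::finite, 'p) lti
     \<Rightarrow> real^('n1 + 'n2)^('n1 + 'n2)" where
  "lmiA S1 S2 = vcat (hcat (matA S1) 0)
                     (hcat 0 (matA S2))"

definition lmiB ::
  "('n1::finite, 'm::finite, 'q1::finite, 'p::finite) lti
   \<Rightarrow> ('n2::finite, 'm, 'q2::finite, 'p) lti
     \<Rightarrow> real^'q2^('n1 + 'n2)" where
  "lmiB S1 S2 = vcat 0 (matE S2)"

definition lmiE ::
  "('n1::finite, 'm::finite, 'q1::finite, 'p::finite) lti
   \<Rightarrow> ('n2::finite, 'm, 'q2::finite, 'p) lti
     \<Rightarrow> real^('m + 'm + 'q1)^('n1 + 'n2)" where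
  "lmiE S1 S2 = vcat (block_row3 (matB S1) 0 (matE S1))
                     (block_row3 0 (matB S2) 0)"

definition lmiC ::
  "('n1::finite, 'm::finite, 'q1::finite, 'p::finite) lti
   \<Rightarrow> ('n2::finite, 'm, 'q2::finite, 'p) lti
     \<Rightarrow> real^('n1 + 'n2)^('p + 'q2)" where
  "lmiC S1 S2 = vcat (hcat (matC S1) (- matC S2))
                     (hcat 0 0)"

definition lmiD ::
  "('n1::finite, 'm::finite, 'q1::finite, 'p::finite) lti
   \<Rightarrow> ('n2::finite, 'm, 'q2::finite, 'p) lti
     \<Rightarrow> real^'q2^('p + 'q2)" where
  "lmiD S1 S2 = vcat 0 (mat 1)"

definition Qtilde :: "real \<Rightarrow> real \<Rightarrow> real \<Rightarrow> real^('m::finite + 'm + 'q1::finite)^('m + 'm + 'q1)" where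
  "Qtilde \<gamma> \<delta> \<mu> = block_col3 (block_row3 (mat (\<gamma> + \<delta>)) (mat (- \<gamma>)) 0)
                              (block_row3 (mat (- \<gamma>)) (mat (\<gamma> + \<delta>)) 0)
                              (block_row3 0 0 (mat \<mu>))"

definition Rtilde :: "real \<Rightarrow> real^('p::finite + 'q2::finite)^('p + 'q2)" where
  "Rtilde \<eta> = vcat (hcat (mat 1) 0)
                    (hcat 0 (mat \<eta>))"

end

theory Submission
  imports Defs "HOL-Computational_Algebra.Fundamental_Theorem_Algebra"
begin

text \<open>Put \<open>x = (x\<^sub>1, x\<^sub>2)\<close>, \<open>w = (u\<^sub>1, u\<^sub>2, d\<^sub>1)\<close>, \<open>d = d\<^sub>2\<close>. Similarity says that for every \<open>w\<close> some \<open>d\<close>, which may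
  depend on the future of \<open>w\<close>, achieves \<open>\<parallel>C x\<parallel>\<^sup>2 + \<eta> \<parallel>d\<parallel>\<^sup>2 \<le> \<langle>w, Q w\<rangle>\<close> with some slack in \<open>Q\<close>.

  A solution of the matrix inequality yields the feedback \<open>d = \<Pi> X\<inverse> x\<close> with storage function
  \<open>x \<bullet> X\<inverse> x\<close>. For the converse dualize the minimization over \<open>d\<close>: with a costate
  \<open>-p' = A\<^sup>T p + C\<^sup>T z + v\<close>, \<open>p(T) = 0\<close>, the worst \<open>w\<close> is a pointwise function of \<open>p\<close>, and similarity
  becomes nonnegativity of \<open>\<integral> |z|\<^sup>2 + K |v|\<^sup>2 + |B\<^sup>T p|\<^sup>2 / \<eta> - p \<bullet> E Q\<inverse> E\<^sup>T p\<close>, a problem with a single player.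
  Here \<open>v\<close> is an artificial, heavily penalized input that makes every \<open>p(0)\<close> reachable. The
  infimum over paths with \<open>p(0) = q\<close> is a quadratic form \<open>q \<bullet> X q \<ge> 0\<close>, whose dissipation inequality is
  the Riccati inequality; a small Lyapunov matrix makes it strict, and \<open>\<Pi> = - B\<^sup>T / \<eta>\<close> turns it into
  the matrix inequality.\<close>

section \<open>Lyapunov matrices\<close>

text \<open>The obstacle is the order of choices: \<open>d\<close> is picked with all of
  \<open>w\<close> known, so the primal problem is a sup of infima without a feedback law or a value
  function of the current state. The inner minimization is convex. Replacing it by its dual leaves a
  single optimization over paths of \<open>p\<close>, to which dynamic programming applies. Only
  weak duality is used: any response \<open>x\<close>, paired with \<open>p\<close>, bounds the dual
  cost from below.

  Without \<open>v\<close> only the reachable subspace of the pair of transposes of \<open>A\<close>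
  and \<open>C\<close> would be covered. A finite penalty \<open>K\<close> suffices, because
  stability bounds the energy of \<open>x\<close> by that of \<open>w\<close>, and the resulting
  loss is paid from the slack in \<open>Q\<close>. Half of the slack is spent there; the other half
  makes the final form strict in \<open>w\<close>.

  The costate lives in the space dual to the state, so its value matrix is the inverse of a storage
  matrix. The weights of \<open>d\<close> in the two formulations are reciprocal, since
  \<open>Rtilde\<close> is eliminated by a Schur complement.

  Stability enters through a Lyapunov matrix only. It is built from an annihilating polynomial, with
  neither matrix exponentials nor Jordan forms.\<close>

definition poly_act :: "complex poly \<Rightarrow> (complex^'n \<Rightarrow> complex^'n) \<Rightarrow> complex^'n \<Rightarrow> complex^'n" where
  "poly_act p f = fold_coeffs (\<lambda>a g x. a *s x + f (g x)) p (\<lambda>_. 0)"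

text \<open>Linearity over the complex numbers, as eigenvalues require; \<open>linear\<close> is
  linearity over the reals.\<close>

locale complex_linear =
  fixes f :: "complex^'n \<Rightarrow> complex^'n"
  assumes f_add: "f (x + y) = f x + f y" and f_smult: "f (c *s x) = c *s f x"
begin

lemma f0: "f 0 = 0"
  using f_add[of 0 0] by simp

lemma f_diff: "f (x - y) = f x - f y"
  using f_add[of "x - y" y] by (simp add: algebra_simps)

lemma poly_act_0 [simp]: "poly_act 0 f x = 0"
  by (simp add: poly_act_def)

lemma poly_act_pCons: "poly_act (pCons a p) f x = a *s x + f (poly_act p f x)"
  by (cases "p = 0 \<and> a = 0") (auto simp: poly_act_def f0)

lemma poly_act_add: "poly_act (p + q) f x = poly_act p f x + poly_act q f x"
proof (induction p q rule: poly_induct2)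
  case (pCons a p b q)
  then show ?case
    by (simp add: poly_act_pCons f_add vector_sadd_rdistrib)
qed simp

lemma poly_act_smult: "poly_act (smult c p) f x = c *s poly_act p f x"
  by (induction p) (simp_all add: poly_act_pCons f_smult vector_add_ldistrib vector_smult_assoc)

lemma poly_act_linear_factor:
  "poly_act ([:- l, 1:] * p) f x = f (poly_act p f x) - l *s poly_act p f x"
proof -
  have "[:- l, 1:] * p = smult (- l) p + pCons 0 p" by (simp add: mult_pCons_left)
  then have "poly_act ([:- l, 1:] * p) f x = (- l) *s poly_act p f x + f (poly_act p f x)"
    by (simp only: poly_act_add poly_act_smult poly_act_pCons) simp
  then show ?thesis by (simp add: vector_smult_lneg)
qed

lemma poly_act_monom: "poly_act (monom c k) f x = c *s (f ^^ k) x"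
  by (induction k) (simp_all add: monom_0 monom_Suc poly_act_pCons f0 f_smult)

lemma poly_act_sum: "poly_act (\<Sum>i\<in>I. p i) f x = (\<Sum>i\<in>I. poly_act (p i) f x)"
  by (induction I rule: infinite_finite_induct) (simp_all add: poly_act_add)

text \<open>The product of the maps \<open>f - l\<close> applied to \<open>x\<close>. Keeping a list
  of roots allows induction along partial products and the removal of a single factor.\<close>

definition linear_factors :: "complex list \<Rightarrow> complex^'n \<Rightarrow> complex^'n" where
  "linear_factors ls x = foldr (\<lambda>l y. f y - l *s y) ls x"

lemma linear_factors_simps [simp]: "linear_factors [] x = x" "linear_factors (l # ls) x = f (linear_factors ls x) - l *s linear_factors ls x"
  by (simp_all add: linear_factors_def)

lemma linear_factors_f: "linear_factors ls (f x) = f (linear_factors ls x)"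
  by (induction ls) (simp_all add: f_diff f_smult)

lemma linear_factors_add: "linear_factors ls (x + y) = linear_factors ls x + linear_factors ls y"
  by (induction ls) (simp_all add: f_add vector_add_ldistrib)

lemma linear_factors_smult: "linear_factors ls (c *s x) = c *s linear_factors ls x"
  by (induction ls) (simp_all add: f_smult vector_ssub_ldistrib vector_smult_assoc mult.commute)

lemma linear_factors_diff: "linear_factors ls (x - y) = linear_factors ls x - linear_factors ls y"
  using linear_factors_add[of ls "x - y" y] by simp

lemma linear_factors_append: "linear_factors (ls @ ms) x = linear_factors ls (linear_factors ms x)"
  by (simp add: linear_factors_def)

lemma linear_factors_pact: "linear_factors ls x = poly_act (\<Prod>l\<leftarrow>ls. [:- l, 1:]) f x"
proof (induction ls)
  case Nil
  then show ?case by (simp add: one_pCons poly_act_pCons f0)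
next
  case (Cons l ls)
  then show ?case by (simp only: linear_factors_simps list.map prod_list.Cons poly_act_linear_factor)
qed

text \<open>The factors commute, so in a shortest annihilating list each one can be moved to the
  front. If its \<open>l\<close> were no eigenvalue, \<open>f - l\<close> would be injective and
  could be cancelled, which leaves a shorter list.\<close>

lemma annihilating_list:
  assumes "p \<noteq> 0" and "\<And>x. poly_act p f x = 0"
  shows "\<exists>ls. (\<forall>x. linear_factors ls x = 0) \<and> (\<forall>l\<in>set ls. \<exists>v. v \<noteq> 0 \<and> f v = l *s v)"
proof -
  obtain M where p: "p = smult (lead_coeff p) (\<Prod>x\<in>#M. [:-x, 1:])"
    using alg_closed_imp_factorization[OF assms(1)] by blast
  obtain ls where ls: "mset ls = M" using ex_mset by blast
  have "(\<Prod>x\<in>#M. [:-x, 1:]) = (\<Prod>l\<leftarrow>ls. [:-l, 1:])"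
    using ls by (metis mset_map prod_mset_prod_list)
  then have "poly_act p f x = lead_coeff p *s linear_factors ls x" for x
    by (subst p) (simp add: poly_act_smult linear_factors_pact)
  then have "\<exists>ls. \<forall>x. linear_factors ls x = 0"
    using assms by (auto simp: vector_mul_eq_0)
  then obtain ls where ls: "\<forall>x. linear_factors ls x = 0"
      and min: "\<And>ms. \<forall>x. linear_factors ms x = 0 \<Longrightarrow> length ls \<le> length ms"
    using ex_has_least_nat[of "\<lambda>ls. \<forall>x. linear_factors ls x = 0" _ length] by blast
  have "\<exists>v. v \<noteq> 0 \<and> f v = l *s v" if "l \<in> set ls" for l
  proof (rule ccontr)
    assume no: "\<not> ?thesis"
    obtain as bs where ab: "ls = as @ l # bs" using \<open>l \<in> set ls\<close> by (meson split_list)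
    have "linear_factors (l # as @ bs) x = linear_factors ls x" for x
      using ab by (simp add: linear_factors_append linear_factors_f linear_factors_smult linear_factors_diff)
    then have "f (linear_factors (as @ bs) x) = l *s linear_factors (as @ bs) x" for x
      using ls by (metis linear_factors_simps(2) right_minus_eq)
    then have "\<forall>x. linear_factors (as @ bs) x = 0" using no by blast
    from min[OF this] ab show False by simp
  qed
  with ls show ?thesis by blast
qed

end

text \<open>Counting dimensions: the powers of \<open>A\<close> with exponents from 0 to the
  dimension of the matrix space are one too many to be independent. The degree is larger than in
  Cayley-Hamilton, but any annihilating polynomial will do.\<close>

lemma matrix_annihilating_poly:
  fixes A :: "real^'n^'n"
  shows "\<exists>p. p \<noteq> 0 \<and> (\<forall>x. poly_act p ((*v) (\<chi> i j. complex_of_real (A $ i $ j))) x = 0)"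
proof -
  define f where "f = (*v) (\<chi> i j. complex_of_real (A $ i $ j))"
  interpret complex_linear f
    by unfold_locales (simp_all add: f_def matrix_vector_right_distrib vector_scalar_commute)
  define pw where "pw k = (((**) A) ^^ k) (mat 1)" for k :: nat
  have f_pw: "(f ^^ k) x = (\<chi> i j. complex_of_real (pw k $ i $ j)) *v x" for k x
  proof (induction k)
    case 0
    have "(\<chi> i j. complex_of_real ((mat 1 :: real^'n^'n) $ i $ j)) = (mat 1 :: complex^'n^'n)"
      by (simp add: vec_eq_iff mat_def)
    then show ?case by (simp add: pw_def)
  next
    case (Suc k)
    have "(\<chi> i j. complex_of_real (pw (Suc k) $ i $ j)) =
      (\<chi> i j. complex_of_real (A $ i $ j)) ** (\<chi> i j. complex_of_real (pw k $ i $ j))"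
      by (simp add: pw_def vec_eq_iff matrix_matrix_mult_def)
    then show ?case using Suc by (simp add: f_def matrix_vector_mul_assoc)
  qed
  have "\<exists>p. p \<noteq> 0 \<and> (\<forall>x. poly_act p f x = 0)"
  \<comment> \<open>Dependence is a property of the set of powers, so repetitions are a case of
    their own: the difference of two equal powers annihilates.\<close>
  proof (cases "inj_on pw {..DIM(real^'n^'n)}")
    case False
    then obtain i j where ij: "i \<noteq> j" "pw i = pw j" by (auto simp: inj_on_def)
    let ?p = "monom 1 i + monom (-1) j :: complex poly"
    have "coeff ?p i = 1" using ij by simp
    then have "?p \<noteq> 0" by (metis coeff_0 zero_neq_one)
    moreover have "poly_act ?p f x = 0" for x
      using ij by (simp add: poly_act_add poly_act_monom f_pw flip: vector_sneg_minus1)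
    ultimately show ?thesis by blast
  next
    case True
    let ?I = "{..DIM(real^'n^'n)}"
    have "dependent (pw ` ?I)"
      by (rule dependent_biggerset) (simp only: card_image[OF True] card_atMost lessI)
    then obtain u where u: "\<exists>v\<in>pw ` ?I. u v \<noteq> 0" "(\<Sum>v\<in>pw ` ?I. u v *\<^sub>R v) = 0"
      by (auto simp: dependent_finite)
    define c where "c i = u (pw i)" for i
    obtain m where m: "m \<in> ?I" "c m \<noteq> 0" using u(1) by (auto simp: c_def)
    have c: "(\<Sum>i\<in>?I. c i *\<^sub>R pw i) = 0"
      using u(2) unfolding sum.reindex[OF True] c_def o_def .
    let ?p = "\<Sum>i\<in>?I. monom (complex_of_real (c i)) i"
    have "coeff ?p m = complex_of_real (c m)"
      using m(1) by (simp add: coeff_sum)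
    then have "?p \<noteq> 0" using m(2) by (metis coeff_0 of_real_eq_0_iff)
    moreover have "poly_act ?p f x = 0" for x
    proof -
      have "poly_act ?p f x $ k = 0" for k
      proof -
        have "poly_act ?p f x $ k = (\<Sum>i\<in>?I. \<Sum>j\<in>UNIV. complex_of_real (c i * pw i $ k $ j) * x $ j)"
          by (simp add: poly_act_sum poly_act_monom f_pw matrix_vector_mult_def sum_distrib_left mult.assoc)
        also have "\<dots> = (\<Sum>j\<in>UNIV. \<Sum>i\<in>?I. complex_of_real (c i * pw i $ k $ j) * x $ j)"
          by (rule sum.swap)
        also have "\<dots> = (\<Sum>j\<in>UNIV. complex_of_real ((\<Sum>i\<in>?I. c i *\<^sub>R pw i) $ k $ j) * x $ j)"
          by (simp add: sum_distrib_right)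
        finally show ?thesis unfolding c by simp
      qed
      then show ?thesis by (simp add: vec_eq_iff)
    qed
    ultimately show ?thesis by blast
  qed
  then show ?thesis by (simp add: f_def)
qed

section \<open>Quadratic forms, definite matrices and the Lyapunov inequality\<close>

lemma young: "2 * (x \<bullet> y) \<le> k * (norm x)\<^sup>2 + (norm y)\<^sup>2 / k" if "k > 0" for x y :: "'a::real_inner"
proof -
  have "0 \<le> (norm (k *\<^sub>R x - y))\<^sup>2 / k" using that by simp
  also have "(norm (k *\<^sub>R x - y))\<^sup>2 = k\<^sup>2 * (norm x)\<^sup>2 - 2 * k * (x \<bullet> y) + (norm y)\<^sup>2"
    unfolding power2_norm_eq_inner
    by (simp add: inner_diff_left inner_diff_right inner_commute power2_eq_square)
  also have "\<dots> / k = k * (norm x)\<^sup>2 + (norm y)\<^sup>2 / k - 2 * (x \<bullet> y)"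
    using that by (simp add: field_simps power2_eq_square)
  finally show ?thesis by simp
qed

lemma matrix_of_bilinear:
  fixes b :: "real^'n \<Rightarrow> real^'m \<Rightarrow> real"
  assumes "bilinear b"
  shows "\<exists>M. \<forall>x y. x \<bullet> (M *v y) = b x y"
proof -
  define M :: "real^'m^'n" where "M = (\<chi> i j. b (axis i 1) (axis j 1))"
  have "x \<bullet> (M *v y) = b x y" for x y
  proof -
    have "b x y = b (\<Sum>i\<in>UNIV. x $ i *s axis i 1) (\<Sum>j\<in>UNIV. y $ j *s axis j 1)"
      by (simp add: basis_expansion)
    also have "\<dots> = (\<Sum>(i,j)\<in>UNIV \<times> UNIV. b (x $ i *s axis i 1) (y $ j *s axis j 1))"
      by (rule bilinear_sum[OF assms])
    also have "\<dots> = (\<Sum>i\<in>UNIV. \<Sum>j\<in>UNIV. x $ i * (y $ j * M $ i $ j))"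
      unfolding sum.cartesian_product[symmetric] UNIV_Times_UNIV[symmetric]
      by (simp add: scalar_mult_eq_scaleR M_def bilinear_lmul[OF assms] bilinear_rmul[OF assms]
          mult.left_commute)
    finally show ?thesis
      by (simp add: inner_vec_def matrix_vector_mult_def sum_distrib_left mult.commute)
  qed
  then show ?thesis by blast
qed

lemma symmetric_matrix_iff:
  fixes M :: "real^'n^'n"
  shows "transpose M = M \<longleftrightarrow> (\<forall>x y. x \<bullet> (M *v y) = y \<bullet> (M *v x))"
proof
  assume "transpose M = M"
  then show "\<forall>x y. x \<bullet> (M *v y) = y \<bullet> (M *v x)"
    by (metis dot_lmul_matrix inner_commute transpose_matrix_vector)
next
  assume *: "\<forall>x y. x \<bullet> (M *v y) = y \<bullet> (M *v x)"
  have "transpose M *v x = M *v x" for x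
    by (rule vector_eq_rdot[THEN iffD1])
      (metis "*" dot_lmul_matrix inner_commute transpose_matrix_vector)
  then show "transpose M = M" by (simp add: matrix_eq)
qed

lemma inner_transpose:
  fixes M :: "real^'n^'m"
  shows "x \<bullet> (transpose M *v y) = (M *v x) \<bullet> y"
  by (metis dot_lmul_matrix inner_commute transpose_matrix_vector)

lemma matrix_vector_bound:
  fixes M :: "real^'n^'m"
  obtains L where "L > 0" "\<And>x. norm (M *v x) \<le> L * norm x"
  using linear_bounded_pos[OF matrix_vector_mul_linear[of M]] by (metis mult.commute)

lemma positive_definite_inverse:
  fixes X :: "real^'n^'n"
  assumes "positive_definite X"
  obtains Y where "positive_definite Y" "X ** Y = mat 1" "Y ** X = mat 1"
proof -
  have sym: "x \<bullet> (X *v y) = y \<bullet> (X *v x)" for x y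
    using assms symmetric_matrix_iff by (auto simp: positive_definite_def)
  have "\<forall>x. X *v x = 0 \<longrightarrow> x = 0"
    using assms by (metis inner_zero_right less_irrefl positive_definite_def)
  then have "invertible X"
    using matrix_left_invertible_ker invertible_left_inverse by blast
  then obtain Y where Y: "X ** Y = mat 1" "Y ** X = mat 1" by (auto simp: invertible_def)
  have XY: "X *v (Y *v x) = x" for x by (simp add: Y matrix_vector_mul_assoc)
  have "positive_definite Y"
    unfolding positive_definite_def symmetric_matrix_iff
  proof (intro conjI allI impI)
    fix x y show "x \<bullet> (Y *v y) = y \<bullet> (Y *v x)"
      by (metis XY inner_commute sym)
  next
    fix v :: "real^'n" assume "v \<noteq> 0"
    then have "Y *v v \<noteq> 0" using XY by (metis matrix_vector_mult_0_right)
    then have "(Y *v v) \<bullet> (X *v (Y *v v)) > 0" using assms by (auto simp: positive_definite_def)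
    then show "v \<bullet> (Y *v v) > 0" by (simp add: XY inner_commute)
  qed
  then show thesis using that Y by blast
qed

text \<open>As a real space, \<open>complex^'n\<close> carries the real part of the Hermitian
  product. Thus an eigenvalue enters the decay estimate through its real part alone.\<close>

lemma inner_complex_smult:
  fixes z :: "complex^'n"
  shows "z \<bullet> (l *s z) = Re l * (norm z)\<^sup>2"
proof -
  have "z $ i \<bullet> (l * z $ i) = Re l * (norm (z $ i))\<^sup>2" for i
    unfolding inner_complex_def cmod_power2 by (simp add: power2_eq_square algebra_simps)
  then show ?thesis
    by (simp add: inner_vec_def sum_distrib_left power2_norm_eq_inner)
qed

text \<open>With \<open>z\<^sub>k = (A - l\<^sub>1) \<cdots> (A - l\<^sub>k) x\<close> along the factors of an annihilating product we have
  \<open>z\<^sub>k' = l\<^sub>k\<^sub>+\<^sub>1 z\<^sub>k + z\<^sub>k\<^sub>+\<^sub>1\<close>, so \<open>\<Sum> r\<^sup>k |z\<^sub>k|\<^sup>2\<close> decays for a suitable weight \<open>r\<close>.\<close>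

lemma hurwitz_lyapunov:
  fixes A :: "real^'n^'n"
  assumes "hurwitz A"
  obtains P a where "positive_definite P" "a > 0"
    "\<And>x. x \<bullet> (P *v (A *v x)) \<le> - a * (norm x)\<^sup>2"
proof -
  define f where "f = (*v) (\<chi> i j. complex_of_real (A $ i $ j))"
  interpret complex_linear f
    by unfold_locales (simp_all add: f_def matrix_vector_right_distrib vector_scalar_commute)
  obtain p where p: "p \<noteq> 0" "\<And>x. poly_act p f x = 0"
    using matrix_annihilating_poly unfolding f_def by blast
  obtain ls where ls: "\<And>x. linear_factors ls x = 0"
      "\<And>l. l \<in> set ls \<Longrightarrow> \<exists>v. v \<noteq> 0 \<and> f v = l *s v"
    using annihilating_list[OF p] by auto
  have Re_neg: "Re l < 0" if "l \<in> set ls" for l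
    using ls(2)[OF that] assms unfolding hurwitz_def f_def by blast
  \<comment> \<open>A decay rate common to all factors; the 1 keeps the set nonempty.\<close>
  define a where "a = Min (insert 1 ((\<lambda>l. - Re l) ` set ls))"
  have a: "a > 0" and Re_a: "\<And>l. l \<in> set ls \<Longrightarrow> Re l \<le> - a"
  proof -
    show "a > 0" unfolding a_def by (subst Min_gr_iff) (auto simp: Re_neg)
    show "Re l \<le> - a" if "l \<in> set ls" for l
    proof -
      have "a \<le> - Re l" using that unfolding a_def by (intro Min_le) auto
      then show ?thesis by simp
    qed
  qed
  \<comment> \<open>With this weight the coupling of one level to the next, after Young's
    inequality, costs exactly half of the decay of the next level.\<close>
  define r where "r = 2 / a\<^sup>2"
  have r: "r > 0" using a by (simp add: r_def)
  define W where "W = rec_list (\<lambda>x y. 0)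
    (\<lambda>l ms w x y. w x y + r ^ length ms * (linear_factors ms x \<bullet> linear_factors ms y))"
  have W: "W [] x y = 0" "W (l # ms) x y = W ms x y + r ^ length ms * (linear_factors ms x \<bullet> linear_factors ms y)"
    for l ms x y by (simp_all add: W_def)
  have W_sym: "W ms x y = W ms y x" for ms x y
    by (induction ms) (simp_all add: W inner_commute)
  have W_add: "W ms x (y + z) = W ms x y + W ms x z" for ms x y z
    by (induction ms) (simp_all add: W linear_factors_add inner_add_right algebra_simps)
  have W_scale: "W ms x (of_real c *s y) = c * W ms x y" for ms x y c
  proof -
    have "of_real c *s z = c *\<^sub>R z" for z :: "complex^'n"
      unfolding vec_eq_iff vector_scaleR_component by (simp add: scaleR_conv_of_real)
    then have "linear_factors ms (of_real c *s y) = c *\<^sub>R linear_factors ms y" for ms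
      using linear_factors_smult by metis
    then show ?thesis
      by (induction ms) (simp_all add: W algebra_simps)
  qed
  have W_nonneg: "W ms x x \<ge> 0" for ms x
    using r by (induction ms) (simp_all add: W)
  \<comment> \<open>The last term is a debt: the coupling to the one vector whose square is not yet
    in the sum. The next factor of the list pays it, and for the full list it is 0 because that
    product annihilates.\<close>
  have W_dissip: "2 * W ms x (f x) \<le> - (a / 2) * W ms x x + r ^ length ms * (a / 2) * (norm (linear_factors ms x))\<^sup>2"
    if "set ms \<subseteq> set ls" for ms x
    using that
  proof (induction ms)
    case Nil
    then show ?case using a by (simp add: W)
  next
    case (Cons l ms)
    define z z' where "z = linear_factors ms x" and "z' = linear_factors (l # ms) x"
    have fz: "linear_factors ms (f x) = l *s z + z'" by (simp add: linear_factors_f z_def z'_def)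
    have "2 * (z \<bullet> z') \<le> a * (norm z)\<^sup>2 + (norm z')\<^sup>2 / a" by (rule young[OF a])
    moreover have "Re l * (norm z)\<^sup>2 \<le> - a * (norm z)\<^sup>2"
      using Cons.prems by (intro mult_right_mono Re_a) auto
    ultimately have "2 * (z \<bullet> linear_factors ms (f x)) \<le> - a * (norm z)\<^sup>2 + (norm z')\<^sup>2 / a"
      unfolding fz inner_add_right inner_complex_smult distrib_left mult_minus_left by linarith
    then have "r ^ length ms * (2 * (z \<bullet> linear_factors ms (f x)))
        \<le> r ^ length ms * (- a * (norm z)\<^sup>2 + (norm z')\<^sup>2 / a)"
      using r by (intro mult_left_mono) auto
    moreover have "r ^ length ms * ((norm z')\<^sup>2 / a) = r ^ length (l # ms) * (a / 2) * (norm z')\<^sup>2"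
      using a by (simp add: r_def field_simps power2_eq_square)
    moreover have "2 * W ms x (f x) \<le> - (a / 2) * W ms x x + r ^ length ms * (a / 2) * (norm z)\<^sup>2"
      using Cons by (simp add: z_def)
    moreover have "2 * (w + R * q) \<le> - (a / 2) * (v + R * zz) + Q"
      if "R * (2 * q) \<le> R * (- a * zz + t)" "R * t = Q" "2 * w \<le> - (a / 2) * v + R * (a / 2) * zz"
      for w q v zz t Q R :: real
      using that by (simp add: algebra_simps add_divide_distrib)
    moreover have "2 * (w + R * q) \<le> - (a / 2) * (v + R * zz) + Q"
      if "R * (2 * q) \<le> R * (- a * zz + t)" "R * t = Q" "2 * w \<le> - (a / 2) * v + R * (a / 2) * zz"
      for w q v zz t Q R :: real
      using that by (simp add: algebra_simps add_divide_distrib)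
    ultimately show ?case
      unfolding W z_def[symmetric] z'_def[symmetric] power2_norm_eq_inner[symmetric]
      by blast
  qed
  \<comment> \<open>\<open>W ls\<close> is a real bilinear form on the complex space;
    \<open>P\<close> represents its restriction to real vectors.\<close>
  define cx where "cx x = (\<chi> i. complex_of_real (x $ i))" for x :: "real^'n"
  have cx: "cx (x + y) = cx x + cx y" "cx (c *\<^sub>R x) = of_real c *s cx x" "f (cx x) = cx (A *v x)"
    for x y c by (simp_all add: cx_def f_def vec_eq_iff matrix_vector_mult_def)
  have norm_cx: "norm (cx x) = norm x" for x by (simp add: cx_def norm_vec_def)
  have "bilinear (\<lambda>x y. W ls (cx x) (cx y))"
  proof -
    have "linear (\<lambda>y. W ls (cx x) (cx y))" for x
      by (intro linearI) (simp_all add: cx W_add W_scale)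
    then show ?thesis unfolding bilinear_def by (subst (2) W_sym) blast
  qed
  then obtain P where P: "\<And>x y. x \<bullet> (P *v y) = W ls (cx x) (cx y)"
    using matrix_of_bilinear by blast
  \<comment> \<open>The empty suffix contributes the square of \<open>norm x\<close> with weight 1;
    the other summands are nonnegative.\<close>
  have W_lower: "W ls (cx x) (cx x) \<ge> (norm x)\<^sup>2" for x
  proof -
    have lower: "ms \<noteq> [] \<Longrightarrow> W ms y y \<ge> (norm y)\<^sup>2" for ms y
    proof (induction ms)
      case (Cons l ms)
      show ?case
      proof (cases "ms = []")
        case True
        then show ?thesis by (simp add: W power2_norm_eq_inner)
      next
        case False
        then have "W ms y y \<ge> (norm y)\<^sup>2" using Cons by blast
        moreover have "0 \<le> r ^ length ms * (linear_factors ms y \<bullet> linear_factors ms y)" using r by simp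
        ultimately show ?thesis by (simp only: W)
      qed
    qed simp
    have "ls \<noteq> []"
    proof
      assume "ls = []"
      then have "(1 :: complex^'n) = 0" using ls(1)[of 1] by simp
      then show False by (simp add: vec_eq_iff)
    qed
    from lower[OF this, of "cx x"] show ?thesis by (simp add: norm_cx)
  qed
  show thesis
  proof (rule that)
    show "positive_definite P"
      unfolding positive_definite_def symmetric_matrix_iff P
    proof (intro conjI allI impI)
      fix v :: "real^'n" assume "v \<noteq> 0"
      then have "0 < (norm v)\<^sup>2" by simp
      then show "0 < W ls (cx v) (cx v)" using W_lower[of v] by linarith
    qed (rule W_sym)
    show "a / 4 > 0" using a by simp
    fix x
    have "2 * (x \<bullet> (P *v (A *v x))) \<le> - (a / 2) * W ls (cx x) (cx x)"
      using W_dissip[of ls "cx x"] ls(1) by (simp add: P cx)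
    also have "\<dots> \<le> - (a / 2) * (norm x)\<^sup>2"
      using a W_lower[of x] by simp
    finally show "x \<bullet> (P *v (A *v x)) \<le> - (a / 4) * (norm x)\<^sup>2" by simp
  qed
qed

section \<open>Linear differential equations\<close>

lemma absolutely_integrable_inner_continuous:
  fixes f F :: "real \<Rightarrow> 'a::euclidean_space"
  assumes f: "f absolutely_integrable_on {a..b}" and F: "continuous_on {a..b} F"
  shows "(\<lambda>t. F t \<bullet> f t) absolutely_integrable_on {a..b}"
  by (rule absolutely_integrable_bounded_measurable_product[OF _ _ _ _ f])
    (use F in \<open>simp_all add: bilinear_conv_bounded_bilinear bounded_bilinear_inner
      compact_imp_bounded compact_continuous_image continuous_imp_measurable_on_sets_lebesgue\<close>)

lemma integral_shift_start:
  fixes f :: "real \<Rightarrow> 'a::banach"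
  assumes "f integrable_on {a..c}" "a \<le> b" "b \<le> c"
  shows "integral {b..c} f = integral {a..c} f - integral {a..b} f"
  using Henstock_Kurzweil_Integration.integral_combine[OF assms(2,3,1)] by (simp add: algebra_simps)

text \<open>On a short interval \<open>[s, t]\<close> replace \<open>G\<close> by \<open>G t\<close> and \<open>F\<close> by \<open>F s\<close>: the increment of
  \<open>F \<bullet> G\<close> is then exact, and the error is the oscillation times \<open>\<integral>|f| + |g|\<close>.\<close>

lemma ac_product_rule:
  fixes F G f g :: "real \<Rightarrow> 'a::euclidean_space"
  assumes T: "0 \<le> T"
    and f: "f absolutely_integrable_on {0..T}" and g: "g absolutely_integrable_on {0..T}"
    and F: "\<And>t. t \<in> {0..T} \<Longrightarrow> F t = F 0 + integral {0..t} f"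
    and G: "\<And>t. t \<in> {0..T} \<Longrightarrow> G t = G 0 + integral {0..t} g"
  shows "((\<lambda>t. G t \<bullet> f t + F t \<bullet> g t) has_integral F T \<bullet> G T - F 0 \<bullet> G 0) {0..T}"
proof -
  have intf: "f integrable_on {0..T}" and intg: "g integrable_on {0..T}"
    using f g by (auto simp: absolutely_integrable_on_def)
  have cont_int: "continuous_on {0..T} (\<lambda>t. c + integral {0..t} k)" if "k integrable_on {0..T}"
    for c :: 'a and k :: "real \<Rightarrow> 'a"
    using that by (intro continuous_intros indefinite_integral_continuous_1)
  have contF: "continuous_on {0..T} F"
    by (rule continuous_on_eq[OF cont_int[OF intf, of "F 0"]]) (rule F[symmetric])
  have contG: "continuous_on {0..T} G"
    by (rule continuous_on_eq[OF cont_int[OF intg, of "G 0"]]) (rule G[symmetric])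
  define h where "h t = G t \<bullet> f t + F t \<bullet> g t" for t
  define k where "k t = norm (f t) + norm (g t)" for t
  have h: "h integrable_on {0..T}"
    unfolding h_def
    by (intro integrable_add set_lebesgue_integral_eq_integral(1)
        absolutely_integrable_inner_continuous f g contF contG)
  have k: "k integrable_on {0..T}"
    unfolding k_def using f g by (intro integrable_add) (auto simp: absolutely_integrable_on_def)
  define \<Phi> where "\<Phi> t = F t \<bullet> G t - F 0 \<bullet> G 0 - integral {0..t} h" for t
  define N where "N t = integral {0..t} k" for t
  have step: "\<bar>\<Phi> t - \<Phi> s\<bar> \<le> e * (N t - N s)"
    if st: "0 \<le> s" "s \<le> t" "t \<le> T"
      and osc: "\<And>r. r \<in> {s..t} \<Longrightarrow> norm (G t - G r) \<le> e \<and> norm (F s - F r) \<le> e" for s t e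
  proof -
    have sub: "{s..t} \<subseteq> {0..T}" using st by auto
    have on_sub: "j integrable_on {s..t}" if "j integrable_on {0..T}" for j :: "real \<Rightarrow> 'b::euclidean_space"
      using integrable_on_subinterval[OF that sub] .
    have incr: "integral {s..t} j = integral {0..t} j - integral {0..s} j"
      if "j integrable_on {0..T}" for j :: "real \<Rightarrow> 'b::euclidean_space"
      using st integrable_on_subinterval[OF that, of 0 t]
      by (intro integral_shift_start) auto
    have "F t \<bullet> G t - F s \<bullet> G s = G t \<bullet> (F t - F s) + F s \<bullet> (G t - G s)"
      by (simp add: inner_diff_right inner_commute)
    also have "F t - F s = integral {s..t} f"
      using F[of t] F[of s] st incr[OF intf] by simp
    also have "G t - G s = integral {s..t} g"
      using G[of t] G[of s] st incr[OF intg] by simp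
    finally have "\<Phi> t - \<Phi> s = integral {s..t} (\<lambda>r. G t \<bullet> f r) + integral {s..t} (\<lambda>r. F s \<bullet> g r)
        - integral {s..t} h"
      using incr[OF h] integral_linear[OF on_sub[OF intf] bounded_linear_inner_right[of "G t"]]
        integral_linear[OF on_sub[OF intg] bounded_linear_inner_right[of "F s"]]
      by (simp add: \<Phi>_def o_def)
    also have "\<dots> = integral {s..t} (\<lambda>r. G t \<bullet> f r + F s \<bullet> g r - h r)"
    proof -
      have "(\<lambda>r. G t \<bullet> f r) integrable_on {s..t}" "(\<lambda>r. F s \<bullet> g r) integrable_on {s..t}"
        using on_sub[OF intf] on_sub[OF intg] by (auto intro: integrable_linear[unfolded o_def] bounded_linear_inner_right)
      then show ?thesis
        using on_sub[OF h] by (simp add: Henstock_Kurzweil_Integration.integral_add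
            Henstock_Kurzweil_Integration.integral_diff integrable_add)
    qed
    also have "\<bar>\<dots>\<bar> \<le> integral {s..t} (\<lambda>r. e * k r)"
      unfolding real_norm_def[symmetric]
    proof (rule integral_norm_bound_integral)
      show "(\<lambda>r. G t \<bullet> f r + F s \<bullet> g r - h r) integrable_on {s..t}"
        using integrable_linear[OF on_sub[OF intf] bounded_linear_inner_right]
          integrable_linear[OF on_sub[OF intg] bounded_linear_inner_right] on_sub[OF h]
        by (auto simp: o_def intro!: integrable_diff integrable_add)
      show "(\<lambda>r. e * k r) integrable_on {s..t}"
        by (intro integrable_on_mult_right on_sub k)
      fix r assume r: "r \<in> {s..t}"
      have "G t \<bullet> f r + F s \<bullet> g r - h r = (G t - G r) \<bullet> f r + (F s - F r) \<bullet> g r"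
        by (simp add: h_def inner_diff_left)
      also have "norm \<dots> \<le> norm (G t - G r) * norm (f r) + norm (F s - F r) * norm (g r)"
        by (rule norm_triangle_mono) (simp_all add: Cauchy_Schwarz_ineq2)
      also have "\<dots> \<le> e * norm (f r) + e * norm (g r)"
        using osc[OF r] by (intro add_mono mult_right_mono) auto
      finally show "norm (G t \<bullet> f r + F s \<bullet> g r - h r) \<le> e * k r"
        by (simp add: k_def distrib_left)
    qed
    also have "\<dots> = e * (N t - N s)"
      using incr[OF k] by (simp add: N_def)
    finally show ?thesis .
  qed
  \<comment> \<open>Cut \<open>{0..T}\<close> into steps shorter than both moduli of uniform
    continuity; the estimates of \<open>step\<close> telescope.\<close>
  have bound: "\<bar>\<Phi> T\<bar> \<le> e * N T" if e: "e > 0" for e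
  proof -
    have uc: "uniformly_continuous_on {0..T} F" "uniformly_continuous_on {0..T} G"
      using contF contG by (auto intro: compact_uniformly_continuous)
    obtain d1 where d1: "d1 > 0" "\<And>x y. \<lbrakk>x \<in> {0..T}; y \<in> {0..T}; dist y x < d1\<rbrakk> \<Longrightarrow> dist (F y) (F x) < e"
      using uc(1) e unfolding uniformly_continuous_on_def by metis
    obtain d2 where d2: "d2 > 0" "\<And>x y. \<lbrakk>x \<in> {0..T}; y \<in> {0..T}; dist y x < d2\<rbrakk> \<Longrightarrow> dist (G y) (G x) < e"
      using uc(2) e unfolding uniformly_continuous_on_def by metis
    obtain n where n: "T / min d1 d2 < real n" using reals_Archimedean2 by blast
    then have n0: "n > 0" using T d1(1) d2(1)
      by (metis divide_nonneg_pos gr0I min_less_iff_conj not_le of_nat_0)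
    define \<tau> where "\<tau> = T / n"
    have "\<tau> < min d1 d2"
      using n n0 d1(1) d2(1) unfolding \<tau>_def
      by (metis less_divide_eq min_less_iff_conj mult.commute of_nat_0_less_iff divide_less_eq)
    then have \<tau>: "0 \<le> \<tau>" "\<tau> < d1" "\<tau> < d2" "real n * \<tau> = T"
      using n0 T by (auto simp: \<tau>_def)
    have "i \<le> n \<Longrightarrow> \<bar>\<Phi> (real i * \<tau>)\<bar> \<le> e * N (real i * \<tau>)" for i
    proof (induction i)
      case 0
      then show ?case by (simp add: \<Phi>_def N_def)
    next
      case (Suc i)
      have le: "real (Suc i) * \<tau> \<le> T"
        using Suc.prems \<tau> by (metis mult_right_mono of_nat_le_iff)
      have ge: "0 \<le> real i * \<tau>" using \<tau> by simp
      have eq: "real (Suc i) * \<tau> = real i * \<tau> + \<tau>" by (simp add: algebra_simps)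
      have "\<bar>\<Phi> (real (Suc i) * \<tau>) - \<Phi> (real i * \<tau>)\<bar> \<le> e * (N (real (Suc i) * \<tau>) - N (real i * \<tau>))"
      proof (rule step)
        fix r assume r0: "r \<in> {real i * \<tau>..real (Suc i) * \<tau>}"
        define lo hi where "lo = real i * \<tau>" and "hi = real (Suc i) * \<tau>"
        have b: "0 \<le> lo" "lo \<le> r" "r \<le> hi" "hi \<le> T" "hi = lo + \<tau>"
          using r0 le ge eq by (auto simp: lo_def hi_def)
        then have "dist (G hi) (G r) < e"
          using \<tau> by (intro d2(2)) (auto simp: dist_real_def)
        moreover have "dist (F lo) (F r) < e"
          using b \<tau> by (intro d1(2)) (auto simp: dist_real_def)
        ultimately show "norm (G (real (Suc i) * \<tau>) - G r) \<le> e \<and> norm (F (real i * \<tau>) - F r) \<le> e"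
          by (simp add: dist_norm lo_def hi_def)
      qed (use le ge eq \<tau> in auto)
      then show ?case using Suc by (simp add: right_diff_distrib)
    qed
    from this[of n] show ?thesis using \<tau> by simp
  qed
  have "\<Phi> T = 0"
  proof (rule ccontr)
    assume nz: "\<Phi> T \<noteq> 0"
    have "N T \<ge> 0" unfolding N_def by (rule integral_nonneg[OF k]) (simp add: k_def)
    \<comment> \<open>This \<open>e\<close> makes the bound smaller than the left side; the 1 covers
      \<open>N T = 0\<close>.\<close>
    then have "\<bar>\<Phi> T\<bar> \<le> \<bar>\<Phi> T\<bar> / (2 * (N T + 1)) * N T"
      using nz by (intro bound) simp
    also have "\<dots> < \<bar>\<Phi> T\<bar>"
    proof -
      have "N T / (2 * (N T + 1)) < 1" using \<open>N T \<ge> 0\<close> by simp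
      then have "\<bar>\<Phi> T\<bar> * (N T / (2 * (N T + 1))) < \<bar>\<Phi> T\<bar> * 1"
        using nz by (intro mult_strict_left_mono) auto
      then show ?thesis by simp
    qed
    finally show False by simp
  qed
  then have "integral {0..T} h = F T \<bullet> G T - F 0 \<bullet> G 0" by (simp add: \<Phi>_def)
  with h have "(h has_integral F T \<bullet> G T - F 0 \<bullet> G 0) {0..T}"
    by (metis has_integral_integral)
  then show ?thesis unfolding h_def .
qed

section \<open>Existence and uniqueness of trajectories by Picard iteration\<close>

text \<open>Each integration turns one term of the exponential series into the next. The sequence
  \<open>w\<close> is general because existence applies this to the summands of the Picard series,
  and uniqueness to a constant sequence.\<close>

lemma picard_bound:
  fixes A :: "real^'n^'n" and w :: "nat \<Rightarrow> real \<Rightarrow> real^'n"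
  assumes w0: "\<And>t. t \<in> {0..T} \<Longrightarrow> norm (w 0 t) \<le> C"
    and cont: "\<And>n. continuous_on {0..T} (w n)"
    and step: "\<And>n t. t \<in> {0..T} \<Longrightarrow> w (Suc n) t = integral {0..t} (\<lambda>s. A *v w n s)"
    and L: "\<And>v. norm (A *v v) \<le> L * norm v" "L \<ge> 0"
    and t: "t \<in> {0..T}"
  shows "norm (w n t) \<le> C * (L * t) ^ n / fact n"
  using t
proof (induction n arbitrary: t)
  case 0
  then show ?case using w0 by simp
next
  case (Suc n)
  have sub: "{0..t} \<subseteq> {0..T}" using Suc.prems by auto
  let ?B = "\<lambda>s. C * (L * s) ^ Suc n / fact (Suc n)"
  have "(?B has_real_derivative L * (C * (L * s) ^ n / fact n)) (at s within {0..t})" for s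
  proof -
    have "((\<lambda>s. L * s) has_real_derivative L) (at s within {0..t})"
      by (auto intro!: derivative_eq_intros)
    then have "(?B has_real_derivative C * ((1 + real n) * (L * (L * s) ^ n)) / fact (Suc n)) (at s within {0..t})"
      by (intro DERIV_cdivide DERIV_cmult DERIV_power_Suc)
    moreover have "C * (m * (L * y)) / (m * k) = L * (C * y / k)" if "m \<noteq> 0" for m y k :: real
      using that by simp
    from this[of "real (Suc n)" "(L * s) ^ n" "fact n"]
    have "C * ((1 + real n) * (L * (L * s) ^ n)) / fact (Suc n) = L * (C * (L * s) ^ n / fact n)"
      by (simp only: fact_Suc of_nat_Suc)
    ultimately show ?thesis by (simp only:)
  qed
  then have int: "((\<lambda>s. L * (C * (L * s) ^ n / fact n)) has_integral ?B t - ?B 0) {0..t}"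
    using Suc.prems
    by (intro fundamental_theorem_of_calculus) (auto simp: has_real_derivative_iff_has_vector_derivative)
  have "norm (w (Suc n) t) = norm (integral {0..t} (\<lambda>s. A *v w n s))"
    using step Suc.prems by simp
  also have "\<dots> \<le> integral {0..t} (\<lambda>s. L * (C * (L * s) ^ n / fact n))"
  proof (rule integral_norm_bound_integral)
    show "(\<lambda>s. A *v w n s) integrable_on {0..t}"
      by (intro integrable_continuous_real matrix_vector_mult_linear_continuous_on
          continuous_on_compose2[OF matrix_vector_mult_linear_continuous_on continuous_on_subset[OF cont sub]]) auto
    show "(\<lambda>s. L * (C * (L * s) ^ n / fact n)) integrable_on {0..t}" using int by blast
    fix s assume "s \<in> {0..t}"
    then have "norm (w n s) \<le> C * (L * s) ^ n / fact n" using Suc.IH sub by blast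
    then show "norm (A *v w n s) \<le> L * (C * (L * s) ^ n / fact n)"
      by (meson L mult_left_mono order_trans)
  qed
  also have "\<dots> = ?B t" unfolding integral_unique[OF int] by simp
  finally show ?case .
qed

text \<open>A Caratheodory trajectory starting at 0 at time 0, with all inputs merged into one
  forcing term \<open>f\<close>.\<close>

definition linear_trajectory ::
  "real^'n^'n \<Rightarrow> (real \<Rightarrow> real^'n) \<Rightarrow> (real \<Rightarrow> real^'n) \<Rightarrow> bool" where
  "linear_trajectory A f x \<longleftrightarrow>
     (\<forall>t\<ge>0. (\<lambda>s. A *v x s + f s) absolutely_integrable_on {0..t} \<and>
            x t = integral {0..t} (\<lambda>s. A *v x s + f s))"

lemma linear_trajectory_continuous:
  assumes "linear_trajectory A f x"
  shows "continuous_on {0..T} x"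
proof (cases "T \<ge> 0")
  case True
  then have "(\<lambda>s. A *v x s + f s) integrable_on {0..T}"
    using assms by (auto simp: linear_trajectory_def absolutely_integrable_on_def)
  then have "continuous_on {0..T} (\<lambda>t. integral {0..t} (\<lambda>s. A *v x s + f s))"
    by (rule indefinite_integral_continuous_1)
  then show ?thesis
    by (rule continuous_on_eq) (use assms in \<open>simp add: linear_trajectory_def\<close>)
qed simp

lemma continuous_on_matrix_vector_mult:
  fixes A :: "real^'n^'m"
  shows "continuous_on S x \<Longrightarrow> continuous_on S (\<lambda>t. A *v x t)"
  using continuous_on_compose2[OF matrix_vector_mult_linear_continuous_on[of UNIV A]] by auto

lemma linear_trajectory_unique:
  assumes x: "linear_trajectory A f x" and y: "linear_trajectory A f y" and t: "t \<ge> 0"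
  shows "x t = y t"
proof -
  define e where "e s = x s - y s" for s
  have cont: "continuous_on {0..t} e"
    unfolding e_def by (intro continuous_intros linear_trajectory_continuous[OF x] linear_trajectory_continuous[OF y])
  have "bounded (e ` {0..t})"
    by (intro compact_imp_bounded compact_continuous_image cont) simp
  then obtain C where C: "\<And>s. s \<in> {0..t} \<Longrightarrow> norm (e s) \<le> C"
    unfolding bounded_iff by (metis imageI)
  obtain L where L: "L > 0" "\<And>v. norm (A *v v) \<le> L * norm v" using matrix_vector_bound[of A] by metis
  have e: "e s = integral {0..s} (\<lambda>r. A *v e r)" if "s \<in> {0..t}" for s
  proof -
    have "(\<lambda>r. A *v x r + f r) integrable_on {0..s}" "(\<lambda>r. A *v y r + f r) integrable_on {0..s}"
      using x y that by (auto simp: linear_trajectory_def absolutely_integrable_on_def)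
    from integral_diff[OF this] show ?thesis
      using x y that by (simp add: linear_trajectory_def e_def matrix_vector_mult_diff_distrib)
  qed
  \<comment> \<open>The difference \<open>e\<close> is a fixed point of the homogeneous integral
    operator, so the constant sequence \<open>e\<close> satisfies the Picard recursion, and the
    bound tends to 0 with \<open>n\<close>.\<close>
  have "norm (e t) \<le> C * ((L * t) ^ n / fact n)" for n
    using picard_bound[of t "\<lambda>_. e" C A L t n, OF C cont e L(2)] L(1) t by simp
  moreover have "(\<lambda>n. C * ((L * t) ^ n / fact n)) \<longlonglongrightarrow> C * 0"
    using summable_LIMSEQ_zero[OF summable_exp[of "L * t"]]
    by (intro tendsto_mult tendsto_const) (simp add: divide_inverse mult.commute)
  ultimately have "norm (e t) \<le> C * 0"
    by (intro LIMSEQ_le_const) auto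
  then show ?thesis by (simp add: e_def)
qed

text \<open>The Picard series: its first summand is the integral of \<open>f\<close>, each further
  one the integral of \<open>A\<close> times the previous one. It converges uniformly on every
  \<open>{0..T}\<close> by comparison with an exponential series, hence may be integrated
  termwise.\<close>

lemma linear_trajectory_exists:
  fixes A :: "real^'n^'n"
  assumes f: "\<And>t. t \<ge> 0 \<Longrightarrow> f absolutely_integrable_on {0..t}"
  obtains x where "linear_trajectory A f x"
proof -
  obtain L where L: "L > 0" "\<And>v. norm (A *v v) \<le> L * norm v" using matrix_vector_bound[of A] by metis
  have intf: "f integrable_on {0..t}" "(\<lambda>s. norm (f s)) integrable_on {0..t}" if "t \<ge> 0" for t
    using f[OF that] by (auto simp: absolutely_integrable_on_def)
  define z where "z = rec_nat (\<lambda>t. integral {0..t} f) (\<lambda>_ w t. integral {0..t} (\<lambda>s. A *v w s))"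
  have z0: "z 0 t = integral {0..t} f"
    and z_Suc: "z (Suc n) t = integral {0..t} (\<lambda>s. A *v z n s)" for n t
    by (simp_all add: z_def)
  have cont: "continuous_on {0..T} (z n)" if "T \<ge> 0" for n T
  proof (induction n)
    case 0
    then show ?case unfolding z0[abs_def]
      by (intro indefinite_integral_continuous_1 intf that)
  next
    case (Suc n)
    then show ?case unfolding z_Suc[abs_def]
      by (intro indefinite_integral_continuous_1 integrable_continuous_real continuous_on_matrix_vector_mult)
  qed
  define x where "x t = (\<Sum>n. z n t)" for t
  have unif: "uniform_limit {0..T} (\<lambda>N t. \<Sum>n<N. z n t) x sequentially" if T: "T \<ge> 0" for T
    unfolding x_def
  proof (rule Weierstrass_m_test)
    define C where "C = integral {0..T} (\<lambda>s. norm (f s))"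
    have C: "norm (z 0 t) \<le> C" if t: "t \<in> {0..T}" for t
    proof -
      have "norm (z 0 t) \<le> integral {0..t} (\<lambda>s. norm (f s))"
        unfolding z0 using t by (intro integral_norm_bound_integral intf) auto
      also have "\<dots> \<le> C"
        unfolding C_def using t T by (intro integral_subset_le intf) auto
      finally show ?thesis .
    qed
    then have "C \<ge> 0" using T by (meson atLeastAtMost_iff norm_ge_zero order_refl order_trans)
    show "norm (z n t) \<le> C * ((L * T) ^ n / fact n)" if t: "t \<in> {0..T}" for n t
    proof -
      have "norm (z n t) \<le> C * (L * t) ^ n / fact n"
        using L by (intro picard_bound[where A = A and T = T] C cont z_Suc t T) auto
      also have "\<dots> \<le> C * ((L * T) ^ n / fact n)"
        using L t \<open>C \<ge> 0\<close> by (auto intro!: mult_left_mono divide_right_mono power_mono simp flip: times_divide_eq_right)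
      finally show ?thesis .
    qed
    show "summable (\<lambda>n. C * ((L * T) ^ n / fact n))"
      using summable_exp_generic[of "L * T"] by (intro summable_mult) (simp add: divide_inverse mult.commute)
  qed
  have contx: "continuous_on {0..T} x" if T: "T \<ge> 0" for T
    by (rule uniform_limit_theorem[OF _ unif[OF T]])
      (auto intro!: eventuallyI continuous_intros cont T)
  have "linear_trajectory A f x"
    unfolding linear_trajectory_def
  proof (intro allI impI conjI)
    fix t :: real assume t: "t \<ge> 0"
    have cAx: "continuous_on {0..t} (\<lambda>s. A *v x s)"
      by (intro continuous_on_matrix_vector_mult contx t)
    show "(\<lambda>s. A *v x s + f s) absolutely_integrable_on {0..t}"
      by (intro set_integral_add absolutely_integrable_continuous_real f t cAx)
    have "uniform_limit {0..t} (\<lambda>N s. A *v (\<Sum>n<N. z n s)) (\<lambda>s. A *v x s) sequentially"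
      by (intro bounded_linear.uniform_limit[OF matrix_vector_mul_bounded_linear] unif t)
    moreover have "continuous_on {0..t} (\<lambda>s. A *v (\<Sum>n<N. z n s))" for N
      by (intro continuous_on_matrix_vector_mult continuous_intros cont t)
    ultimately obtain I J where I: "\<And>N. ((\<lambda>s. A *v (\<Sum>n<N. z n s)) has_integral I N) {0..t}"
      and J: "((\<lambda>s. A *v x s) has_integral J) {0..t}" and lim: "I \<longlonglongrightarrow> J"
      by (elim uniform_limit_integral) auto
    \<comment> \<open>Integrating \<open>A\<close> times a summand shifts the index by one, so only
      the summand 0 is missing; it supplies the forcing term.\<close>
    have "I N = (\<Sum>n<Suc N. z n t) - z 0 t" for N
    proof -
      have "integral {0..t} (\<lambda>s. A *v (\<Sum>n<N. z n s)) = (\<Sum>n<N. integral {0..t} (\<lambda>s. A *v z n s))"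
        unfolding linear_sum[OF matrix_vector_mul_linear]
        by (intro integral_sum integrable_continuous_real continuous_on_matrix_vector_mult cont t) simp
      then show ?thesis
        using I[of N] by (simp add: integral_unique z_Suc[symmetric] sum.lessThan_Suc_shift del: sum.lessThan_Suc)
    qed
    then have "I = (\<lambda>N. (\<Sum>n<Suc N. z n t) - z 0 t)" by blast
    moreover have "(\<lambda>N. (\<Sum>n<N. z n t)) \<longlonglongrightarrow> x t"
      using tendsto_uniform_limitI[OF unif[OF t], of t] t by simp
    then have "(\<lambda>N. (\<Sum>n<Suc N. z n t) - z 0 t) \<longlonglongrightarrow> x t - z 0 t"
      by (intro tendsto_intros LIMSEQ_Suc)
    ultimately have "J = x t - z 0 t" using lim LIMSEQ_unique by blast
    then show "x t = integral {0..t} (\<lambda>s. A *v x s + f s)"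
      using J intf[OF t] by (simp add: integral_add has_integral_integrable integral_unique z0)
  qed
  then show thesis by (rule that)
qed

section \<open>Square integrable signals\<close>

abbreviation energy :: "(real \<Rightarrow> 'a::real_normed_vector) \<Rightarrow> real" where
  "energy u \<equiv> integral {0..} (\<lambda>t. (norm (u t))\<^sup>2)"

text \<open>For nonnegative functions Lebesgue and Henstock-Kurzweil integrability agree. This moves
  the definition of \<open>L2\<close> to the integral in which trajectories are expressed.\<close>

lemma L2_iff:
  "u \<in> L2 \<longleftrightarrow> u \<in> borel_measurable (lebesgue_on {0..}) \<and> (\<lambda>t. (norm (u t))\<^sup>2) integrable_on {0..}"
proof -
  have "integrable (lebesgue_on {0..}) (\<lambda>t. (norm (u t))\<^sup>2) \<longleftrightarrow>
      (\<lambda>t. (norm (u t))\<^sup>2) absolutely_integrable_on {0..}"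
    by (simp add: set_integrable_def integrable_restrict_space)
  then show ?thesis by (simp add: L2_def absolutely_integrable_on_iff_nonneg)
qed

lemma L2norm_power2:
  assumes "u \<in> L2"
  shows "(L2norm u)\<^sup>2 = energy u"
proof -
  have "integrable (lebesgue_on {0..}) (\<lambda>t. (norm (u t))\<^sup>2)" using assms by (simp add: L2_def)
  then have "integral\<^sup>L (lebesgue_on {0..}) (\<lambda>t. (norm (u t))\<^sup>2) = energy u"
    by (rule lebesgue_integral_eq_integral) simp
  moreover have "integral\<^sup>L (lebesgue_on {0..}) (\<lambda>t. (norm (u t))\<^sup>2) \<ge> 0"
    by simp
  ultimately show ?thesis by (simp add: L2norm_def)
qed

lemma L2_cong:
  assumes "\<And>t. t \<ge> 0 \<Longrightarrow> u t = v t"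
  shows "u \<in> L2 \<longleftrightarrow> v \<in> L2"
proof -
  have "u \<in> borel_measurable (lebesgue_on {0..}) \<longleftrightarrow> v \<in> borel_measurable (lebesgue_on {0..})"
    by (rule measurable_cong) (simp add: assms)
  moreover have "(\<lambda>t. (norm (u t))\<^sup>2) integrable_on {0..} \<longleftrightarrow> (\<lambda>t. (norm (v t))\<^sup>2) integrable_on {0..}"
    by (rule integrable_cong) (simp add: assms)
  ultimately show ?thesis by (simp add: L2_iff)
qed

lemma L2norm_cong:
  assumes "\<And>t. t \<ge> 0 \<Longrightarrow> u t = v t"
  shows "L2norm u = L2norm v"
  unfolding L2norm_def using assms by (intro arg_cong[where f = sqrt] Bochner_Integration.integral_cong) auto

lemma L2_dominated:
  assumes "u \<in> borel_measurable (lebesgue_on {0..})" "g integrable_on {0..}"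
    and "\<And>t. t \<ge> 0 \<Longrightarrow> (norm (u t))\<^sup>2 \<le> g t"
  shows "u \<in> L2"
proof -
  have "(\<lambda>t. (norm (u t))\<^sup>2) \<in> borel_measurable (lebesgue_on {0..})"
    using assms(1) by measurable
  then have "(\<lambda>t. (norm (u t))\<^sup>2) absolutely_integrable_on {0..}"
    by (rule measurable_bounded_by_integrable_imp_absolutely_integrable[OF _ _ assms(2)])
      (use assms(3) in auto)
  then show ?thesis using assms(1) by (simp add: L2_iff absolutely_integrable_on_iff_nonneg)
qed

lemma norm_add_power2_le: "(norm (a + b))\<^sup>2 \<le> 2 * (norm a)\<^sup>2 + 2 * (norm b)\<^sup>2"
  for a b :: "'a::real_inner"
proof -
  have "0 \<le> (norm (a - b))\<^sup>2" by simp
  then show ?thesis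
    by (simp add: power2_norm_eq_inner inner_add_left inner_add_right inner_diff_left inner_diff_right
        inner_commute)
qed

lemma L2_add:
  assumes "u \<in> L2" "v \<in> L2"
  shows "(\<lambda>t. u t + v t) \<in> L2"
proof (rule L2_dominated)
  show "(\<lambda>t. u t + v t) \<in> borel_measurable (lebesgue_on {0..})"
    using assms by (auto simp: L2_iff)
  show "(\<lambda>t. 2 * (norm (u t))\<^sup>2 + 2 * (norm (v t))\<^sup>2) integrable_on {0..}"
    using assms by (intro integrable_add integrable_on_mult_right) (auto simp: L2_iff)
qed (rule norm_add_power2_le)

lemma borel_measurable_matrix_vector_mult:
  fixes M :: "real^'n^'m"
  assumes "u \<in> borel_measurable N"
  shows "(\<lambda>t. M *v u t) \<in> borel_measurable N"
  by (rule borel_measurable_continuous_on[OF matrix_vector_mult_linear_continuous_on assms])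

lemma L2_matrix:
  fixes M :: "real^'n^'m"
  assumes "u \<in> L2"
  shows "(\<lambda>t. M *v u t) \<in> L2"
proof -
  obtain L where L: "L > 0" "\<And>x. norm (M *v x) \<le> L * norm x" using matrix_vector_bound[of M] by metis
  show ?thesis
  proof (rule L2_dominated)
    show "(\<lambda>t. M *v u t) \<in> borel_measurable (lebesgue_on {0..})"
      using assms by (intro borel_measurable_matrix_vector_mult) (simp add: L2_iff)
    show "(\<lambda>t. L\<^sup>2 * (norm (u t))\<^sup>2) integrable_on {0..}"
      using assms by (intro integrable_on_mult_right) (simp add: L2_iff)
    show "(norm (M *v u t))\<^sup>2 \<le> L\<^sup>2 * (norm (u t))\<^sup>2" for t
      using power_mono[OF L(2)[of "u t"], of 2] by (simp add: power_mult_distrib)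
  qed
qed

lemma L2_inner_integrable:
  assumes "u \<in> L2" "v \<in> L2"
  shows "(\<lambda>t. u t \<bullet> v t) integrable_on {0..}"
proof -
  have "(\<lambda>t. u t \<bullet> v t) \<in> borel_measurable (lebesgue_on {0..})"
    using assms by (auto simp: L2_iff)
  then have "(\<lambda>t. u t \<bullet> v t) absolutely_integrable_on {0..}"
  proof (rule measurable_bounded_by_integrable_imp_absolutely_integrable)
    show "(\<lambda>t. (norm (u t))\<^sup>2 + (norm (v t))\<^sup>2) integrable_on {0..}"
      using assms by (intro integrable_add) (auto simp: L2_iff)
    fix t
    have "norm (u t \<bullet> v t) \<le> norm (u t) * norm (v t)" by (simp add: Cauchy_Schwarz_ineq2)
    also have "2 * (norm (u t) * norm (v t)) \<le> (norm (u t))\<^sup>2 + (norm (v t))\<^sup>2"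
      using sum_squares_bound[of "norm (u t)" "norm (v t)"] by (simp add: mult.assoc)
    then have "norm (u t) * norm (v t) \<le> (norm (u t))\<^sup>2 + (norm (v t))\<^sup>2"
      using mult_nonneg_nonneg[OF norm_ge_zero[of "u t"] norm_ge_zero[of "v t"]] by linarith
    finally show "norm (u t \<bullet> v t) \<le> (norm (u t))\<^sup>2 + (norm (v t))\<^sup>2" .
  qed simp
  then show ?thesis using set_lebesgue_integral_eq_integral(1) by blast
qed

lemma integrable_on_Icc_if_Ici:
  fixes f :: "real \<Rightarrow> 'a::banach"
  assumes "f integrable_on {0..}"
  shows "f integrable_on {0..T}"
  by (rule integrable_on_subinterval[OF assms]) auto

lemma L2_absolutely_integrable:
  assumes "u \<in> L2"
  shows "u absolutely_integrable_on {0..T}"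
proof (rule measurable_bounded_by_integrable_imp_absolutely_integrable)
  show "u \<in> borel_measurable (lebesgue_on {0..T})"
    by (rule measurable_restrict_mono[of _ _ "{0..}"]) (use assms in \<open>auto simp: L2_iff\<close>)
  show "(\<lambda>t. 1 + (norm (u t))\<^sup>2) integrable_on {0..T}"
    using assms by (intro integrable_add integrable_on_Icc_if_Ici integrable_const_ivl) (auto simp: L2_iff)
  show "norm (u t) \<le> 1 + (norm (u t))\<^sup>2" for t
    using sum_squares_bound[of 1 "norm (u t)"] norm_ge_zero[of "u t"] unfolding power2_eq_square by linarith
qed simp

text \<open>Monotone convergence for truncations to \<open>{0..k}\<close>. It turns estimates that
  are uniform in the horizon into estimates on the half-line.\<close>

lemma nonneg_integrable_Ici:
  fixes h :: "real \<Rightarrow> real"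
  assumes int: "\<And>T. T \<ge> 0 \<Longrightarrow> h integrable_on {0..T}" and nonneg: "\<And>t. t \<ge> 0 \<Longrightarrow> h t \<ge> 0"
    and bound: "\<And>T. T \<ge> 0 \<Longrightarrow> integral {0..T} h \<le> K"
  shows "h integrable_on {0..}" "integral {0..} h \<le> K"
proof -
  define f where "f k t = (if t \<in> {0..real k} then h t else 0)" for k :: nat and t
  have int_f: "f k integrable_on {0..}" and f_eq: "integral {0..} (f k) = integral {0..real k} h" for k
  proof -
    have sub: "{0..real k} \<subseteq> {0..}" by auto
    show "f k integrable_on {0..}"
      unfolding f_def using int[of "real k"] integrable_restrict_Int[of "{0..real k}" h "{0..}"] sub
      by (simp add: Int_absorb1 Int_absorb2)
    show "integral {0..} (f k) = integral {0..real k} h"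
      unfolding f_def using integral_restrict_Int[of "{0..}" "{0..real k}" h] sub
      by (simp add: Int_absorb1 Int_absorb2)
  qed
  have "h integrable_on {0..} \<and> (\<lambda>k. integral {0..} (f k)) \<longlonglongrightarrow> integral {0..} h"
  proof (rule monotone_convergence_increasing[OF int_f])
    show "f k t \<le> f (Suc k) t" if "t \<in> {0..}" for k t
      using nonneg that by (auto simp: f_def)
    show "(\<lambda>k. f k t) \<longlonglongrightarrow> h t" if t: "t \<in> {0..}" for t
    proof (rule tendsto_eventually)
      obtain n where "t \<le> real n" using real_arch_simple by blast
      then show "\<forall>\<^sub>F k in sequentially. f k t = h t"
        using t by (intro eventually_sequentiallyI[of n]) (auto simp: f_def)
    qed
    have "0 \<le> integral {0..real k} h" for k
      by (intro integral_nonneg int) (auto simp: nonneg)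
    then have "norm (integral {0..} (f k)) \<le> K" for k
      using bound[of "real k"] by (simp add: f_eq)
    then show "bounded (range (\<lambda>k. integral {0..} (f k)))" by (auto simp: bounded_iff)
  qed
  then show "h integrable_on {0..}" "integral {0..} h \<le> K"
    using bound by (auto simp: f_eq intro: LIMSEQ_le_const2)
qed

section \<open>Energy estimates along trajectories\<close>

lemma linear_trajectory_measurable:
  assumes "linear_trajectory A f x"
  shows "x \<in> borel_measurable (lebesgue_on {0..})"
proof (rule continuous_imp_measurable_on_sets_lebesgue)
  show "continuous_on {0..} x"
    unfolding continuous_on_eq_continuous_within
  proof
    fix t :: real assume t: "t \<in> {0..}"
    have "continuous_on {0..t + 1} x" by (rule linear_trajectory_continuous[OF assms])
    then have "continuous (at t within {0..t + 1}) x"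
      using t by (auto simp: continuous_on_eq_continuous_within)
    moreover have "at t within {0..t + 1} = at t within {0..}"
      by (rule at_within_nhd[of _ "{..<t + 1}"]) auto
    ultimately show "continuous (at t within {0..}) x" by simp
  qed
qed simp

text \<open>The product rule for \<open>x\<close> and \<open>P *v x\<close>; symmetry merges the two
  terms, and the value at time 0 vanishes since trajectories start at 0.\<close>

lemma linear_trajectory_storage:
  fixes P :: "real^'n^'n"
  assumes x: "linear_trajectory A f x" and P: "transpose P = P" and T: "T \<ge> 0"
  shows "((\<lambda>t. 2 * (x t \<bullet> (P *v (A *v x t + f t)))) has_integral x T \<bullet> (P *v x T)) {0..T}"
proof -
  define g where "g t = A *v x t + f t" for t
  have g: "g absolutely_integrable_on {0..t}" "x t = integral {0..t} g" if "t \<ge> 0" for t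
    using x that by (auto simp: linear_trajectory_def g_def[abs_def])
  have x0: "x 0 = 0" using g(2)[of 0] by simp
  have Pg: "(\<lambda>t. P *v g t) absolutely_integrable_on {0..T}"
    using absolutely_integrable_linear[OF g(1)[OF T] matrix_vector_mul_bounded_linear] by (simp add: o_def)
  have "((\<lambda>t. (P *v x t) \<bullet> g t + x t \<bullet> (P *v g t)) has_integral x T \<bullet> (P *v x T) - x 0 \<bullet> (P *v x 0)) {0..T}"
  proof (rule ac_product_rule[OF T g(1)[OF T] Pg])
    fix t assume t: "t \<in> {0..T}"
    then show "x t = x 0 + integral {0..t} g" using g(2)[of t] x0 by simp
    have "g integrable_on {0..t}" using g(1)[of t] t by (auto simp: absolutely_integrable_on_def)
    from integral_linear[OF this matrix_vector_mul_bounded_linear[of P]]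
    show "P *v x t = P *v x 0 + integral {0..t} (\<lambda>t. P *v g t)"
      using g(2)[of t] x0 t by (simp add: o_def)
  qed
  moreover have "(P *v x t) \<bullet> g t = x t \<bullet> (P *v g t)" for t
    by (rule inner_transpose[of "x t" P "g t", unfolded P, symmetric])
  ultimately show ?thesis
    unfolding g_def[symmetric] mult_2 by (simp only: x0) simp
qed

lemma positive_definite_nonneg:
  assumes "positive_definite P"
  shows "v \<bullet> (P *v v) \<ge> 0"
proof (cases "v = 0")
  case False
  then have "v \<bullet> (P *v v) > 0" using assms unfolding positive_definite_def by blast
  then show ?thesis by simp
qed simp

text \<open>Take a Lyapunov matrix as storage function. Young's inequality with weight
  \<open>a\<close> spends half of the decay on the cross term with \<open>f\<close> and keeps the
  other half. The constant does not depend on \<open>T\<close>, and nothing is presupposed about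
  \<open>x\<close> at infinity.\<close>

lemma hurwitz_L2_gain:
  fixes A :: "real^'n^'n"
  assumes "hurwitz A"
  obtains c where "c > 0"
    "\<And>f x T. linear_trajectory A f x \<Longrightarrow> T \<ge> 0 \<Longrightarrow> (\<lambda>t. (norm (f t))\<^sup>2) integrable_on {0..T} \<Longrightarrow>
       integral {0..T} (\<lambda>t. (norm (x t))\<^sup>2) \<le> c * integral {0..T} (\<lambda>t. (norm (f t))\<^sup>2)"
proof -
  obtain P a where P: "positive_definite P" and a: "a > 0"
    and dissip: "\<And>x. x \<bullet> (P *v (A *v x)) \<le> - a * (norm x)\<^sup>2"
    using hurwitz_lyapunov[OF assms] by metis
  obtain L where L: "L > 0" "\<And>x. norm (P *v x) \<le> L * norm x" using matrix_vector_bound[of P] by metis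
  show thesis
  proof (rule that)
    show "L\<^sup>2 / a\<^sup>2 > 0" using L a by simp
    fix f x and T :: real
    assume x: "linear_trajectory A f x" and T: "T \<ge> 0" and f: "(\<lambda>t. (norm (f t))\<^sup>2) integrable_on {0..T}"
    have int_x: "(\<lambda>t. (norm (x t))\<^sup>2) integrable_on {0..T}"
      by (intro integrable_continuous_real continuous_intros linear_trajectory_continuous[OF x])
    have "((\<lambda>t. 2 * (x t \<bullet> (P *v (A *v x t + f t)))) has_integral x T \<bullet> (P *v x T)) {0..T}"
      using P by (intro linear_trajectory_storage[OF x _ T]) (simp add: positive_definite_def)
    moreover have "x T \<bullet> (P *v x T) \<ge> 0"
      by (rule positive_definite_nonneg[OF P])
    moreover have "((\<lambda>t. - a * (norm (x t))\<^sup>2 + L\<^sup>2 / a * (norm (f t))\<^sup>2) has_integral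
        - a * integral {0..T} (\<lambda>t. (norm (x t))\<^sup>2) + L\<^sup>2 / a * integral {0..T} (\<lambda>t. (norm (f t))\<^sup>2)) {0..T}"
      using int_x f by (intro has_integral_add has_integral_mult_right integrable_integral)
    moreover have "2 * (x t \<bullet> (P *v (A *v x t + f t))) \<le> - a * (norm (x t))\<^sup>2 + L\<^sup>2 / a * (norm (f t))\<^sup>2" for t
    proof -
      have "2 * (x t \<bullet> (P *v f t)) \<le> a * (norm (x t))\<^sup>2 + (norm (P *v f t))\<^sup>2 / a"
        by (rule young[OF a])
      moreover have "(norm (P *v f t))\<^sup>2 / a \<le> L\<^sup>2 / a * (norm (f t))\<^sup>2"
        using power_mono[OF L(2)[of "f t"], of 2] a by (simp add: power_mult_distrib divide_right_mono)
      ultimately show ?thesis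
        using dissip[of "x t"] by (simp add: matrix_vector_right_distrib inner_add_right)
    qed
    ultimately have "0 \<le> - a * integral {0..T} (\<lambda>t. (norm (x t))\<^sup>2) + L\<^sup>2 / a * integral {0..T} (\<lambda>t. (norm (f t))\<^sup>2)"
      by (meson has_integral_le order_trans)
    then show "integral {0..T} (\<lambda>t. (norm (x t))\<^sup>2) \<le> L\<^sup>2 / a\<^sup>2 * integral {0..T} (\<lambda>t. (norm (f t))\<^sup>2)"
      using a by (simp add: field_simps power2_eq_square)
  qed
qed

section \<open>From the matrix inequality to dissipativity\<close>

text \<open>The minimum over the compact unit sphere, scaled by homogeneity. It turns strict
  definiteness into a uniform margin.\<close>

lemma homogeneous_lower_bound:
  fixes q :: "'a::euclidean_space \<Rightarrow> real"
  assumes cont: "continuous_on UNIV q" and hom: "\<And>c v. q (c *\<^sub>R v) = c\<^sup>2 * q v"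
    and pos: "\<And>v. v \<noteq> 0 \<Longrightarrow> q v > 0"
  obtains c where "c > 0" "\<And>v. q v \<ge> c * (norm v)\<^sup>2"
proof -
  obtain b :: 'a where "norm b = 1" using norm_Basis nonempty_Basis by blast
  then have "sphere 0 1 \<noteq> ({} :: 'a set)" by auto
  then obtain v0 where v0: "norm v0 = 1" "\<And>v. norm v = 1 \<Longrightarrow> q v0 \<le> q v"
    using continuous_attains_inf[OF compact_sphere, of "0 :: 'a" 1 q] continuous_on_subset[OF cont]
    by auto
  show thesis
  proof (rule that)
    show "q v0 > 0" using v0(1) by (intro pos) auto
    fix v
    show "q v \<ge> q v0 * (norm v)\<^sup>2"
    proof (cases "v = 0")
      case True
      then show ?thesis using hom[of 0 0] by simp
    next
      case False
      then have "q v = (norm v)\<^sup>2 * q (v /\<^sub>R norm v)" using hom[of "norm v" "v /\<^sub>R norm v"] by simp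
      moreover have "q v0 \<le> q (v /\<^sub>R norm v)" using False by (intro v0(2)) simp
      ultimately show ?thesis by (metis mult.commute mult_left_mono zero_le_power2)
    qed
  qed
qed

lemma mat_vector_mult: "(mat c :: real^'n^'n) *v x = c *\<^sub>R x"
  by (simp add: vec_eq_iff matrix_vector_mult_def mat_def if_distrib[of "\<lambda>a. a * _"] cong: if_cong)

text \<open>The quadratic form of the block matrix at the stacked vector
  \<open>\<xi>, w, r1, r2\<close>. Here \<open>C\<close> is only the upper row block of
  \<open>lmiC\<close>; \<open>r1\<close> and \<open>r2\<close> are the parts belonging to the two
  blocks of \<open>Rtilde\<close>.\<close>

definition lmi_form where
  "lmi_form A B E C Q \<eta> X Pi \<xi> w r1 r2 =
     2 * (\<xi> \<bullet> (A *v (X *v \<xi>)) + \<xi> \<bullet> (B *v (Pi *v \<xi>)) + \<xi> \<bullet> (E *v w)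
          + r1 \<bullet> (C *v (X *v \<xi>)) + r2 \<bullet> (Pi *v \<xi>))
     - w \<bullet> (Q *v w) - (norm r1)\<^sup>2 - \<eta> * (norm r2)\<^sup>2"
  for A :: "real^'n^'n" and B :: "real^'q^'n" and E :: "real^'w^'n" and C :: "real^'n^'p"
    and Q :: "real^'w^'w" and X :: "real^'n^'n" and Pi :: "real^'n^'q"

text \<open>Similarity in terms of the error system: \<open>w\<close> stacks the two inputs and
  \<open>d1\<close>, \<open>d\<close> is \<open>d2\<close>, and the slack is absorbed in
  \<open>Q\<close>. By uniqueness of trajectories, asking for some \<open>x\<close> is the same as
  asking for the \<open>x\<close>.\<close>

definition open_loop_dissipative where
  "open_loop_dissipative A B E C Q \<eta> \<longleftrightarrow>
     (\<forall>w\<in>L2. \<exists>d\<in>L2. \<exists>x. linear_trajectory A (\<lambda>t. B *v d t + E *v w t) x \<and> (\<lambda>t. C *v x t) \<in> L2 \<and>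
        energy (\<lambda>t. C *v x t) \<le> integral {0..} (\<lambda>t. w t \<bullet> (Q *v w t)) - \<eta> * energy d)"
  for A :: "real^'n^'n" and B :: "real^'q^'n" and E :: "real^'w^'n" and C :: "real^'n^'p"
    and Q :: "real^'w^'w"

text \<open>Maximizing the form over \<open>r1\<close> and \<open>r2\<close> is a Schur complement
  and gives a dissipation inequality for the storage \<open>x \<bullet> (P *v x)\<close>, where
  \<open>P\<close> inverts \<open>X\<close> and \<open>\<xi> = P *v x\<close>. Maximizing over
  \<open>r2\<close> divides by \<open>\<eta>\<close>, whence the weight \<open>1 / \<eta>\<close> on
  \<open>d\<close>.\<close>

lemma lmi_imp_open_loop_dissipative:
  fixes A :: "real^'n^'n" and B :: "real^'q^'n" and E :: "real^'w^'n" and C :: "real^'n^'p"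
    and Q :: "real^'w^'w" and X :: "real^'n^'n" and Pi :: "real^'n^'q"
  assumes X: "positive_definite X" and \<eta>: "\<eta> > 0"
    and lmi: "\<And>\<xi> w r1 r2. \<xi> \<noteq> 0 \<or> w \<noteq> 0 \<Longrightarrow> lmi_form A B E C Q \<eta> X Pi \<xi> w r1 r2 < 0"
  obtains c where "c > 0" "open_loop_dissipative A B E C (Q - mat c) (1 / \<eta>)"
proof -
  obtain P where P: "positive_definite P" "X ** P = mat 1" using positive_definite_inverse[OF X] by metis
  \<comment> \<open>The values inserted for \<open>r1\<close> and \<open>r2\<close> are the
    maximizers of the form; they are linear in \<open>\<xi>\<close>, so \<open>\<psi>\<close> stays
    homogeneous of degree 2.\<close>
  define \<psi> where "\<psi> v = - lmi_form A B E C Q \<eta> X Pi (fst v) (snd v)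
      (C *v (X *v fst v)) ((1 / \<eta>) *\<^sub>R (Pi *v fst v))" for v
  have "continuous_on UNIV \<psi>"
    unfolding \<psi>_def lmi_form_def by (intro continuous_intros continuous_on_matrix_vector_mult)
  moreover have "\<psi> (k *\<^sub>R v) = k\<^sup>2 * \<psi> v" for k v
    unfolding \<psi>_def lmi_form_def power2_norm_eq_inner
    by (simp add: matrix_vector_mult_scaleR power2_eq_square algebra_simps)
  moreover have "\<psi> v > 0" if "v \<noteq> 0" for v
    using lmi[of "fst v" "snd v"] that by (auto simp: \<psi>_def prod_eq_iff)
  ultimately obtain c where c: "c > 0" "\<And>v. \<psi> v \<ge> c * (norm v)\<^sup>2"
    using homogeneous_lower_bound by metis
  \<comment> \<open>Only the \<open>w\<close> part of the margin \<open>c\<close> is kept; it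
    becomes the slack in \<open>Q\<close>.\<close>
  have pointwise: "2 * (\<xi> \<bullet> (A *v (X *v \<xi>) + (B *v (Pi *v \<xi>)) + E *v w))
      \<le> w \<bullet> ((Q - mat c) *v w) - ((norm (C *v (X *v \<xi>)))\<^sup>2 + 1 / \<eta> * (norm (Pi *v \<xi>))\<^sup>2)" for \<xi> w
  proof -
    have "\<psi> (\<xi>, w) = - 2 * (\<xi> \<bullet> (A *v (X *v \<xi>) + (B *v (Pi *v \<xi>)) + E *v w))
      + w \<bullet> (Q *v w) - (norm (C *v (X *v \<xi>)))\<^sup>2 - 1 / \<eta> * (norm (Pi *v \<xi>))\<^sup>2"
      unfolding \<psi>_def lmi_form_def power2_norm_eq_inner using \<eta>
      by (simp add: inner_add_right field_simps power2_eq_square)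
    moreover have "c * (norm w)\<^sup>2 \<le> \<psi> (\<xi>, w)"
    proof -
      have "(norm w)\<^sup>2 \<le> (norm (\<xi>, w))\<^sup>2" by (simp add: norm_Pair)
      then have "c * (norm w)\<^sup>2 \<le> c * (norm (\<xi>, w))\<^sup>2" using c(1) by simp
      then show ?thesis using c(2) order_trans by blast
    qed
    ultimately show ?thesis
      by (simp add: matrix_vector_mult_diff_rdistrib mat_vector_mult inner_diff_right power2_norm_eq_inner)
  qed
  \<comment> \<open>At \<open>\<xi> = 0\<close> only the supply is left. Its sign allows the supply
    up to time \<open>T\<close> to be bounded by the supply over the half-line.\<close>
  have supply_nonneg: "w \<bullet> ((Q - mat c) *v w) \<ge> 0" for w
    using pointwise[of 0 w] by simp
  have "open_loop_dissipative A B E C (Q - mat c) (1 / \<eta>)"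
    unfolding open_loop_dissipative_def
  proof
    fix w :: "real \<Rightarrow> real^'w" assume w: "w \<in> L2"
    have "(\<lambda>t. E *v w t) absolutely_integrable_on {0..t}" for t
      by (intro L2_absolutely_integrable L2_matrix w)
    \<comment> \<open>The feedback is solved first as a closed-loop equation driven by
      \<open>w\<close>; the signal \<open>d\<close> read off from its solution is then an open-loop
      choice.\<close>
    then obtain x where x: "linear_trajectory (A + B ** (Pi ** P)) (\<lambda>t. E *v w t) x"
      using linear_trajectory_exists by metis
    define \<xi> where "\<xi> t = P *v x t" for t
    define d where "d t = Pi *v \<xi> t" for t
    have X\<xi>: "X *v \<xi> t = x t" for t
      using P(2) by (simp add: \<xi>_def matrix_vector_mul_assoc)
    have closed_loop: "(A + B ** (Pi ** P)) *v x t = A *v x t + B *v d t" for t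
      by (simp add: d_def \<xi>_def matrix_vector_mult_add_rdistrib matrix_vector_mul_assoc matrix_mul_assoc)
    have traj: "linear_trajectory A (\<lambda>t. B *v d t + E *v w t) x"
      using x unfolding linear_trajectory_def closed_loop by (simp add: add.assoc)
    define h where "h t = (norm (C *v x t))\<^sup>2 + 1 / \<eta> * (norm (d t))\<^sup>2" for t
    define s where "s t = w t \<bullet> ((Q - mat c) *v w t)" for t
    have s: "s integrable_on {0..}" unfolding s_def by (intro L2_inner_integrable L2_matrix w)
    have h_nonneg: "h t \<ge> 0" for t using \<eta> by (simp add: h_def)
    have h_int: "h integrable_on {0..T}" for T
      unfolding h_def d_def \<xi>_def
      by (intro integrable_continuous_real continuous_intros continuous_on_matrix_vector_mult
          linear_trajectory_continuous[OF x])
    have h_bound: "integral {0..T} h \<le> integral {0..} s" if T: "T \<ge> 0" for T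
    proof -
      have sym: "transpose P = P" using P(1) by (simp add: positive_definite_def)
      have "0 \<le> x T \<bullet> (P *v x T)" by (rule positive_definite_nonneg[OF P(1)])
      also have "\<dots> \<le> integral {0..T} (\<lambda>t. s t - h t)"
      proof (rule has_integral_le[OF linear_trajectory_storage[OF traj sym T]])
        show "((\<lambda>t. s t - h t) has_integral integral {0..T} (\<lambda>t. s t - h t)) {0..T}"
          by (intro integrable_integral integrable_diff h_int integrable_on_Icc_if_Ici s)
        fix t
        have "x t \<bullet> (P *v y) = \<xi> t \<bullet> y" for y
          using inner_transpose[of "x t" P y] by (simp only: sym \<xi>_def)
        then show "2 * (x t \<bullet> (P *v (A *v x t + (B *v d t + E *v w t)))) \<le> s t - h t"
          using pointwise[of "\<xi> t" "w t"] by (simp add: X\<xi> s_def h_def d_def add.assoc)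
      qed
      also have "\<dots> = integral {0..T} s - integral {0..T} h"
        by (intro Henstock_Kurzweil_Integration.integral_diff h_int integrable_on_Icc_if_Ici s)
      finally have "integral {0..T} h \<le> integral {0..T} s" by simp
      also have "\<dots> \<le> integral {0..} s"
        using supply_nonneg by (intro integral_subset_le integrable_on_Icc_if_Ici s) (auto simp: s_def)
      finally show ?thesis .
    qed
    have h: "h integrable_on {0..}" "integral {0..} h \<le> integral {0..} s"
      using nonneg_integrable_Ici[OF h_int h_nonneg h_bound] by auto
    have meas_x: "x \<in> borel_measurable (lebesgue_on {0..})" by (rule linear_trajectory_measurable[OF x])
    have Cx: "(\<lambda>t. C *v x t) \<in> L2"
      using \<eta> by (intro L2_dominated[OF _ h(1)] borel_measurable_matrix_vector_mult meas_x) (simp add: h_def)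
    have d: "d \<in> L2"
    proof (rule L2_dominated)
      show "d \<in> borel_measurable (lebesgue_on {0..})"
        unfolding d_def \<xi>_def by (intro borel_measurable_matrix_vector_mult meas_x)
      show "(\<lambda>t. \<eta> * h t) integrable_on {0..}" by (intro integrable_on_mult_right h)
      show "(norm (d t))\<^sup>2 \<le> \<eta> * h t" for t using \<eta> by (simp add: h_def distrib_left)
    qed
    have "(\<lambda>t. (norm (C *v x t))\<^sup>2) integrable_on {0..}" "(\<lambda>t. 1 / \<eta> * (norm (d t))\<^sup>2) integrable_on {0..}"
      using Cx d integrable_on_mult_right unfolding L2_iff by blast+
    then have "integral {0..} h = energy (\<lambda>t. C *v x t) + integral {0..} (\<lambda>t. 1 / \<eta> * (norm (d t))\<^sup>2)"
      unfolding h_def by (rule Henstock_Kurzweil_Integration.integral_add)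
    then have "integral {0..} h = energy (\<lambda>t. C *v x t) + 1 / \<eta> * energy d"
      by (simp only: Henstock_Kurzweil_Integration.integral_mult_right)
    then have "energy (\<lambda>t. C *v x t) \<le> integral {0..} s - 1 / \<eta> * energy d" using h(2) by simp
    then show "\<exists>d\<in>L2. \<exists>x. linear_trajectory A (\<lambda>t. B *v d t + E *v w t) x \<and> (\<lambda>t. C *v x t) \<in> L2 \<and>
        energy (\<lambda>t. C *v x t) \<le> integral {0..} (\<lambda>t. w t \<bullet> ((Q - mat c) *v w t)) - 1 / \<eta> * energy d"
      using d Cx traj unfolding s_def by blast
  qed
  with c(1) show thesis by (rule that)
qed

section \<open>The dual problem\<close>

text \<open>The identity holds for all real \<open>t\<close> between 0 and 1, so real homogeneity of
  the polar form \<open>\<beta>\<close> requires no continuity: subtract the instances for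
  \<open>x + y, y\<close> and for \<open>x, 0\<close>. Additivity is the case \<open>t = 1/2\<close>
  for \<open>x + y, z + y\<close> and for \<open>x, z\<close>, where the terms at
  \<open>x - z\<close> cancel.\<close>

lemma quadratic_form_of_interpolation:
  fixes V :: "real^'n \<Rightarrow> real"
  assumes V0: "V 0 = 0"
    and interp: "\<And>t a b. 0 < t \<Longrightarrow> t < 1 \<Longrightarrow>
      V (t *\<^sub>R a + (1 - t) *\<^sub>R b) + t * (1 - t) * V (a - b) = t * V a + (1 - t) * V b"
  obtains X where "transpose X = X" "\<And>q. V q = q \<bullet> (X *v q)"
proof -
  define \<beta> where "\<beta> x y = V (x + y) - V x - V y" for x y
  have sym: "\<beta> x y = \<beta> y x" for x y by (simp add: \<beta>_def add.commute)
  have scale01: "\<beta> (t *\<^sub>R x) y = t * \<beta> x y" if "0 < t" "t < 1" for t x y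
  proof -
    have "V (t *\<^sub>R x + y) + t * (1 - t) * V x = t * V (x + y) + (1 - t) * V y"
      using interp[OF that, of "x + y" y] by (simp add: algebra_simps)
    moreover have "V (t *\<^sub>R x) + t * (1 - t) * V x = t * V x"
      using interp[OF that, of x 0] V0 by simp
    ultimately show ?thesis by (simp add: \<beta>_def algebra_simps)
  qed
  have zero: "\<beta> 0 y = 0" for y by (simp add: \<beta>_def V0)
  have add: "\<beta> (x + z) y = \<beta> x y + \<beta> z y" for x z y
  proof -
    let ?m = "(1/2) *\<^sub>R (x + z)"
    have "V ((1/2) *\<^sub>R (x + y) + (1 - 1/2) *\<^sub>R (z + y)) + 1/2 * (1 - 1/2) * V ((x + y) - (z + y))
        = 1/2 * V (x + y) + (1 - 1/2) * V (z + y)"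
      by (rule interp) auto
    moreover have "(1/2) *\<^sub>R (x + y) + (1 - 1/2) *\<^sub>R (z + y) = ?m + y"
    proof -
      have "(1/2) *\<^sub>R y + (1/2) *\<^sub>R y = y" by (simp flip: scaleR_add_left)
      then show ?thesis by (simp add: scaleR_add_right add.assoc add.left_commute[of _ "(1/2) *\<^sub>R z"])
    qed
    moreover have "(x + y) - (z + y) = x - z" by simp
    moreover have "V ((1/2) *\<^sub>R x + (1 - 1/2) *\<^sub>R z) + 1/2 * (1 - 1/2) * V (x - z)
        = 1/2 * V x + (1 - 1/2) * V z"
      by (rule interp) auto
    moreover have "(1/2) *\<^sub>R x + (1 - 1/2) *\<^sub>R z = ?m" by (simp add: algebra_simps)
    ultimately have "\<beta> ?m y = 1/2 * (\<beta> x y + \<beta> z y)" by (simp add: \<beta>_def field_simps)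
    moreover have "\<beta> ?m y = 1/2 * \<beta> (x + z) y" by (rule scale01) auto
    ultimately show ?thesis by simp
  qed
  have scale_pos: "\<beta> (c *\<^sub>R x) y = c * \<beta> x y" if "c > 0" for c x y
  proof (cases c "1 :: real" rule: linorder_cases)
    case greater
    then have "\<beta> ((1 / c) *\<^sub>R (c *\<^sub>R x)) y = 1 / c * \<beta> (c *\<^sub>R x) y" by (intro scale01) auto
    then show ?thesis using that by (simp add: field_simps)
  qed (use that scale01 in auto)
  have scale: "\<beta> (c *\<^sub>R x) y = c * \<beta> x y" for c x y
  proof (cases c "0 :: real" rule: linorder_cases)
    case less
    have "\<beta> (c *\<^sub>R x) y + \<beta> ((- c) *\<^sub>R x) y = 0" using add[of "c *\<^sub>R x" "(- c) *\<^sub>R x" y] zero by simp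
    moreover have "\<beta> ((- c) *\<^sub>R x) y = - c * \<beta> x y" using less by (intro scale_pos) simp
    ultimately show ?thesis by simp
  qed (use scale_pos zero in auto)
  have "linear (\<lambda>x. \<beta> x y)" for y by (intro linearI) (simp_all add: add scale)
  moreover have "\<beta> x = (\<lambda>y. \<beta> y x)" for x by (simp add: fun_eq_iff sym[of x])
  ultimately have "bilinear \<beta>" unfolding bilinear_def by metis
  then obtain Y where Y: "\<And>x y. x \<bullet> (Y *v y) = \<beta> x y" using matrix_of_bilinear by blast
  have "V q = 1/2 * \<beta> q q" for q
  proof -
    have "V ((1/2) *\<^sub>R (2 *\<^sub>R q) + (1 - 1/2) *\<^sub>R 0) + 1/2 * (1 - 1/2) * V (2 *\<^sub>R q - 0)
        = 1/2 * V (2 *\<^sub>R q) + (1 - 1/2) * V 0"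
      by (rule interp) auto
    then have "V (2 *\<^sub>R q) = 4 * V q" by (simp add: V0)
    then show ?thesis by (simp add: \<beta>_def scaleR_2)
  qed
  moreover have "q \<bullet> (((1/2) *\<^sub>R Y) *v r) = 1/2 * \<beta> q r" for q r
    using Y[of q r] by (simp add: scaleR_matrix_vector_assoc[symmetric])
  ultimately have "V q = q \<bullet> (((1/2) *\<^sub>R Y) *v q)" for q by metis
  moreover have "transpose ((1/2) *\<^sub>R Y) = (1/2) *\<^sub>R Y"
    unfolding symmetric_matrix_iff by (simp add: scaleR_matrix_vector_assoc[symmetric] Y sym)
  ultimately show thesis using that by blast
qed

section \<open>Paths of the dual problem and its value function\<close>

text \<open>Vanishing also at negative times makes costs integrals over the whole line, and delaying
  a signal a mere translation. The half-open interval forces the final value 0 at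
  \<open>T\<close>.\<close>

definition test_signals :: "(real \<Rightarrow> 'a::euclidean_space) set" where
  "test_signals = {f \<in> borel_measurable borel. bounded (range f) \<and> (\<exists>T>0. \<forall>t. t \<notin> {0..<T} \<longrightarrow> f t = 0)}"

lemma test_signals_I:
  assumes "f \<in> borel_measurable borel" "T > 0" "\<And>t. t \<notin> {0..<T} \<Longrightarrow> f t = 0" "\<And>t. norm (f t) \<le> K"
  shows "f \<in> test_signals"
  using assms unfolding test_signals_def bounded_iff by blast

lemma test_signals_E:
  assumes "f \<in> test_signals"
  obtains T K where "f \<in> borel_measurable borel" "T > 0" "\<And>t. t \<notin> {0..<T} \<Longrightarrow> f t = 0" "\<And>t. norm (f t) \<le> K"
  using assms unfolding test_signals_def bounded_iff by blast

lemma test_signals_comb: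
  assumes "f \<in> test_signals" "g \<in> test_signals"
  shows "(\<lambda>t. a *\<^sub>R f t + b *\<^sub>R g t) \<in> test_signals"
proof -
  obtain T K where f: "f \<in> borel_measurable borel" "T > 0" "\<And>t. t \<notin> {0..<T} \<Longrightarrow> f t = 0" "\<And>t. norm (f t) \<le> K"
    using test_signals_E[OF assms(1)] by metis
  obtain S L where g: "g \<in> borel_measurable borel" "S > 0" "\<And>t. t \<notin> {0..<S} \<Longrightarrow> g t = 0" "\<And>t. norm (g t) \<le> L"
    using test_signals_E[OF assms(2)] by metis
  show ?thesis
  proof (rule test_signals_I[where T = "max T S"])
    show "(\<lambda>t. a *\<^sub>R f t + b *\<^sub>R g t) \<in> borel_measurable borel" using f(1) g(1) by measurable
    show "norm (a *\<^sub>R f t + b *\<^sub>R g t) \<le> \<bar>a\<bar> * K + \<bar>b\<bar> * L" for t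
      using f(4)[of t] g(4)[of t]
      by (intro norm_triangle_le add_mono) (auto intro: mult_left_mono)
    show "a *\<^sub>R f t + b *\<^sub>R g t = 0" if "t \<notin> {0..<max T S}" for t
      using that f(3)[of t] g(3)[of t] by (auto simp: less_max_iff_disj)
  qed (use f in auto)
qed

lemma test_signals_matrix:
  fixes M :: "real^'n^'m"
  assumes "f \<in> test_signals"
  shows "(\<lambda>t. M *v f t) \<in> test_signals"
proof -
  obtain T K where f: "f \<in> borel_measurable borel" "T > 0" "\<And>t. t \<notin> {0..<T} \<Longrightarrow> f t = 0" "\<And>t. norm (f t) \<le> K"
    using test_signals_E[OF assms] by metis
  obtain L where L: "L > 0" "\<And>x. norm (M *v x) \<le> L * norm x" using matrix_vector_bound[of M] by metis
  show ?thesis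
  proof (rule test_signals_I[where T = T])
    show "(\<lambda>t. M *v f t) \<in> borel_measurable borel" by (intro borel_measurable_matrix_vector_mult f)
    show "norm (M *v f t) \<le> L * K" for t
      using L f(4)[of t] by (meson mult_left_mono less_imp_le order_trans)
  qed (use f in auto)
qed

lemma test_signals_inner_integrable:
  assumes "f \<in> test_signals" "g \<in> test_signals"
  shows "integrable lborel (\<lambda>t. f t \<bullet> g t)"
proof -
  obtain T K where f: "f \<in> borel_measurable borel" "T > 0" "\<And>t. t \<notin> {0..<T} \<Longrightarrow> f t = 0" "\<And>t. norm (f t) \<le> K"
    using test_signals_E[OF assms(1)] by metis
  obtain S L where g: "g \<in> borel_measurable borel" "S > 0" "\<And>t. t \<notin> {0..<S} \<Longrightarrow> g t = 0" "\<And>t. norm (g t) \<le> L"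
    using test_signals_E[OF assms(2)] by metis
  show ?thesis
  proof (rule integrableI_bounded_set[where A = "{0..<T}" and B = "K * L"])
    show "(\<lambda>t. f t \<bullet> g t) \<in> borel_measurable lborel" using f(1) g(1) by simp
    have "norm (f t \<bullet> g t) \<le> K * L" for t
    proof -
      have "norm (f t \<bullet> g t) \<le> norm (f t) * norm (g t)" by (simp add: Cauchy_Schwarz_ineq2)
      also have "\<dots> \<le> K * L"
        using f(4)[of t] g(4)[of t] by (intro mult_mono) (auto intro: order_trans[OF norm_ge_zero])
      finally show ?thesis .
    qed
    then show "AE t in lborel. t \<in> {0..<T} \<longrightarrow> norm (f t \<bullet> g t) \<le> K * L" by simp
  qed (use f in auto)
qed

lemma test_signals_L2:
  assumes "f \<in> test_signals"
  shows "f \<in> L2"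
proof -
  obtain T K where f: "f \<in> borel_measurable borel" "T > 0" "\<And>t. t \<notin> {0..<T} \<Longrightarrow> f t = 0" "\<And>t. norm (f t) \<le> K"
    using test_signals_E[OF assms] by metis
  show ?thesis
  proof (rule L2_dominated)
    show "f \<in> borel_measurable (lebesgue_on {0..})"
      using f(1) by (intro measurable_restrict_space1) (simp add: measurable_completion)
    have "(\<lambda>t. K\<^sup>2) integrable_on ({0..T} \<inter> {0..})"
      by (subst Int_absorb2) (auto intro: integrable_const_ivl)
    then show "(\<lambda>t. if t \<in> {0..T} then K\<^sup>2 else 0) integrable_on {0..}"
      by (simp only: integrable_restrict_Int)
    show "(norm (f t))\<^sup>2 \<le> (if t \<in> {0..T} then K\<^sup>2 else 0)" for t
      using f(3)[of t] f(4)[of t] by (auto intro: power_mono)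
  qed
qed

text \<open>The costate satisfies \<open>p' = - g\<close>; the artificial input is \<open>v = g - A\<^sup>T p - C\<^sup>T z\<close>.\<close>

definition dual_path :: "(real \<Rightarrow> real^'n) \<Rightarrow> (real \<Rightarrow> real^'n) \<Rightarrow> (real \<Rightarrow> real^'p) \<Rightarrow> bool" where
  "dual_path p g z \<longleftrightarrow> p \<in> test_signals \<and> g \<in> test_signals \<and> z \<in> test_signals \<and>
     (\<forall>t\<ge>0. (g has_integral p 0 - p t) {0..t})"

text \<open>The costate equation is not imposed: its violation is penalized with weight
  \<open>K\<close>, so that \<open>g\<close> may be chosen freely.\<close>

definition stage_cost where
  "stage_cost A C M K p g z =
     (norm z)\<^sup>2 + K * (norm (g - transpose A *v p - transpose C *v z))\<^sup>2 + p \<bullet> (M *v p)"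
  for A :: "real^'n^'n" and C :: "real^'n^'p" and M :: "real^'n^'n"

definition path_cost where
  "path_cost A C M K p g z = (LINT t|lborel. stage_cost A C M K (p t) (g t) (z t))"
  for p :: "real \<Rightarrow> _"

lemma stage_cost_integrable:
  assumes "dual_path p g z"
  shows "integrable lborel (\<lambda>t. stage_cost A C M K (p t) (g t) (z t))"
proof -
  have ts: "p \<in> test_signals" "g \<in> test_signals" "z \<in> test_signals" using assms by (auto simp: dual_path_def)
  have "(\<lambda>t. 1 *\<^sub>R (1 *\<^sub>R g t + (-1) *\<^sub>R (transpose A *v p t)) + (-1) *\<^sub>R (transpose C *v z t)) \<in> test_signals"
    by (intro test_signals_comb test_signals_matrix ts)
  then have "(\<lambda>t. g t - transpose A *v p t - transpose C *v z t) \<in> test_signals" by simp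
  then show ?thesis
    unfolding stage_cost_def power2_norm_eq_inner
    by (intro Bochner_Integration.integrable_add integrable_mult_right test_signals_inner_integrable
        test_signals_matrix ts)
qed

text \<open>The cost is a quadratic form in \<open>p, g, z\<close> jointly. This identity expresses
  it in a way that survives integration and, read as two inequalities, the passage to an
  infimum.\<close>

lemma stage_cost_interp:
  "t * stage_cost A C M K p g z + (1 - t) * stage_cost A C M K p' g' z' =
   stage_cost A C M K (t *\<^sub>R p + (1 - t) *\<^sub>R p') (t *\<^sub>R g + (1 - t) *\<^sub>R g') (t *\<^sub>R z + (1 - t) *\<^sub>R z')
   + t * (1 - t) * stage_cost A C M K (p - p') (g - g') (z - z')"
proof -
  define v v' where "v = g - transpose A *v p - transpose C *v z" and "v' = g' - transpose A *v p' - transpose C *v z'"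
  have 1: "(t *\<^sub>R g + (1 - t) *\<^sub>R g') - transpose A *v (t *\<^sub>R p + (1 - t) *\<^sub>R p') - transpose C *v (t *\<^sub>R z + (1 - t) *\<^sub>R z')
      = t *\<^sub>R v + (1 - t) *\<^sub>R v'"
    by (simp only: v_def v'_def matrix_vector_right_distrib matrix_vector_mult_scaleR) (simp add: algebra_simps)
  have 2: "(g - g') - transpose A *v (p - p') - transpose C *v (z - z') = v - v'"
    by (simp only: v_def v'_def matrix_vector_mult_diff_distrib) (simp add: algebra_simps)
  have sq: "t * (x \<bullet> (N *v x)) + (1 - t) * (y \<bullet> (N *v y)) =
    (t *\<^sub>R x + (1 - t) *\<^sub>R y) \<bullet> (N *v (t *\<^sub>R x + (1 - t) *\<^sub>R y)) + t * (1 - t) * ((x - y) \<bullet> (N *v (x - y)))"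
    for x y :: "real^'k" and N
    by (simp only: matrix_vector_right_distrib matrix_vector_mult_scaleR matrix_vector_mult_diff_distrib
        inner_add_left inner_add_right inner_diff_left inner_diff_right inner_scaleR_left inner_scaleR_right)
      (simp add: algebra_simps)
  have nsq: "t * (norm x)\<^sup>2 + (1 - t) * (norm y)\<^sup>2 =
    (norm (t *\<^sub>R x + (1 - t) *\<^sub>R y))\<^sup>2 + t * (1 - t) * (norm (x - y))\<^sup>2" for x y :: "real^'k"
    using sq[of x "mat 1" y] by (simp add: power2_norm_eq_inner)
  have "t * stage_cost A C M K p g z + (1 - t) * stage_cost A C M K p' g' z'
    = (t * (norm z)\<^sup>2 + (1 - t) * (norm z')\<^sup>2) + K * (t * (norm v)\<^sup>2 + (1 - t) * (norm v')\<^sup>2)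
      + (t * (p \<bullet> (M *v p)) + (1 - t) * (p' \<bullet> (M *v p')))"
    unfolding stage_cost_def v_def[symmetric] v'_def[symmetric] by (simp add: algebra_simps)
  then show ?thesis
    unfolding nsq sq stage_cost_def 1 2 by (simp only: distrib_left mult.assoc mult.left_commute[of K] add_ac)
qed

lemma dual_path_comb:
  assumes "dual_path p g z" "dual_path p' g' z'"
  shows "dual_path (\<lambda>t. a *\<^sub>R p t + b *\<^sub>R p' t) (\<lambda>t. a *\<^sub>R g t + b *\<^sub>R g' t) (\<lambda>t. a *\<^sub>R z t + b *\<^sub>R z' t)"
  unfolding dual_path_def
proof (intro conjI allI impI test_signals_comb)
  fix t :: real assume "t \<ge> 0"
  then have "((\<lambda>t. a *\<^sub>R g t + b *\<^sub>R g' t) has_integral a *\<^sub>R (p 0 - p t) + b *\<^sub>R (p' 0 - p' t)) {0..t}"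
    using assms by (intro has_integral_add has_integral_cmul) (auto simp: dual_path_def)
  then show "((\<lambda>t. a *\<^sub>R g t + b *\<^sub>R g' t) has_integral
      (a *\<^sub>R p 0 + b *\<^sub>R p' 0) - (a *\<^sub>R p t + b *\<^sub>R p' t)) {0..t}"
    by (simp add: algebra_simps)
qed (use assms in \<open>auto simp: dual_path_def\<close>)

lemma path_cost_interp:
  assumes "dual_path p g z" "dual_path p' g' z'"
  shows "t * path_cost A C M K p g z + (1 - t) * path_cost A C M K p' g' z' =
    path_cost A C M K (\<lambda>s. t *\<^sub>R p s + (1 - t) *\<^sub>R p' s) (\<lambda>s. t *\<^sub>R g s + (1 - t) *\<^sub>R g' s) (\<lambda>s. t *\<^sub>R z s + (1 - t) *\<^sub>R z' s)
    + t * (1 - t) * path_cost A C M K (\<lambda>s. p s - p' s) (\<lambda>s. g s - g' s) (\<lambda>s. z s - z' s)"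
proof -
  note i1 = stage_cost_integrable[OF assms(1), of A C M K] and i2 = stage_cost_integrable[OF assms(2), of A C M K]
  note i3 = stage_cost_integrable[OF dual_path_comb[OF assms, of t "1 - t"], of A C M K]
  have i4: "integrable lborel (\<lambda>s. stage_cost A C M K (p s - p' s) (g s - g' s) (z s - z' s))"
    using stage_cost_integrable[OF dual_path_comb[OF assms, of 1 "-1"], of A C M K] by simp
  have "t * path_cost A C M K p g z + (1 - t) * path_cost A C M K p' g' z' =
    (LINT s|lborel. t * stage_cost A C M K (p s) (g s) (z s) + (1 - t) * stage_cost A C M K (p' s) (g' s) (z' s))"
    using i1 i2 by (simp add: path_cost_def)
  also have "\<dots> = (LINT s|lborel. stage_cost A C M K (t *\<^sub>R p s + (1 - t) *\<^sub>R p' s) (t *\<^sub>R g s + (1 - t) *\<^sub>R g' s) (t *\<^sub>R z s + (1 - t) *\<^sub>R z' s)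
     + t * (1 - t) * stage_cost A C M K (p s - p' s) (g s - g' s) (z s - z' s))"
    by (simp only: stage_cost_interp)
  also have "\<dots> = path_cost A C M K (\<lambda>s. t *\<^sub>R p s + (1 - t) *\<^sub>R p' s) (\<lambda>s. t *\<^sub>R g s + (1 - t) *\<^sub>R g' s) (\<lambda>s. t *\<^sub>R z s + (1 - t) *\<^sub>R z' s)
    + t * (1 - t) * path_cost A C M K (\<lambda>s. p s - p' s) (\<lambda>s. g s - g' s) (\<lambda>s. z s - z' s)"
    using i3 i4 by (simp add: path_cost_def)
  finally show ?thesis .
qed

definition glue :: "real \<Rightarrow> (real \<Rightarrow> 'a) \<Rightarrow> (real \<Rightarrow> 'a) \<Rightarrow> real \<Rightarrow> 'a" where
  "glue h f k t = (if t \<in> {0..<h} then f t else k (t - h))"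

lemma glue_test_signals:
  assumes k: "k \<in> test_signals" and f: "continuous_on UNIV f" and h: "h > 0"
  shows "glue h f k \<in> test_signals"
proof -
  obtain T L where T: "k \<in> borel_measurable borel" "T > 0" "\<And>t. t \<notin> {0..<T} \<Longrightarrow> k t = 0" "\<And>t. norm (k t) \<le> L"
    using test_signals_E[OF k] by metis
  have "bounded (f ` {0..h})"
    by (intro compact_imp_bounded compact_continuous_image continuous_on_subset[OF f]) auto
  then obtain L' where L': "\<And>t. t \<in> {0..h} \<Longrightarrow> norm (f t) \<le> L'" unfolding bounded_iff by (metis imageI)
  show ?thesis
  proof (rule test_signals_I[where T = "T + h"])
    have [measurable]: "f \<in> borel_measurable borel" "k \<in> borel_measurable borel"
      using borel_measurable_continuous_onI[OF f] T(1) by auto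
    show "glue h f k \<in> borel_measurable borel" unfolding glue_def[abs_def] by measurable
    show "norm (glue h f k t) \<le> max L L'" for t
      using T(4)[of "t - h"] L'[of t] by (auto simp: glue_def)
    show "glue h f k t = 0" if "t \<notin> {0..<T + h}" for t
      using that T(2) h by (auto simp: glue_def intro!: T(3))
  qed (use T h in auto)
qed

text \<open>Delay the old path by \<open>h\<close> and precede it by a straight segment running from
  \<open>p 0 + h *\<^sub>R a\<close> to \<open>p 0\<close>, with constant \<open>g\<close> and
  \<open>z\<close>. The old part keeps its cost, and the segment costs at most \<open>m\<close> per
  unit of time.\<close>

lemma dual_path_prepend:
  fixes a q :: "real^'n" and \<zeta> :: "real^'p"
  assumes path: "dual_path p g z" and h: "h > 0"
    and bound: "\<And>s. 0 \<le> s \<Longrightarrow> s \<le> h \<Longrightarrow> stage_cost A C M K (p 0 + s *\<^sub>R a) a \<zeta> \<le> m"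
  obtains p' g' z' where "dual_path p' g' z'" "p' 0 = p 0 + h *\<^sub>R a"
    "path_cost A C M K p' g' z' \<le> path_cost A C M K p g z + h * m"
proof -
  define p' where "p' = glue h (\<lambda>t. p 0 + (h - t) *\<^sub>R a) p"
  define g' where "g' = glue h (\<lambda>_. a) g"
  define z' where "z' = glue h (\<lambda>_. \<zeta>) z"
  have ts: "p \<in> test_signals" "g \<in> test_signals" "z \<in> test_signals"
    and int_g: "\<And>t. t \<ge> 0 \<Longrightarrow> (g has_integral p 0 - p t) {0..t}"
    using path by (auto simp: dual_path_def)
  have p'0: "p' 0 = p 0 + h *\<^sub>R a" using h by (simp add: p'_def glue_def)
  have path': "dual_path p' g' z'"
    unfolding dual_path_def
  proof (intro conjI allI impI)
    show "p' \<in> test_signals" "g' \<in> test_signals" "z' \<in> test_signals"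
      unfolding p'_def g'_def z'_def by (intro glue_test_signals ts h continuous_intros)+
    fix t :: real assume t: "t \<ge> 0"
    \<comment> \<open>At the endpoint \<open>h\<close> the glued signal already has its later value;
      a single point does not affect the integral.\<close>
    have const: "(g' has_integral r *\<^sub>R a) {0..r}" if "0 \<le> r" "r \<le> h" for r
      using that has_integral_const_real[of a 0 r]
      by (intro has_integral_spike_finite[of "{h}" _ g' "\<lambda>_. a"]) (auto simp: g'_def glue_def)
    show "(g' has_integral p' 0 - p' t) {0..t}"
    proof (cases "t < h")
      case True
      then show ?thesis using const[of t] t p'0 by (simp add: p'_def glue_def algebra_simps)
    next
      case False
      have "(g has_integral p 0 - p (t - h)) {h + - h..t + - h}" using int_g[of "t - h"] False by simp
      then have "((g \<circ> ((+) (- h))) has_integral p 0 - p (t - h)) {h..t}"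
        by (simp only: has_integral_shift_Icc_real)
      then have "(g' has_integral p 0 - p (t - h)) {h..t}"
        by (rule has_integral_eq[rotated]) (simp add: g'_def glue_def)
      then have "(g' has_integral h *\<^sub>R a + (p 0 - p (t - h))) {0..t}"
        using const[of h] h False by (intro has_integral_combine[of 0 h t]) auto
      then show ?thesis using False p'0 by (simp add: p'_def glue_def algebra_simps)
    qed
  qed
  define \<phi> where "\<phi> t = stage_cost A C M K (p t) (g t) (z t)" for t
  define \<phi>' where "\<phi>' t = stage_cost A C M K (p' t) (g' t) (z' t)" for t
  have \<phi>: "integrable lborel \<phi>" unfolding \<phi>_def by (rule stage_cost_integrable[OF path])
  have \<phi>': "integrable lborel \<phi>'" unfolding \<phi>'_def by (rule stage_cost_integrable[OF path'])
  have shift: "integrable lborel (\<lambda>t. \<phi> (- h + 1 * t))" "(LINT t|lborel. \<phi> (- h + 1 * t)) = (LINT t|lborel. \<phi> t)"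
    using lborel_integrable_real_affine[OF \<phi>, of 1 "- h"] lborel_integral_real_affine[of 1 \<phi> "- h"] by simp_all
  have ind: "integrable lborel (indicat_real {0..<h})"
    by (rule integrable_real_indicator) (use h in \<open>simp_all add: less_imp_le\<close>)
  have "(LINT t|lborel. \<phi>' t) \<le> (LINT t|lborel. indicator {0..<h} t * m + \<phi> (- h + 1 * t))"
  proof (rule integral_mono[OF \<phi>'])
    show "integrable lborel (\<lambda>t. indicator {0..<h} t * m + \<phi> (- h + 1 * t))"
      using shift(1) ind by (intro Bochner_Integration.integrable_add integrable_mult_left)
    fix t :: real
    \<comment> \<open>Hence the delayed cost vanishes on \<open>{0..<h}\<close>, where only the
      segment contributes.\<close>
    have neg: "p s = 0" "g s = 0" "z s = 0" if "s < 0" for s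
      using ts that by (auto simp: test_signals_def)
    show "\<phi>' t \<le> indicator {0..<h} t * m + \<phi> (- h + 1 * t)"
    proof (cases "t \<in> {0..<h}")
      case True
      then have "\<phi>' t \<le> m"
        using bound[of "h - t"] by (simp add: \<phi>'_def p'_def g'_def z'_def glue_def)
      moreover have "\<phi> (- h + 1 * t) = 0"
        using True neg[of "t - h"] by (simp add: \<phi>_def stage_cost_def)
      ultimately show ?thesis using True by simp
    next
      case False
      then show ?thesis
        unfolding \<phi>'_def \<phi>_def p'_def g'_def z'_def glue_def if_not_P[OF False] by simp
    qed
  qed
  also have "\<dots> = h * m + (LINT t|lborel. \<phi> t)"
  proof -
    have "integrable lborel (\<lambda>t. indicator {0..<h} t * m)" by (intro integrable_mult_left ind)
    moreover have "(LINT t|lborel. indicator {0..<h} t * m) = h * m" using h by simp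
    ultimately show ?thesis using shift by simp
  qed
  finally have "path_cost A C M K p' g' z' \<le> path_cost A C M K p g z + h * m"
    by (simp add: path_cost_def \<phi>_def \<phi>'_def)
  with path' p'0 show thesis by (rule that)
qed

text \<open>The value function \<open>V\<close> of the dual problem is quadratic; prepending a short linear piece to a
  nearly optimal path gives its dissipation inequality.\<close>

lemma dual_value_matrix:
  fixes A :: "real^'n^'n" and C :: "real^'n^'p" and M :: "real^'n^'n"
  assumes nonneg: "\<And>p g z. dual_path p g z \<Longrightarrow> path_cost A C M K p g z \<ge> 0"
  obtains X where "transpose X = X" "\<And>q. q \<bullet> (X *v q) \<ge> 0"
    "\<And>q a \<zeta>. 2 * (q \<bullet> (X *v a)) \<le> stage_cost A C M K q a \<zeta>"
proof -
  let ?J = "path_cost A C M K"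
  define S where "S q = {?J p g z | p g z. dual_path p g z \<and> p 0 = q}" for q
  define V where "V q = Inf (S q)" for q
  have zero_path: "dual_path (\<lambda>_. 0 :: real^'n) (\<lambda>_. 0) (\<lambda>_. 0 :: real^'p)"
    by (auto simp: dual_path_def intro!: test_signals_I[where T = 1 and K = 0])
  \<comment> \<open>A segment of unit duration with slope \<open>q\<close>, prepended to the zero
    path, starts at \<open>q\<close>; its violation of the costate equation costs a finite
    amount.\<close>
  have S_ne: "S q \<noteq> {}" for q
  proof -
    have "continuous_on {0..1} (\<lambda>s. stage_cost A C M K (0 + s *\<^sub>R q) q 0)"
      unfolding stage_cost_def by (intro continuous_intros continuous_on_matrix_vector_mult)
    then have "bounded ((\<lambda>s. stage_cost A C M K (0 + s *\<^sub>R q) q 0) ` {0..1})"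
      by (intro compact_imp_bounded compact_continuous_image) auto
    then obtain m where m: "\<And>s. s \<in> {0..1} \<Longrightarrow> norm (stage_cost A C M K (0 + s *\<^sub>R q) q 0) \<le> m"
      unfolding bounded_iff by (metis imageI)
    have bound: "stage_cost A C M K (0 + s *\<^sub>R q) q 0 \<le> m" if "0 \<le> s" "s \<le> 1" for s
      using m[of s] that by (simp only: real_norm_def abs_le_iff atLeastAtMost_iff)
    obtain p g z where "dual_path p g (z :: real \<Rightarrow> real^'p)" "p 0 = 0 + 1 *\<^sub>R q"
      using dual_path_prepend[OF zero_path zero_less_one bound] by blast
    then have "?J p g z \<in> S q" unfolding S_def by auto
    then show ?thesis by blast
  qed
  have S_bdd: "bdd_below (S q)" for q
    unfolding S_def using nonneg by (auto intro!: bdd_belowI[of _ 0])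
  have V_le: "V (p 0) \<le> ?J p g z" if "dual_path p g z" for p g z
    unfolding V_def by (rule cInf_lower[OF _ S_bdd]) (use that in \<open>auto simp: S_def\<close>)
  have V_greatest: "c \<le> V q" if "\<And>p g z. dual_path p g z \<Longrightarrow> p 0 = q \<Longrightarrow> c \<le> ?J p g z" for c q
    unfolding V_def by (rule cInf_greatest[OF S_ne]) (use that in \<open>auto simp: S_def\<close>)
  have V_near: "\<exists>p g z. dual_path p g z \<and> p 0 = q \<and> ?J p g z < V q + e" if "e > 0" for q e
    using V_greatest[of q "V q + e"] that by (meson leD leI less_add_same_cancel1)
  have V_nonneg: "V q \<ge> 0" for q using nonneg by (intro V_greatest)
  have V0: "V 0 = 0"
  proof -
    have "V 0 \<le> ?J (\<lambda>_. 0) (\<lambda>_. 0) (\<lambda>_. 0)" by (rule V_le[OF zero_path])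
    also have "\<dots> = 0" by (simp add: path_cost_def stage_cost_def)
    finally show ?thesis using V_nonneg[of 0] by simp
  qed
  have interp: "V (t *\<^sub>R a + (1 - t) *\<^sub>R b) + t * (1 - t) * V (a - b) = t * V a + (1 - t) * V b"
    if t: "0 < t" "t < 1" for t a b
  proof (rule antisym)
    \<comment> \<open>Nearly optimal paths from \<open>a\<close> and \<open>b\<close> are combined
      to paths from the intermediate point and from \<open>a - b\<close>.\<close>
    show "V (t *\<^sub>R a + (1 - t) *\<^sub>R b) + t * (1 - t) * V (a - b) \<le> t * V a + (1 - t) * V b"
    proof (rule field_le_epsilon)
      fix e :: real assume e: "e > 0"
      obtain p g z where 1: "dual_path p g z" "p 0 = a" "?J p g z < V a + e" using V_near[OF e] by blast
      obtain p' g' z' where 2: "dual_path p' g' z'" "p' 0 = b" "?J p' g' z' < V b + e" using V_near[OF e] by blast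
      have "V (t *\<^sub>R a + (1 - t) *\<^sub>R b) \<le>
          ?J (\<lambda>s. t *\<^sub>R p s + (1 - t) *\<^sub>R p' s) (\<lambda>s. t *\<^sub>R g s + (1 - t) *\<^sub>R g' s) (\<lambda>s. t *\<^sub>R z s + (1 - t) *\<^sub>R z' s)"
        using V_le[OF dual_path_comb[OF 1(1) 2(1), of t "1 - t"]] 1(2) 2(2) by simp
      moreover have "V (a - b) \<le> ?J (\<lambda>s. p s - p' s) (\<lambda>s. g s - g' s) (\<lambda>s. z s - z' s)"
        using V_le[OF dual_path_comb[OF 1(1) 2(1), of 1 "- 1"]] 1(2) 2(2) by simp
      then have "t * (1 - t) * V (a - b) \<le> t * (1 - t) * ?J (\<lambda>s. p s - p' s) (\<lambda>s. g s - g' s) (\<lambda>s. z s - z' s)"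
        using t by (intro mult_left_mono) auto
      ultimately have "V (t *\<^sub>R a + (1 - t) *\<^sub>R b) + t * (1 - t) * V (a - b)
          \<le> t * ?J p g z + (1 - t) * ?J p' g' z'"
        unfolding path_cost_interp[OF 1(1) 2(1)] by (rule add_mono)
      also have "\<dots> \<le> t * (V a + e) + (1 - t) * (V b + e)"
        using 1(3) 2(3) t by (intro add_mono mult_left_mono) auto
      also have "\<dots> = t * V a + (1 - t) * V b + e" by (simp add: algebra_simps)
      finally show "V (t *\<^sub>R a + (1 - t) *\<^sub>R b) + t * (1 - t) * V (a - b) \<le> t * V a + (1 - t) * V b + e" .
    qed
    show "t * V a + (1 - t) * V b \<le> V (t *\<^sub>R a + (1 - t) *\<^sub>R b) + t * (1 - t) * V (a - b)"
    proof (rule field_le_epsilon)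
      fix e :: real assume e: "e > 0"
      define e' where "e' = e / 2"
      have e': "e' > 0" using e by (simp add: e'_def)
      obtain p g z where 1: "dual_path p g z" "p 0 = t *\<^sub>R a + (1 - t) *\<^sub>R b"
          "?J p g z < V (t *\<^sub>R a + (1 - t) *\<^sub>R b) + e'" using V_near[OF e'] by blast
      obtain p' g' z' where 2: "dual_path p' g' z'" "p' 0 = a - b" "?J p' g' z' < V (a - b) + e'"
        using V_near[OF e'] by blast
      \<comment> \<open>The inverse substitution: nearly optimal paths from the intermediate point
        and from \<open>a - b\<close> give back paths from \<open>a\<close> and \<open>b\<close>,
        with the same identity between the costs.\<close>
      note \<alpha> = dual_path_comb[OF 1(1) 2(1), of 1 "1 - t"] and \<beta> = dual_path_comb[OF 1(1) 2(1), of 1 "- t"]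
      have "t *\<^sub>R (1 *\<^sub>R x + (1 - t) *\<^sub>R y) + (1 - t) *\<^sub>R (1 *\<^sub>R x + (- t) *\<^sub>R y) = x"
        "(1 *\<^sub>R x + (1 - t) *\<^sub>R y) - (1 *\<^sub>R x + (- t) *\<^sub>R y) = y" for x y :: "real^'k"
        by (simp_all add: algebra_simps)
      note eqs = this
      have Va: "V a \<le> ?J (\<lambda>s. 1 *\<^sub>R p s + (1 - t) *\<^sub>R p' s) (\<lambda>s. 1 *\<^sub>R g s + (1 - t) *\<^sub>R g' s) (\<lambda>s. 1 *\<^sub>R z s + (1 - t) *\<^sub>R z' s)"
        using V_le[OF \<alpha>] 1(2) 2(2) by (simp add: algebra_simps)
      have Vb: "V b \<le> ?J (\<lambda>s. 1 *\<^sub>R p s + (- t) *\<^sub>R p' s) (\<lambda>s. 1 *\<^sub>R g s + (- t) *\<^sub>R g' s) (\<lambda>s. 1 *\<^sub>R z s + (- t) *\<^sub>R z' s)"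
        using V_le[OF \<beta>] 1(2) 2(2) by (simp add: algebra_simps)
      have "t * V a + (1 - t) * V b \<le> ?J p g z + t * (1 - t) * ?J p' g' z'"
        unfolding path_cost_interp[OF \<alpha> \<beta>, of t A C M K, unfolded eqs, symmetric]
        by (intro add_mono mult_left_mono Va Vb) (use t in auto)
      also have "\<dots> \<le> (V (t *\<^sub>R a + (1 - t) *\<^sub>R b) + e') + t * (1 - t) * (V (a - b) + e')"
        using 1(3) 2(3) t by (intro add_mono mult_left_mono) auto
      also have "\<dots> \<le> V (t *\<^sub>R a + (1 - t) *\<^sub>R b) + t * (1 - t) * V (a - b) + e"
      proof -
        have "t * (1 - t) \<le> 1 * 1" using t by (intro mult_mono) auto
        then have "t * (1 - t) * e' \<le> 1 * e'" using e' by (intro mult_right_mono) auto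
        then show ?thesis by (simp add: e'_def distrib_left)
      qed
      finally show "t * V a + (1 - t) * V b \<le> V (t *\<^sub>R a + (1 - t) *\<^sub>R b) + t * (1 - t) * V (a - b) + e" .
    qed
  qed
  obtain X where X: "transpose X = X" "\<And>q. V q = q \<bullet> (X *v q)"
    using quadratic_form_of_interpolation[OF V0 interp] by blast
  have sym: "x \<bullet> (X *v y) = y \<bullet> (X *v x)" for x y using X(1) symmetric_matrix_iff by blast
  have "2 * (q \<bullet> (X *v a)) \<le> stage_cost A C M K q a \<zeta>" for q a \<zeta>
  proof (rule field_le_epsilon)
    fix e :: real assume e: "e > 0"
    let ?l = "\<lambda>s. stage_cost A C M K (q + s *\<^sub>R a) a \<zeta>"
    have "continuous_on UNIV ?l"
      unfolding stage_cost_def by (intro continuous_intros continuous_on_matrix_vector_mult)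
    then have "isCont ?l 0" by (simp add: continuous_on_eq_continuous_at)
    then obtain d where d: "d > 0" "\<And>s. \<bar>s\<bar> < d \<Longrightarrow> \<bar>?l s - ?l 0\<bar> < e"
      using e unfolding continuous_at_eps_delta by (auto simp: dist_real_def)
    define h where "h = d / 2"
    have h: "h > 0" using d by (simp add: h_def)
    have bound: "?l s \<le> stage_cost A C M K q a \<zeta> + e" if "0 \<le> s" "s \<le> h" for s
      using d(1) d(2)[of s] that by (simp add: h_def)
    have "V (q + h *\<^sub>R a) \<le> V q + h * (stage_cost A C M K q a \<zeta> + e)"
    proof (rule field_le_epsilon)
      fix e' :: real assume "e' > 0"
      then obtain p g z where p: "dual_path p g z" "p 0 = q" "?J p g z < V q + e'" using V_near by blast
      have bound': "stage_cost A C M K (p 0 + s *\<^sub>R a) a \<zeta> \<le> stage_cost A C M K q a \<zeta> + e"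
        if "0 \<le> s" "s \<le> h" for s using bound[OF that] p(2) by simp
      obtain p' g' z' where p': "dual_path p' g' z'" "p' 0 = p 0 + h *\<^sub>R a"
          "?J p' g' z' \<le> ?J p g z + h * (stage_cost A C M K q a \<zeta> + e)"
        using dual_path_prepend[OF p(1) h bound'] by metis
      have "V (q + h *\<^sub>R a) \<le> ?J p' g' z'" using V_le[OF p'(1)] p'(2) p(2) by simp
      then show "V (q + h *\<^sub>R a) \<le> V q + h * (stage_cost A C M K q a \<zeta> + e) + e'"
        using p'(3) p(3) by simp
    qed
    moreover have "V (q + h *\<^sub>R a) = V q + h * (2 * (q \<bullet> (X *v a))) + h * h * V a"
      unfolding X(2)
      by (simp add: matrix_vector_right_distrib matrix_vector_mult_scaleR inner_add_left inner_add_right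
          sym[of a q] algebra_simps)
    ultimately have "h * (2 * (q \<bullet> (X *v a))) \<le> h * (stage_cost A C M K q a \<zeta> + e)"
      using mult_nonneg_nonneg[OF zero_le_square[of h] V_nonneg[of a]] by linarith
    then show "2 * (q \<bullet> (X *v a)) \<le> stage_cost A C M K q a \<zeta> + e"
      using h by simp
  qed
  moreover have "q \<bullet> (X *v q) \<ge> 0" for q using V_nonneg[of q] by (simp add: X(2))
  ultimately show thesis using X(1) that by blast
qed

section \<open>Weak duality and the strict Riccati inequality\<close>

lemma quadratic_form_upper_bound:
  fixes M :: "real^'n^'n"
  obtains L where "L > 0" "\<And>x. x \<bullet> (M *v x) \<le> L * (norm x)\<^sup>2"
proof -
  obtain L where L: "L > 0" "\<And>x. norm (M *v x) \<le> L * norm x" using matrix_vector_bound[of M] by metis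
  have "x \<bullet> (M *v x) \<le> L * (norm x)\<^sup>2" for x
  proof -
    have "x \<bullet> (M *v x) \<le> norm x * norm (M *v x)" by (rule norm_cauchy_schwarz)
    also have "\<dots> \<le> norm x * (L * norm x)" using L(2) by (intro mult_left_mono) auto
    finally show ?thesis by (simp add: power2_eq_square mult.left_commute)
  qed
  with L(1) show thesis by (rule that)
qed

text \<open>Duality: along a dual path the disturbance \<open>w = W E\<^sup>T p\<close> is a worst case; pairing its response
  \<open>x\<close> with \<open>p\<close> by the product rule and completing squares turns dissipativity into nonnegativity
  of the dual cost.\<close>

lemma dual_cost_nonneg:
  fixes A :: "real^'n^'n" and B :: "real^'q^'n" and E :: "real^'w^'n" and C :: "real^'n^'p"
    and Q W :: "real^'w^'w"
  assumes hurwitz: "hurwitz A" and \<epsilon>: "\<epsilon> > 0" and \<eta>: "\<eta> > 0"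
    and Q_nonneg: "\<And>w. w \<bullet> (Q *v w) \<ge> 0"
    and W: "(Q + mat \<epsilon>) ** W = mat 1"
    and diss: "open_loop_dissipative A B E C Q \<eta>"
  obtains K where "K > 0"
    "\<And>p g z. dual_path p g z \<Longrightarrow>
       path_cost A C ((1 / \<eta>) *\<^sub>R (B ** transpose B) - E ** W ** transpose E) K p g z \<ge> 0"
proof -
  let ?M = "(1 / \<eta>) *\<^sub>R (B ** transpose B) - E ** W ** transpose E"
  obtain c where c: "c > 0"
    "\<And>f x T. linear_trajectory A f x \<Longrightarrow> T \<ge> 0 \<Longrightarrow> (\<lambda>t. (norm (f t))\<^sup>2) integrable_on {0..T} \<Longrightarrow>
       integral {0..T} (\<lambda>t. (norm (x t))\<^sup>2) \<le> c * integral {0..T} (\<lambda>t. (norm (f t))\<^sup>2)"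
    using hurwitz_L2_gain[OF hurwitz] by metis
  obtain LQ where LQ: "LQ > 0" "\<And>x. x \<bullet> (Q *v x) \<le> LQ * (norm x)\<^sup>2"
    using quadratic_form_upper_bound[of Q] by metis
  obtain LB where LB: "LB > 0" "\<And>x. norm (B *v x) \<le> LB * norm x" using matrix_vector_bound[of B] by metis
  obtain LE where LE: "LE > 0" "\<And>x. norm (E *v x) \<le> LE * norm x" using matrix_vector_bound[of E] by metis
  \<comment> \<open>A bound for the gain from \<open>w\<close> to \<open>x\<close>: the dissipation
    inequality bounds the energy of \<open>d\<close> by \<open>LQ / \<eta>\<close> times that of
    \<open>w\<close>, and \<open>c\<close> is the gain from \<open>B *v d + E *v w\<close> to
    \<open>x\<close>. Dividing by \<open>\<epsilon>\<close> in \<open>K\<close> makes the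
    \<open>x\<close> term of the dual estimate affordable by the slack.\<close>
  define c' where "c' = c * (2 * LB\<^sup>2 * (LQ / \<eta>) + 2 * LE\<^sup>2)"
  have c': "c' > 0" unfolding c'_def using c LQ LB LE \<eta> by (simp add: add_nonneg_pos)
  define K where "K = c' / \<epsilon>"
  have K: "K > 0" using c' \<epsilon> by (simp add: K_def)
  show thesis
  proof (rule that[OF K])
    fix p g :: "real \<Rightarrow> real^'n" and z :: "real \<Rightarrow> real^'p"
    assume path: "dual_path p g z"
    have ts: "p \<in> test_signals" "g \<in> test_signals" "z \<in> test_signals"
      and int_g: "\<And>t. t \<ge> 0 \<Longrightarrow> (g has_integral p 0 - p t) {0..t}"
      using path by (auto simp: dual_path_def)
    obtain Tp Tg Tz where TT: "Tp > 0" "\<And>t. t \<notin> {0..<Tp} \<Longrightarrow> p t = 0"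
      "Tg > 0" "\<And>t. t \<notin> {0..<Tg} \<Longrightarrow> g t = 0" "Tz > 0" "\<And>t. t \<notin> {0..<Tz} \<Longrightarrow> z t = 0"
      using ts unfolding test_signals_def by auto
    define T where "T = Tp + Tg + Tz"
    have T: "T > 0" and vanish: "\<And>t. t \<notin> {0..<T} \<Longrightarrow> p t = 0 \<and> g t = 0 \<and> z t = 0"
      using TT by (auto simp: T_def)
    \<comment> \<open>The maximizer of \<open>2 * (p \<bullet> (E *v w)) - w \<bullet> ((Q + mat
      \<epsilon>) *v w)\<close> at each time.\<close>
    define w where "w t = W *v (transpose E *v p t)" for t
    have w_ts: "w \<in> test_signals" unfolding w_def by (intro test_signals_matrix ts)
    have w: "w \<in> L2" by (rule test_signals_L2[OF w_ts])
    obtain d x where d: "d \<in> L2" and x: "linear_trajectory A (\<lambda>t. B *v d t + E *v w t) x"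
      and Cx: "(\<lambda>t. C *v x t) \<in> L2"
      and gain: "energy (\<lambda>t. C *v x t) \<le> integral {0..} (\<lambda>t. w t \<bullet> (Q *v w t)) - \<eta> * energy d"
      using diss w unfolding open_loop_dissipative_def by blast
    let ?I = "integral {0..T}"
    define \<phi> where "\<phi> t = A *v x t + (B *v d t + E *v w t)" for t
    have \<phi>: "\<phi> absolutely_integrable_on {0..T}" "\<And>t. t \<ge> 0 \<Longrightarrow> x t = integral {0..t} \<phi>"
      using x T by (auto simp: linear_trajectory_def \<phi>_def[abs_def])
    have x0: "x 0 = 0" using \<phi>(2)[of 0] by simp
    \<comment> \<open>The derivative of \<open>p \<bullet> x\<close>; its integral is 0 because
      \<open>x\<close> starts and \<open>p\<close> ends at 0.\<close>
    define s where "s t = p t \<bullet> \<phi> t - x t \<bullet> g t" for t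
    have s: "(s has_integral 0) {0..T}"
    proof -
      have "(\<lambda>t. - 1 *\<^sub>R g t + 0 *\<^sub>R g t) \<in> test_signals" by (rule test_signals_comb[OF ts(2) ts(2)])
      then have "(\<lambda>t. - g t) absolutely_integrable_on {0..T}"
        using L2_absolutely_integrable[OF test_signals_L2] by simp
      then have "((\<lambda>t. p t \<bullet> \<phi> t + x t \<bullet> (- g t)) has_integral x T \<bullet> p T - x 0 \<bullet> p 0) {0..T}"
        using T
      proof (intro ac_product_rule \<phi>(1))
        fix t assume "t \<in> {0..T}"
        then show "x t = x 0 + integral {0..t} \<phi>" "p t = p 0 + integral {0..t} (\<lambda>t. - g t)"
          using \<phi>(2)[of t] x0 integral_unique[OF int_g[of t]] by simp_all
      qed auto
      then show ?thesis using vanish[of T] by (simp add: x0 s_def[abs_def])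
    qed
    have int_sq: "(\<lambda>t. (norm (u t))\<^sup>2) integrable_on {0..T}" if "u \<in> L2" for u :: "real \<Rightarrow> real^'k"
      using that by (intro integrable_on_Icc_if_Ici) (simp add: L2_iff)
    have int_x: "(\<lambda>t. (norm (x t))\<^sup>2) integrable_on {0..T}"
      by (intro integrable_continuous_real continuous_intros linear_trajectory_continuous[OF x])
    have int_wQ: "(\<lambda>t. w t \<bullet> (Q *v w t)) integrable_on {0..}"
      by (intro L2_inner_integrable L2_matrix w)
    have int_ww: "(\<lambda>t. (norm (w t))\<^sup>2) integrable_on {0..T}" by (rule int_sq[OF w])
    have wQ_eq: "integral {0..} (\<lambda>t. w t \<bullet> (Q *v w t)) = ?I (\<lambda>t. w t \<bullet> (Q *v w t))"
    proof -
      have "integral {0..} (\<lambda>t. if t \<in> {0..T} then w t \<bullet> (Q *v w t) else 0) = ?I (\<lambda>t. w t \<bullet> (Q *v w t))"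
        unfolding integral_restrict_Int by (rule arg_cong[of _ _ "\<lambda>S. integral S _"]) auto
      moreover have "(if t \<in> {0..T} then w t \<bullet> (Q *v w t) else 0) = w t \<bullet> (Q *v w t)" for t
        using vanish[of t] by (auto simp: w_def)
      ultimately show ?thesis by (simp only:)
    qed
    have le_energy: "?I (\<lambda>t. (norm (u t))\<^sup>2) \<le> energy u" if "u \<in> L2" for u :: "real \<Rightarrow> real^'k"
      using that by (intro integral_subset_le int_sq) (auto simp: L2_iff)
    \<comment> \<open>Although \<open>d\<close> acts on the whole half-line, the horizon can be cut
      at \<open>T\<close>: the supply vanishes afterwards together with \<open>w\<close>, and the
      other side only loses nonnegative terms.\<close>
    have gain_T: "?I (\<lambda>t. (norm (C *v x t))\<^sup>2) + \<eta> * ?I (\<lambda>t. (norm (d t))\<^sup>2) \<le> ?I (\<lambda>t. w t \<bullet> (Q *v w t))"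
    proof -
      have "\<eta> * ?I (\<lambda>t. (norm (d t))\<^sup>2) \<le> \<eta> * energy d" using le_energy[OF d] \<eta> by simp
      then show ?thesis using gain le_energy[OF Cx] wQ_eq by simp
    qed
    have x_bound: "?I (\<lambda>t. (norm (x t))\<^sup>2) \<le> c' * ?I (\<lambda>t. (norm (w t))\<^sup>2)"
    proof -
      let ?f = "\<lambda>t. B *v d t + E *v w t"
      have "?I (\<lambda>t. (norm (x t))\<^sup>2) \<le> c * ?I (\<lambda>t. (norm (?f t))\<^sup>2)"
        using T by (intro c(2)[OF x] int_sq L2_add L2_matrix d w) auto
      also have "?I (\<lambda>t. (norm (?f t))\<^sup>2) \<le> ?I (\<lambda>t. 2 * LB\<^sup>2 * (norm (d t))\<^sup>2 + 2 * LE\<^sup>2 * (norm (w t))\<^sup>2)"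
      proof (rule integral_le)
        show "(\<lambda>t. (norm (?f t))\<^sup>2) integrable_on {0..T}" by (intro int_sq L2_add L2_matrix d w)
        show "(\<lambda>t. 2 * LB\<^sup>2 * (norm (d t))\<^sup>2 + 2 * LE\<^sup>2 * (norm (w t))\<^sup>2) integrable_on {0..T}"
          by (intro integrable_add integrable_on_mult_right int_sq d w)
        fix t
        have "(norm (B *v d t))\<^sup>2 \<le> LB\<^sup>2 * (norm (d t))\<^sup>2" "(norm (E *v w t))\<^sup>2 \<le> LE\<^sup>2 * (norm (w t))\<^sup>2"
          using power_mono[OF LB(2)[of "d t"], of 2] power_mono[OF LE(2)[of "w t"], of 2]
          by (simp_all add: power_mult_distrib)
        then show "(norm (?f t))\<^sup>2 \<le> 2 * LB\<^sup>2 * (norm (d t))\<^sup>2 + 2 * LE\<^sup>2 * (norm (w t))\<^sup>2"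
          using norm_add_power2_le[of "B *v d t" "E *v w t"] by simp
      qed
      also have "\<dots> = 2 * LB\<^sup>2 * ?I (\<lambda>t. (norm (d t))\<^sup>2) + 2 * LE\<^sup>2 * ?I (\<lambda>t. (norm (w t))\<^sup>2)"
        by (subst Henstock_Kurzweil_Integration.integral_add)
          (simp_all only: Henstock_Kurzweil_Integration.integral_mult_right integrable_on_mult_right int_sq d w)
      also have "?I (\<lambda>t. (norm (d t))\<^sup>2) \<le> LQ / \<eta> * ?I (\<lambda>t. (norm (w t))\<^sup>2)"
      proof -
        have "0 \<le> ?I (\<lambda>t. (norm (C *v x t))\<^sup>2)" by (intro integral_nonneg int_sq Cx) simp
        then have "\<eta> * ?I (\<lambda>t. (norm (d t))\<^sup>2) \<le> ?I (\<lambda>t. w t \<bullet> (Q *v w t))" using gain_T by linarith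
        also have "\<dots> \<le> ?I (\<lambda>t. LQ * (norm (w t))\<^sup>2)"
          by (intro integral_le integrable_on_Icc_if_Ici int_wQ integrable_on_mult_right int_ww LQ(2))
        finally show ?thesis using \<eta> by (simp add: field_simps)
      qed
      finally have "?I (\<lambda>t. (norm (x t))\<^sup>2)
          \<le> c * (2 * LB\<^sup>2 * (LQ / \<eta> * ?I (\<lambda>t. (norm (w t))\<^sup>2)) + 2 * LE\<^sup>2 * ?I (\<lambda>t. (norm (w t))\<^sup>2))"
        using c(1) by (simp add: mult_left_mono)
      then show ?thesis by (simp only: c'_def distrib_left distrib_right mult.assoc)
    qed
    define \<Lambda> where "\<Lambda> t = stage_cost A C ?M K (p t) (g t) (z t)" for t
    \<comment> \<open>What remains of the dual cost after Young's inequality for the pairs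
      \<open>z, C *v x\<close>, \<open>v, x\<close> and \<open>transpose B *v p, d\<close>. Its
      integral is nonnegative by \<open>gain_T\<close> and \<open>x_bound\<close>.\<close>
    define low where "low t = w t \<bullet> (Q *v w t) + \<epsilon> * (norm (w t))\<^sup>2 - 2 * s t - (norm (C *v x t))\<^sup>2
       - (norm (x t))\<^sup>2 / K - \<eta> * (norm (d t))\<^sup>2" for t
    have pointwise: "low t \<le> \<Lambda> t" for t
    proof -
      define v where "v = g t - transpose A *v p t - transpose C *v z t"
      have Qw: "(Q + mat \<epsilon>) *v w t = transpose E *v p t"
        using W by (simp add: w_def matrix_vector_mul_assoc)
      have pEw: "p t \<bullet> (E *v w t) = w t \<bullet> (Q *v w t) + \<epsilon> * (norm (w t))\<^sup>2"
      proof -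
        have "p t \<bullet> (E *v w t) = w t \<bullet> ((Q + mat \<epsilon>) *v w t)"
          unfolding Qw by (simp only: inner_transpose inner_commute)
        then show ?thesis
          by (simp only: matrix_vector_mult_add_rdistrib mat_vector_mult inner_add_right inner_scaleR_right
              power2_norm_eq_inner)
      qed
      have "p t \<bullet> (?M *v p t) = 1 / \<eta> * (norm (transpose B *v p t))\<^sup>2 - p t \<bullet> (E *v w t)"
      proof -
        have "p t \<bullet> (B *v (transpose B *v p t)) = (norm (transpose B *v p t))\<^sup>2"
          using inner_transpose[of "p t" "transpose B" "transpose B *v p t"]
          by (simp add: power2_norm_eq_inner)
        then show ?thesis
          by (simp add: matrix_vector_mult_diff_rdistrib inner_diff_right scaleR_matrix_vector_assoc[symmetric]
              w_def matrix_vector_mul_assoc[symmetric])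
      qed
      then have "\<Lambda> t = (norm (z t))\<^sup>2 + K * (norm v)\<^sup>2 + 1 / \<eta> * (norm (transpose B *v p t))\<^sup>2 - p t \<bullet> (E *v w t)"
        by (simp add: \<Lambda>_def stage_cost_def v_def)
      moreover have "2 * (z t \<bullet> (C *v x t)) \<le> (norm (z t))\<^sup>2 + (norm (C *v x t))\<^sup>2"
        using young[of 1 "z t" "C *v x t"] by simp
      moreover have "2 * (v \<bullet> x t) \<le> K * (norm v)\<^sup>2 + (norm (x t))\<^sup>2 / K" by (rule young[OF K])
      moreover have "- 2 * ((transpose B *v p t) \<bullet> d t) \<le> 1 / \<eta> * (norm (transpose B *v p t))\<^sup>2 + \<eta> * (norm (d t))\<^sup>2"
        using young[of "1 / \<eta>" "transpose B *v p t" "- d t"] \<eta> by (simp add: mult.commute)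
      moreover have "s t = (transpose B *v p t) \<bullet> d t + p t \<bullet> (E *v w t) - v \<bullet> x t - z t \<bullet> (C *v x t)"
      proof -
        have "p t \<bullet> (A *v x t) = (transpose A *v p t) \<bullet> x t" "p t \<bullet> (B *v d t) = (transpose B *v p t) \<bullet> d t"
          "z t \<bullet> (C *v x t) = (transpose C *v z t) \<bullet> x t"
          using inner_transpose[of "x t" A "p t"] inner_transpose[of "d t" B "p t"] inner_transpose[of "x t" C "z t"]
          by (simp_all add: inner_commute)
        then show ?thesis
          unfolding s_def \<phi>_def v_def
          by (simp add: inner_add_right inner_diff_left inner_diff_right inner_commute)
      qed
      ultimately show ?thesis unfolding low_def using pEw by linarith
    qed
    have "0 \<le> ?I low"
    proof -
      have low: "(low has_integral ?I (\<lambda>t. w t \<bullet> (Q *v w t)) + \<epsilon> * ?I (\<lambda>t. (norm (w t))\<^sup>2) - 2 * 0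
          - ?I (\<lambda>t. (norm (C *v x t))\<^sup>2) - ?I (\<lambda>t. (norm (x t))\<^sup>2) / K - \<eta> * ?I (\<lambda>t. (norm (d t))\<^sup>2)) {0..T}"
        unfolding low_def divide_inverse
        by (intro has_integral_add has_integral_diff has_integral_mult_right has_integral_mult_left s
            integrable_integral int_sq w d Cx int_x integrable_on_Icc_if_Ici[OF int_wQ])
      have "?I (\<lambda>t. (norm (x t))\<^sup>2) / K \<le> \<epsilon> * ?I (\<lambda>t. (norm (w t))\<^sup>2)"
        using x_bound c' \<epsilon> by (simp add: K_def field_simps)
      then show ?thesis unfolding integral_unique[OF low] using gain_T by simp
    qed
    also have "?I low \<le> ?I \<Lambda>"
    proof (rule integral_le)
      show "low integrable_on {0..T}"
        unfolding low_def divide_inverse using s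
        by (intro integrable_add integrable_diff integrable_on_mult_right integrable_on_mult_left int_sq w d Cx int_x
            integrable_on_Icc_if_Ici[OF int_wQ]) auto
      have "\<Lambda> integrable_on UNIV"
        unfolding \<Lambda>_def by (intro integrable_on_lborel stage_cost_integrable path)
      then show "\<Lambda> integrable_on {0..T}" by (rule integrable_on_subinterval) simp
    qed (rule pointwise)
    also have "?I \<Lambda> = path_cost A C ?M K p g z"
    proof -
      have "path_cost A C ?M K p g z = integral UNIV \<Lambda>"
        unfolding path_cost_def \<Lambda>_def by (rule integral_lborel[symmetric]) (rule stage_cost_integrable[OF path])
      also have "\<Lambda> = (\<lambda>t. if t \<in> {0..T} then \<Lambda> t else 0)"
        using vanish by (auto simp: \<Lambda>_def stage_cost_def fun_eq_iff)
      also have "integral UNIV \<dots> = ?I \<Lambda>" by (simp only: integral_restrict_Int Int_UNIV_right)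
      finally show ?thesis by simp
    qed
    finally show "path_cost A C ?M K p g z \<ge> 0" .
  qed
qed

text \<open>Adding a small multiple of a Lyapunov matrix makes the Riccati inequality strict, since its cross
  term is absorbed by \<open>|Xq|\<^sup>2 / K\<close>.\<close>

lemma strict_riccati:
  fixes A :: "real^'n^'n" and C :: "real^'n^'p" and M X :: "real^'n^'n"
  assumes hurwitz: "hurwitz A" and K: "K > 0"
    and X: "transpose X = X" "\<And>q. q \<bullet> (X *v q) \<ge> 0"
    and ineq: "\<And>q a \<zeta>. 2 * (q \<bullet> (X *v a)) \<le> stage_cost A C M K q a \<zeta>"
  obtains Z where "positive_definite Z"
    "\<And>q. q \<noteq> 0 \<Longrightarrow> 2 * (q \<bullet> (A *v (Z *v q))) + (norm (C *v (Z *v q)))\<^sup>2 < q \<bullet> (M *v q)"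
proof -
  have symX: "x \<bullet> (X *v y) = (X *v x) \<bullet> y" for x y using inner_transpose[of x X y] X(1) by simp
  have riccati: "2 * (q \<bullet> (A *v (X *v q))) + (norm (C *v (X *v q)))\<^sup>2 + (norm (X *v q))\<^sup>2 / K \<le> q \<bullet> (M *v q)" for q
  proof -
    \<comment> \<open>For fixed \<open>q\<close> these \<open>\<zeta>\<close> and \<open>v\<close>
      make the inequality sharpest: they maximize the difference of its two sides.\<close>
    define y \<zeta> v where "y = X *v q" and "\<zeta> = C *v y" and "v = (1 / K) *\<^sub>R y"
    have "2 * (q \<bullet> (X *v (transpose A *v q + transpose C *v \<zeta> + v))) \<le> (norm \<zeta>)\<^sup>2 + K * (norm v)\<^sup>2 + q \<bullet> (M *v q)"
      using ineq[of q "transpose A *v q + transpose C *v \<zeta> + v" \<zeta>] by (simp add: stage_cost_def)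
    moreover have "q \<bullet> (X *v (transpose A *v q + transpose C *v \<zeta> + v)) = q \<bullet> (A *v y) + (norm \<zeta>)\<^sup>2 + (norm y)\<^sup>2 / K"
      unfolding symX y_def[symmetric] inner_add_right inner_transpose
      by (simp add: v_def \<zeta>_def[symmetric] power2_norm_eq_inner inner_commute)
    moreover have "K * (norm v)\<^sup>2 = (norm y)\<^sup>2 / K"
      using K by (simp add: v_def power_mult_distrib power_divide power2_eq_square)
    ultimately show ?thesis unfolding \<zeta>_def y_def by simp
  qed
  obtain P a where P: "positive_definite P" and a: "a > 0"
    and lyap: "\<And>x. x \<bullet> (P *v (A *v x)) \<le> - a * (norm x)\<^sup>2"
    using hurwitz_lyapunov[OF hurwitz] by metis
  \<comment> \<open>The inverse of a Lyapunov matrix satisfies the Lyapunov inequality in costate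
    coordinates, as needed for a perturbation of \<open>X\<close>.\<close>
  obtain Y where Y: "positive_definite Y" "P ** Y = mat 1" using positive_definite_inverse[OF P] by metis
  have PY: "P *v (Y *v q) = q" for q by (simp add: matrix_vector_mul_assoc Y(2))
  obtain LP where LP: "LP > 0" "\<And>x. norm (P *v x) \<le> LP * norm x" using matrix_vector_bound[of P] by metis
  define b where "b = a / LP\<^sup>2"
  have b: "b > 0" using a LP by (simp add: b_def)
  have lyapY: "q \<bullet> (A *v (Y *v q)) \<le> - b * (norm q)\<^sup>2" for q
  proof -
    have "x \<bullet> (P *v y) = (P *v x) \<bullet> y" for x y
      using inner_transpose[of x P y] P unfolding positive_definite_def by metis
    then have "q \<bullet> (A *v (Y *v q)) = (Y *v q) \<bullet> (P *v (A *v (Y *v q)))" by (simp add: PY)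
    also have "\<dots> \<le> - a * (norm (Y *v q))\<^sup>2" by (rule lyap)
    also have "\<dots> \<le> - b * (norm q)\<^sup>2"
    proof -
      have "(norm q)\<^sup>2 \<le> (LP * norm (Y *v q))\<^sup>2"
        using LP(2)[of "Y *v q"] by (intro power_mono) (simp_all add: PY)
      then have "b * (norm q)\<^sup>2 \<le> b * (LP * norm (Y *v q))\<^sup>2" using b by (intro mult_left_mono) auto
      then show ?thesis using LP by (simp add: b_def power_mult_distrib)
    qed
    finally show ?thesis .
  qed
  obtain l1 where l1: "l1 > 0" "\<And>x. norm ((transpose C ** C ** Y) *v x) \<le> l1 * norm x"
    using matrix_vector_bound[of "transpose C ** C ** Y"] by metis
  obtain l2 where l2: "l2 > 0" "\<And>x. norm ((C ** Y) *v x) \<le> l2 * norm x"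
    using matrix_vector_bound[of "C ** Y"] by metis
  \<comment> \<open>Adding \<open>r *\<^sub>R Y\<close> gains \<open>2 * r * b\<close> at first
    order and loses at most \<open>r * r * k\<close> at second order. With \<open>r = b / k\<close>
    the loss is half of the gain.\<close>
  define k where "k = K * l1\<^sup>2 + l2\<^sup>2"
  have k: "k > 0" using K l1 l2 by (simp add: k_def add_nonneg_pos)
  define r where "r = b / k"
  have r: "r > 0" using b k by (simp add: r_def)
  define Z where "Z = X + r *\<^sub>R Y"
  have Z: "Z *v q = X *v q + r *\<^sub>R (Y *v q)" for q
    by (simp add: Z_def matrix_vector_mult_add_rdistrib scaleR_matrix_vector_assoc)
  show thesis
  proof (rule that[of Z])
    show "positive_definite Z"
      unfolding positive_definite_def symmetric_matrix_iff
    proof (intro conjI allI impI)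
      fix x y :: "real^'n"
      have "x \<bullet> (X *v y) = y \<bullet> (X *v x)" "x \<bullet> (Y *v y) = y \<bullet> (Y *v x)"
        using X(1) Y(1) symmetric_matrix_iff unfolding positive_definite_def by blast+
      then show "x \<bullet> (Z *v y) = y \<bullet> (Z *v x)" by (simp add: Z inner_add_right)
    next
      fix v :: "real^'n" assume "v \<noteq> 0"
      then have "v \<bullet> (Y *v v) > 0" using Y(1) unfolding positive_definite_def by blast
      then have "r * (v \<bullet> (Y *v v)) > 0" using r by simp
      then show "v \<bullet> (Z *v v) > 0" using X(2)[of v] by (simp add: Z inner_add_right)
    qed
    fix q :: "real^'n" assume q: "q \<noteq> 0"
    define x u y where "x = X *v q" and "u = (transpose C ** C ** Y) *v q" and "y = (C ** Y) *v q"
    have u: "x \<bullet> u = (C *v x) \<bullet> y"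
      unfolding u_def y_def by (simp only: matrix_vector_mul_assoc[symmetric] inner_transpose)
    have y: "C *v (Y *v q) = y" by (simp add: y_def matrix_vector_mul_assoc)
    have "2 * (q \<bullet> (A *v (Z *v q))) = 2 * (q \<bullet> (A *v x)) + 2 * r * (q \<bullet> (A *v (Y *v q)))"
      by (simp add: Z x_def matrix_vector_right_distrib matrix_vector_mult_scaleR inner_add_right)
    also have "\<dots> \<le> 2 * (q \<bullet> (A *v x)) - 2 * r * (b * (norm q)\<^sup>2)"
    proof -
      have "2 * r * (q \<bullet> (A *v (Y *v q))) \<le> 2 * r * (- b * (norm q)\<^sup>2)"
        by (rule mult_left_mono[OF lyapY]) (use r in simp)
      moreover have "2 * r * (- b * (norm q)\<^sup>2) = - (2 * r * (b * (norm q)\<^sup>2))" by simp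
      ultimately show ?thesis by linarith
    qed
    finally have 1: "2 * (q \<bullet> (A *v (Z *v q))) \<le> 2 * (q \<bullet> (A *v x)) - 2 * r * (b * (norm q)\<^sup>2)" .
    have "(norm (C *v (Z *v q)))\<^sup>2 = (norm (C *v x))\<^sup>2 + 2 * (x \<bullet> (r *\<^sub>R u)) + r\<^sup>2 * (norm y)\<^sup>2"
      unfolding Z x_def[symmetric] matrix_vector_right_distrib matrix_vector_mult_scaleR y power2_norm_eq_inner
      by (simp add: inner_add_left inner_add_right u inner_commute[of y "C *v x"] power2_eq_square distrib_left)
    also have "2 * (x \<bullet> (r *\<^sub>R u)) \<le> (norm x)\<^sup>2 / K + K * (r\<^sup>2 * (norm u)\<^sup>2)"
      using young[of "1 / K" x "r *\<^sub>R u"] K by (simp add: power_mult_distrib mult.commute)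
    finally have 2: "(norm (C *v (Z *v q)))\<^sup>2
        \<le> (norm (C *v x))\<^sup>2 + (norm x)\<^sup>2 / K + r\<^sup>2 * (K * (norm u)\<^sup>2 + (norm y)\<^sup>2)"
      by (simp add: algebra_simps)
    have "(norm u)\<^sup>2 \<le> l1\<^sup>2 * (norm q)\<^sup>2" "(norm y)\<^sup>2 \<le> l2\<^sup>2 * (norm q)\<^sup>2"
      using power_mono[OF l1(2)[of q], of 2] power_mono[OF l2(2)[of q], of 2]
      by (simp_all add: u_def y_def power_mult_distrib)
    then have "K * (norm u)\<^sup>2 + (norm y)\<^sup>2 \<le> K * (l1\<^sup>2 * (norm q)\<^sup>2) + l2\<^sup>2 * (norm q)\<^sup>2"
      using K by (intro add_mono mult_left_mono) auto
    then have "r\<^sup>2 * (K * (norm u)\<^sup>2 + (norm y)\<^sup>2) \<le> r\<^sup>2 * (k * (norm q)\<^sup>2)"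
      by (intro mult_left_mono) (auto simp: k_def algebra_simps)
    also have "r\<^sup>2 * (k * (norm q)\<^sup>2) = r * (b * (norm q)\<^sup>2)"
      using k by (simp add: r_def power2_eq_square)
    also have "\<dots> < 2 * r * (b * (norm q)\<^sup>2)" using r b q by simp
    finally have 3: "r\<^sup>2 * (K * (norm u)\<^sup>2 + (norm y)\<^sup>2) < 2 * r * (b * (norm q)\<^sup>2)" .
    show "2 * (q \<bullet> (A *v (Z *v q))) + (norm (C *v (Z *v q)))\<^sup>2 < q \<bullet> (M *v q)"
      using 1 2 3 riccati[of q] unfolding x_def[symmetric] by linarith
  qed
qed

text \<open>The slack is halved: one half enters \<open>Q2\<close> and pays for the finite penalty
  in the dual problem, the other remains as strict negativity in \<open>w\<close>. The form then
  splits into the Riccati expression and negative squares.\<close>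

lemma open_loop_dissipative_imp_lmi:
  fixes A :: "real^'n^'n" and B :: "real^'q^'n" and E :: "real^'w^'n" and C :: "real^'n^'p"
    and Q :: "real^'w^'w"
  assumes hurwitz: "hurwitz A" and \<epsilon>: "\<epsilon> > 0" and \<eta>: "\<eta> > 0"
    and Q: "positive_definite Q" and diss: "open_loop_dissipative A B E C Q \<eta>"
  obtains X Pi where "positive_definite X"
    "\<And>\<xi> w r1 r2. \<xi> \<noteq> 0 \<or> w \<noteq> 0 \<or> r1 \<noteq> 0 \<or> r2 \<noteq> 0 \<Longrightarrow>
       lmi_form A B E C (Q + mat \<epsilon>) (1 / \<eta>) X Pi \<xi> w r1 r2 < 0"
proof -
  define Q2 where "Q2 = Q + mat (\<epsilon> / 2)"
  have Q2_v: "Q2 *v w = Q *v w + (\<epsilon> / 2) *\<^sub>R w" for w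
    by (simp add: Q2_def matrix_vector_mult_add_rdistrib mat_vector_mult)
  have "positive_definite Q2"
    unfolding positive_definite_def symmetric_matrix_iff
  proof (intro conjI allI impI)
    fix x y
    have "x \<bullet> (Q *v y) = y \<bullet> (Q *v x)"
      using Q symmetric_matrix_iff unfolding positive_definite_def by blast
    then show "x \<bullet> (Q2 *v y) = y \<bullet> (Q2 *v x)" by (simp add: Q2_v inner_add_right inner_commute)
  next
    fix v :: "real^'w" assume "v \<noteq> 0"
    then have "v \<bullet> (Q *v v) > 0" "\<epsilon> / 2 * (v \<bullet> v) > 0" using Q \<epsilon> unfolding positive_definite_def by auto
    then show "v \<bullet> (Q2 *v v) > 0" by (simp add: Q2_v inner_add_right)
  qed
  then obtain W where W: "Q2 ** W = mat 1" using positive_definite_inverse by metis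
  have Q2_nonneg: "w \<bullet> (Q2 *v w) \<ge> 0" for w by (rule positive_definite_nonneg[OF \<open>positive_definite Q2\<close>])
  have Q2_sym: "x \<bullet> (Q2 *v y) = y \<bullet> (Q2 *v x)" for x y
    using \<open>positive_definite Q2\<close> symmetric_matrix_iff unfolding positive_definite_def by blast
  define M where "M = (1 / \<eta>) *\<^sub>R (B ** transpose B) - E ** W ** transpose E"
  obtain K where K: "K > 0" "\<And>p g z. dual_path p g z \<Longrightarrow> path_cost A C M K p g z \<ge> 0"
    using dual_cost_nonneg[OF hurwitz _ \<eta> positive_definite_nonneg[OF Q] W[unfolded Q2_def] diss] \<epsilon>
    unfolding M_def by (metis half_gt_zero)
  obtain X where X: "transpose X = X" "\<And>q. q \<bullet> (X *v q) \<ge> 0"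
    "\<And>q a \<zeta>. 2 * (q \<bullet> (X *v a)) \<le> stage_cost A C M K q a \<zeta>"
    using dual_value_matrix[OF K(2)] by metis
  obtain Z where Z: "positive_definite Z"
    "\<And>q. q \<noteq> 0 \<Longrightarrow> 2 * (q \<bullet> (A *v (Z *v q))) + (norm (C *v (Z *v q)))\<^sup>2 < q \<bullet> (M *v q)"
    using strict_riccati[OF hurwitz K(1) X] by metis
  \<comment> \<open>Eliminating \<open>r2\<close> leaves
    \<open>2 * (\<xi> \<bullet> (B *v d)) + \<eta> * (d \<bullet> d)\<close> with
    \<open>d = Pi *v \<xi>\<close>; this choice minimizes it pointwise.\<close>
  define Pi where "Pi = (- 1 / \<eta>) *\<^sub>R transpose B"
  have "lmi_form A B E C (Q + mat \<epsilon>) (1 / \<eta>) Z Pi \<xi> w r1 r2 < 0"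
    if nz: "\<xi> \<noteq> 0 \<or> w \<noteq> 0 \<or> r1 \<noteq> 0 \<or> r2 \<noteq> 0" for \<xi> w r1 r2
  proof -
    define \<beta> e w0 y where "\<beta> = transpose B *v \<xi>" and "e = transpose E *v \<xi>" and "w0 = W *v e"
      and "y = C *v (Z *v \<xi>)"
    have Pi: "Pi *v \<xi> = (- 1 / \<eta>) *\<^sub>R \<beta>" by (simp only: Pi_def \<beta>_def scaleR_matrix_vector_assoc)
    have B: "\<xi> \<bullet> (B *v u) = \<beta> \<bullet> u" for u
      using inner_transpose[of u B \<xi>] by (simp add: \<beta>_def inner_commute)
    have E: "\<xi> \<bullet> (E *v u) = e \<bullet> u" for u
      using inner_transpose[of u E \<xi>] by (simp add: e_def inner_commute)
    have M: "\<xi> \<bullet> (M *v \<xi>) = 1 / \<eta> * (\<beta> \<bullet> \<beta>) - e \<bullet> w0"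
      unfolding M_def
      by (simp add: matrix_vector_mult_diff_rdistrib inner_diff_right scaleR_matrix_vector_assoc[symmetric]
          matrix_vector_mul_assoc[symmetric] B E w0_def flip: e_def \<beta>_def del: transpose_matrix_vector)
    have "Q2 *v w0 = e" using W by (simp add: w0_def matrix_vector_mul_assoc)
    \<comment> \<open>Completing the square in \<open>w\<close> around the worst case
      \<open>w0\<close>.\<close>
    then have "0 \<le> w \<bullet> (Q2 *v w) - 2 * (e \<bullet> w) + e \<bullet> w0"
      using Q2_nonneg[of "w - w0"] Q2_sym[of w0 w]
      by (simp add: matrix_vector_mult_diff_distrib inner_diff_left inner_diff_right inner_commute)
    then have 1: "2 * (e \<bullet> w) \<le> w \<bullet> (Q *v w) + \<epsilon> / 2 * (norm w)\<^sup>2 + e \<bullet> w0"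
      by (simp add: Q2_v inner_add_right power2_norm_eq_inner)
    have 2: "2 * (r1 \<bullet> y) - (norm r1)\<^sup>2 = (norm y)\<^sup>2 - (norm (r1 - y))\<^sup>2"
      by (simp add: power2_norm_eq_inner inner_diff_left inner_diff_right inner_commute)
    have 3: "- 2 / \<eta> * (r2 \<bullet> \<beta>) - 1 / \<eta> * (norm r2)\<^sup>2 = 1 / \<eta> * (\<beta> \<bullet> \<beta>) - 1 / \<eta> * (norm (r2 + \<beta>))\<^sup>2"
      by (simp add: power2_norm_eq_inner inner_add_left inner_add_right inner_commute distrib_left right_diff_distrib
          add_divide_distrib)
    have "lmi_form A B E C (Q + mat \<epsilon>) (1 / \<eta>) Z Pi \<xi> w r1 r2 =
      2 * (\<xi> \<bullet> (A *v (Z *v \<xi>))) - 2 / \<eta> * (\<beta> \<bullet> \<beta>) + 2 * (e \<bullet> w) + 2 * (r1 \<bullet> y) - 2 / \<eta> * (r2 \<bullet> \<beta>)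
        - w \<bullet> (Q *v w) - \<epsilon> * (norm w)\<^sup>2 - (norm r1)\<^sup>2 - 1 / \<eta> * (norm r2)\<^sup>2"
      unfolding lmi_form_def Pi y_def[symmetric] B E
      by (simp add: matrix_vector_mult_add_rdistrib mat_vector_mult inner_add_right power2_norm_eq_inner
          distrib_left)
    also have "\<dots> \<le> 2 * (\<xi> \<bullet> (A *v (Z *v \<xi>))) + (norm y)\<^sup>2 - \<xi> \<bullet> (M *v \<xi>)
        - \<epsilon> / 2 * (norm w)\<^sup>2 - (norm (r1 - y))\<^sup>2 - 1 / \<eta> * (norm (r2 + \<beta>))\<^sup>2"
      using 1 2 3 unfolding M by simp
    also have "\<dots> < 0"
    \<comment> \<open>For nonzero \<open>\<xi>\<close> strictness comes from the Riccati inequality;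
      otherwise the Riccati expression and the shifts \<open>y\<close> and \<open>\<beta>\<close>
      vanish, and the squares of \<open>w, r1, r2\<close> decide.\<close>
    proof (cases "\<xi> = 0")
      case False
      have "\<epsilon> / 2 * (norm w)\<^sup>2 \<ge> 0" "(norm (r1 - y))\<^sup>2 \<ge> 0" "1 / \<eta> * (norm (r2 + \<beta>))\<^sup>2 \<ge> 0"
        using \<epsilon> \<eta> by auto
      then show ?thesis using Z(2)[OF False] unfolding y_def[symmetric] by linarith
    next
      case True
      then have "y = 0" "\<beta> = 0" by (simp_all add: y_def \<beta>_def)
      have "\<epsilon> / 2 * (norm w)\<^sup>2 \<ge> 0" "(norm r1)\<^sup>2 \<ge> 0" "1 / \<eta> * (norm r2)\<^sup>2 \<ge> 0"
        using \<epsilon> \<eta> by auto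
      moreover have "\<epsilon> / 2 * (norm w)\<^sup>2 > 0 \<or> (norm r1)\<^sup>2 > 0 \<or> 1 / \<eta> * (norm r2)\<^sup>2 > 0"
        using nz True \<epsilon> \<eta> by auto
      moreover have "2 * (\<xi> \<bullet> (A *v (Z *v \<xi>))) + (norm y)\<^sup>2 - \<xi> \<bullet> (M *v \<xi>) = 0"
        using True \<open>y = 0\<close> by simp
      ultimately show ?thesis unfolding \<open>y = 0\<close> \<open>\<beta> = 0\<close> diff_zero add_0_right
        by (elim disjE; linarith)
    qed
    finally show ?thesis .
  qed
  with Z(1) show thesis by (rule that)
qed

section \<open>Block matrices\<close>

lemma sum_UNIV_Plus: "(\<Sum>k\<in>UNIV. f k) = (\<Sum>a\<in>UNIV. f (Inl a)) + (\<Sum>b\<in>UNIV. f (Inr b))"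
  for f :: "'a::finite + 'b::finite \<Rightarrow> 'c::comm_monoid_add"
  using sum.Plus[of "UNIV :: 'a set" "UNIV :: 'b set" f] by (simp add: comp_def)

lemma inner_stack: "stack a b \<bullet> stack c d = a \<bullet> c + b \<bullet> d"
  by (simp add: inner_vec_def stack_def sum_UNIV_Plus)

lemma norm_stack: "(norm (stack a b))\<^sup>2 = (norm a)\<^sup>2 + (norm b)\<^sup>2"
  by (simp add: power2_norm_eq_inner inner_stack)

lemma hcat_stack: "hcat M N *v stack a b = M *v a + N *v b" for M :: "real^'a^'r"
  by (simp add: vec_eq_iff matrix_vector_mult_def hcat_def stack_def sum_UNIV_Plus)

lemma vcat_vector: "vcat M N *v x = stack (M *v x) (N *v x)" for M :: "real^'a^'r"
  by (simp add: vec_eq_iff matrix_vector_mult_def vcat_def stack_def split: sum.split)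

lemma stack_add: "stack a b + stack c d = stack (a + c) (b + d)"
  by (simp add: vec_eq_iff stack_def split: sum.split)

lemma stack_eq_iff: "stack a b = stack c d \<longleftrightarrow> a = c \<and> b = d"
  by (auto simp: vec_eq_iff stack_def split: sum.splits)

lemma stack_zero: "stack 0 0 = 0"
  by (simp add: vec_eq_iff stack_def split: sum.split)

lemma stack_eq_0_iff: "stack a b = 0 \<longleftrightarrow> a = 0 \<and> b = 0"
  using stack_eq_iff[of a b 0 0] by (simp add: stack_zero)

text \<open>Block projections as matrices, so that facts about \<open>L2\<close> and matrix
  multiplication apply to the blocks of a signal.\<close>

abbreviation upper :: "real^('a::finite + 'b::finite) \<Rightarrow> real^'a" where
  "upper v \<equiv> hcat (mat 1) 0 *v v"

abbreviation lower :: "real^('a::finite + 'b::finite) \<Rightarrow> real^'b" where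
  "lower v \<equiv> hcat 0 (mat 1) *v v"

lemma stack_upper_lower: "stack (upper v) (lower v) = v"
proof -
  define a b where "a = (\<chi> i. v $ Inl i)" and "b = (\<chi> i. v $ Inr i)"
  have "v = stack a b"
    by (simp add: a_def b_def vec_eq_iff stack_def split: sum.split)
  then show ?thesis by (simp add: hcat_stack)
qed

lemma stack_as_matrices: "stack a b = vcat (mat 1) 0 *v a + vcat 0 (mat 1) *v b"
  by (simp add: vcat_vector stack_add)

lemma L2_stack:
  assumes "u \<in> L2" "v \<in> L2"
  shows "(\<lambda>t. stack (u t) (v t)) \<in> L2"
  unfolding stack_as_matrices by (intro L2_add L2_matrix assms)

lemma linear_trajectory_stack:
  fixes A1 :: "real^'n1^'n1" and A2 :: "real^'n2^'n2"
  assumes x1: "linear_trajectory A1 f1 x1" and x2: "linear_trajectory A2 f2 x2"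
  shows "linear_trajectory (vcat (hcat A1 0) (hcat 0 A2)) (\<lambda>t. stack (f1 t) (f2 t)) (\<lambda>t. stack (x1 t) (x2 t))"
  unfolding linear_trajectory_def
proof (intro allI impI)
  fix t :: real assume t: "t \<ge> 0"
  define g1 g2 where "g1 s = A1 *v x1 s + f1 s" and "g2 s = A2 *v x2 s + f2 s" for s
  have g: "g1 absolutely_integrable_on {0..t}" "g2 absolutely_integrable_on {0..t}"
    and x: "x1 t = integral {0..t} g1" "x2 t = integral {0..t} g2"
    using x1 x2 t by (auto simp: linear_trajectory_def g1_def[abs_def] g2_def[abs_def])
  have i: "g1 integrable_on {0..t}" "g2 integrable_on {0..t}"
    using g by (auto simp: absolutely_integrable_on_def)
  let ?U = "(*v) (vcat (mat 1) 0) :: real^'n1 \<Rightarrow> real^('n1 + 'n2)"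
  let ?L = "(*v) (vcat 0 (mat 1)) :: real^'n2 \<Rightarrow> real^('n1 + 'n2)"
  have eq: "vcat (hcat A1 0) (hcat 0 A2) *v stack (x1 s) (x2 s) + stack (f1 s) (f2 s) = ?U (g1 s) + ?L (g2 s)" for s
    unfolding stack_as_matrices[symmetric]
    by (simp add: vcat_vector hcat_stack stack_add g1_def g2_def)
  have abs: "(\<lambda>s. ?U (g1 s)) absolutely_integrable_on {0..t}" "(\<lambda>s. ?L (g2 s)) absolutely_integrable_on {0..t}"
    using absolutely_integrable_linear[OF g(1) matrix_vector_mul_bounded_linear]
      absolutely_integrable_linear[OF g(2) matrix_vector_mul_bounded_linear] by (simp_all add: o_def)
  have "integral {0..t} (\<lambda>s. ?U (g1 s) + ?L (g2 s)) = ?U (x1 t) + ?L (x2 t)"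
    using integral_linear[OF i(1) matrix_vector_mul_bounded_linear[of "vcat (mat 1) 0 :: real^'n1^('n1 + 'n2)"]]
      integral_linear[OF i(2) matrix_vector_mul_bounded_linear[of "vcat 0 (mat 1) :: real^'n2^('n1 + 'n2)"]]
    by (subst Henstock_Kurzweil_Integration.integral_add)
      (auto simp: o_def x intro: set_lebesgue_integral_eq_integral(1) abs)
  then show "(\<lambda>s. vcat (hcat A1 0) (hcat 0 A2) *v stack (x1 s) (x2 s) + stack (f1 s) (f2 s)) absolutely_integrable_on {0..t} \<and>
    stack (x1 t) (x2 t) = integral {0..t} (\<lambda>s. vcat (hcat A1 0) (hcat 0 A2) *v stack (x1 s) (x2 s) + stack (f1 s) (f2 s))"
    unfolding eq using set_integral_add(1)[OF abs] by (simp add: stack_as_matrices[symmetric])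
qed

section \<open>Similarity as dissipativity of the error system\<close>

lemma is_state_trajectory_iff:
  "is_state_trajectory S 0 0 u d x \<longleftrightarrow> linear_trajectory (matA S) (\<lambda>t. matB S *v u t + matE S *v d t) x"
  by (simp add: is_state_trajectory_def linear_trajectory_def add.assoc)

text \<open>Uniqueness of trajectories turns the definite description into the value of any given
  trajectory.\<close>

lemma lti_state_eq:
  assumes "linear_trajectory (matA S) (\<lambda>t. matB S *v u t + matE S *v d t) x" "t \<ge> 0"
  shows "lti_state S t 0 0 u d = x t"
  unfolding lti_state_def is_state_trajectory_iff
  by (rule the_equality) (use assms linear_trajectory_unique in blast)+

text \<open>The row block of \<open>lmiC\<close> that produces the output difference; the other
  block is 0.\<close>

definition error_matrix ::
  "('n1::finite, 'm::finite, 'q1::finite, 'p::finite) lti \<Rightarrow> ('n2::finite, 'm, 'q2::finite, 'p) lti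
     \<Rightarrow> real^('n1 + 'n2)^'p" where
  "error_matrix S1 S2 = hcat (matC S1) (- matC S2)"

lemma error_trajectory:
  fixes S1 :: "('n1::finite, 'm::finite, 'q1::finite, 'p::finite) lti"
    and S2 :: "('n2::finite, 'm, 'q2::finite, 'p) lti"
  assumes "u1 \<in> L2" "u2 \<in> L2" "d1 \<in> L2" "d2 \<in> L2"
  obtains x where
    "linear_trajectory (lmiA S1 S2) (\<lambda>t. lmiB S1 S2 *v d2 t + lmiE S1 S2 *v stack (u1 t) (stack (u2 t) (d1 t))) x"
    "\<And>t. t \<ge> 0 \<Longrightarrow> lti_output S1 t 0 0 u1 d1 - lti_output S2 t 0 0 u2 d2 = error_matrix S1 S2 *v x t"
proof -
  have exists: "\<exists>x. linear_trajectory (matA S) (\<lambda>t. matB S *v u t + matE S *v d t) x"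
    if "u \<in> L2" "d \<in> L2" for S :: "('a::finite, 'b::finite, 'c::finite, 'd::finite) lti" and u d
  proof -
    have "(\<lambda>t. matB S *v u t + matE S *v d t) \<in> L2" by (intro L2_add L2_matrix that)
    from linear_trajectory_exists[OF L2_absolutely_integrable[OF this]] show ?thesis by blast
  qed
  obtain x1 where x1: "linear_trajectory (matA S1) (\<lambda>t. matB S1 *v u1 t + matE S1 *v d1 t) x1"
    using exists assms by blast
  obtain x2 where x2: "linear_trajectory (matA S2) (\<lambda>t. matB S2 *v u2 t + matE S2 *v d2 t) x2"
    using exists assms by blast
  show thesis
  proof (rule that)
    have "lmiB S1 S2 *v d2 t + lmiE S1 S2 *v stack (u1 t) (stack (u2 t) (d1 t)) =
        stack (matB S1 *v u1 t + matE S1 *v d1 t) (matB S2 *v u2 t + matE S2 *v d2 t)" for t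
      by (simp add: lmiB_def lmiE_def vcat_vector hcat_stack stack_add add.commute)
    then show "linear_trajectory (lmiA S1 S2)
        (\<lambda>t. lmiB S1 S2 *v d2 t + lmiE S1 S2 *v stack (u1 t) (stack (u2 t) (d1 t))) (\<lambda>t. stack (x1 t) (x2 t))"
      unfolding lmiA_def using linear_trajectory_stack[OF x1 x2] by simp
    fix t :: real assume t: "t \<ge> 0"
    have "(- matC S2) *v x2 t = - (matC S2 *v x2 t)"
      by (simp add: vec_eq_iff matrix_vector_mult_def sum_negf)
    then show "lti_output S1 t 0 0 u1 d1 - lti_output S2 t 0 0 u2 d2 = error_matrix S1 S2 *v stack (x1 t) (x2 t)"
      using lti_state_eq[OF x1 t] lti_state_eq[OF x2 t]
      by (simp add: lti_output_def error_matrix_def hcat_stack)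
  qed
qed

lemma Qtilde_form:
  "stack u1 (stack u2 d1) \<bullet> (Qtilde \<gamma> \<delta> \<mu> *v stack u1 (stack u2 d1)) =
     \<gamma> * (norm (u1 - u2))\<^sup>2 + \<delta> * (norm (stack u1 u2))\<^sup>2 + \<mu> * (norm d1)\<^sup>2"
  by (simp add: Qtilde_def vcat_vector hcat_stack inner_stack mat_vector_mult norm_stack)
    (simp add: power2_norm_eq_inner inner_add_right inner_diff_left inner_diff_right inner_commute algebra_simps)

lemma Qtilde_integral:
  assumes u1: "u1 \<in> L2" and u2: "u2 \<in> L2" and d1: "d1 \<in> L2"
  shows "integral {0..} (\<lambda>t. stack (u1 t) (stack (u2 t) (d1 t)) \<bullet> (Qtilde \<gamma> \<delta> \<mu> *v stack (u1 t) (stack (u2 t) (d1 t))))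
    = \<gamma> * (L2norm (\<lambda>t. u1 t - u2 t))\<^sup>2 + \<delta> * (L2norm (\<lambda>t. stack (u1 t) (u2 t)))\<^sup>2 + \<mu> * (L2norm d1)\<^sup>2"
proof -
  have "(\<lambda>t. u1 t + mat (- 1) *v u2 t) \<in> L2" by (intro L2_add L2_matrix u1 u2)
  then have diff: "(\<lambda>t. u1 t - u2 t) \<in> L2" by (simp add: mat_vector_mult)
  note mem = diff L2_stack[OF u1 u2] d1
  have int: "(\<lambda>t. (norm (u t))\<^sup>2) integrable_on {0..}" if "u \<in> L2" for u :: "real \<Rightarrow> real^'k"
    using that by (simp add: L2_iff)
  have "((\<lambda>t. \<gamma> * (norm (u1 t - u2 t))\<^sup>2 + \<delta> * (norm (stack (u1 t) (u2 t)))\<^sup>2 + \<mu> * (norm (d1 t))\<^sup>2) has_integral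
      \<gamma> * energy (\<lambda>t. u1 t - u2 t) + \<delta> * energy (\<lambda>t. stack (u1 t) (u2 t)) + \<mu> * energy d1) {0..}"
    by (intro has_integral_add has_integral_mult_right integrable_integral int mem)
  then show ?thesis
    unfolding Qtilde_form L2norm_power2[OF mem(1)] L2norm_power2[OF mem(2)] L2norm_power2[OF mem(3)]
    by (rule integral_unique)
qed

text \<open>The right side of the similarity inequality is the integrated form of
  \<open>Qtilde\<close>, with the slack subtracted from \<open>\<delta>\<close> and
  \<open>\<mu>\<close>. The output difference agrees with \<open>error_matrix\<close> applied to any
  trajectory of the stacked system.\<close>

lemma similar_iff_open_loop_dissipative:
  fixes S1 :: "('n1::finite, 'm::finite, 'q1::finite, 'p::finite) lti"
    and S2 :: "('n2::finite, 'm, 'q2::finite, 'p) lti"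
  shows "similar \<gamma> \<delta> S1 S2 \<longleftrightarrow> (\<exists>\<epsilon>>0. \<exists>\<eta>>0. \<exists>\<mu>>0.
    open_loop_dissipative (lmiA S1 S2) (lmiB S1 S2) (lmiE S1 S2) (error_matrix S1 S2)
      (Qtilde \<gamma> (\<delta> - \<epsilon>) (\<mu> - \<epsilon>)) \<eta>)"
proof -
  have "(let e = (\<lambda>t. lti_output S1 t 0 0 u1 d1 - lti_output S2 t 0 0 u2 d2) in
        e \<in> L2 \<and>
        (L2norm e)\<^sup>2 \<le> \<gamma> * (L2norm (\<lambda>t. u1 t - u2 t))\<^sup>2
          + (\<delta> - \<epsilon>) * (L2norm (\<lambda>t. stack (u1 t) (u2 t)))\<^sup>2
          + (\<mu> - \<epsilon>) * (L2norm d1)\<^sup>2 - \<eta> * (L2norm d2)\<^sup>2) \<longleftrightarrow>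
      (\<exists>x. linear_trajectory (lmiA S1 S2) (\<lambda>t. lmiB S1 S2 *v d2 t + lmiE S1 S2 *v w t) x \<and>
        (\<lambda>t. error_matrix S1 S2 *v x t) \<in> L2 \<and>
        energy (\<lambda>t. error_matrix S1 S2 *v x t)
          \<le> integral {0..} (\<lambda>t. w t \<bullet> (Qtilde \<gamma> (\<delta> - \<epsilon>) (\<mu> - \<epsilon>) *v w t)) - \<eta> * energy d2)"
    if mem: "u1 \<in> L2" "u2 \<in> L2" "d1 \<in> L2" "d2 \<in> L2" and w: "w = (\<lambda>t. stack (u1 t) (stack (u2 t) (d1 t)))"
    for \<epsilon> \<eta> \<mu> and u1 u2 :: "real \<Rightarrow> real^'m" and d1 :: "real \<Rightarrow> real^'q1" and d2 :: "real \<Rightarrow> real^'q2" and w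
  proof -
    let ?C = "error_matrix S1 S2"
    define e where "e t = lti_output S1 t 0 0 u1 d1 - lti_output S2 t 0 0 u2 d2" for t
    obtain x where x: "linear_trajectory (lmiA S1 S2) (\<lambda>t. lmiB S1 S2 *v d2 t + lmiE S1 S2 *v w t) x"
        "\<And>t. t \<ge> 0 \<Longrightarrow> e t = ?C *v x t"
      unfolding w e_def by (rule error_trajectory[OF mem, of S1 S2]) blast
    have e_y: "e \<in> L2 \<longleftrightarrow> (\<lambda>t. ?C *v y t) \<in> L2" "L2norm e = L2norm (\<lambda>t. ?C *v y t)"
      if "linear_trajectory (lmiA S1 S2) (\<lambda>t. lmiB S1 S2 *v d2 t + lmiE S1 S2 *v w t) y" for y
    proof -
      have eq: "e t = ?C *v y t" if "t \<ge> 0" for t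
        using x linear_trajectory_unique[OF x(1) \<open>linear_trajectory _ _ y\<close> that] that by simp
      show "e \<in> L2 \<longleftrightarrow> (\<lambda>t. ?C *v y t) \<in> L2" by (rule L2_cong) (rule eq)
      show "L2norm e = L2norm (\<lambda>t. ?C *v y t)" by (rule L2norm_cong) (rule eq)
    qed
    have "e \<in> L2 \<and> (L2norm e)\<^sup>2 \<le> R \<longleftrightarrow> (\<lambda>t. ?C *v y t) \<in> L2 \<and> energy (\<lambda>t. ?C *v y t) \<le> R"
      if "linear_trajectory (lmiA S1 S2) (\<lambda>t. lmiB S1 S2 *v d2 t + lmiE S1 S2 *v w t) y" for y R
      using e_y[OF that] L2norm_power2[of "\<lambda>t. ?C *v y t"] by auto
    then have "e \<in> L2 \<and> (L2norm e)\<^sup>2 \<le> R \<longleftrightarrow>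
        (\<exists>y. linear_trajectory (lmiA S1 S2) (\<lambda>t. lmiB S1 S2 *v d2 t + lmiE S1 S2 *v w t) y \<and>
          (\<lambda>t. ?C *v y t) \<in> L2 \<and> energy (\<lambda>t. ?C *v y t) \<le> R)" for R
      using x(1) by blast
    then show ?thesis
      unfolding Let_def e_def[symmetric, abs_def] w Qtilde_integral[OF mem(1-3)] L2norm_power2[OF mem(4)] .
  qed
  note pointwise = this
  \<comment> \<open>Every signal in the stacked space is the stack of its blocks, so quantifying
    over \<open>w\<close> and over its three parts is the same.\<close>
  have split: "(\<forall>w\<in>L2. \<Psi> w) \<longleftrightarrow> (\<forall>u1\<in>L2. \<forall>u2\<in>L2. \<forall>d1\<in>L2. \<Psi> (\<lambda>t. stack (u1 t) (stack (u2 t) (d1 t))))"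
    for \<Psi> :: "(real \<Rightarrow> real^('m + 'm + 'q1)) \<Rightarrow> bool"
  proof safe
    fix w :: "real \<Rightarrow> real^('m + 'm + 'q1)"
    assume *: "\<forall>u1\<in>L2. \<forall>u2\<in>L2. \<forall>d1\<in>L2. \<Psi> (\<lambda>t. stack (u1 t) (stack (u2 t) (d1 t)))" and w: "w \<in> L2"
    have "\<Psi> (\<lambda>t. stack (upper (w t)) (stack (upper (lower (w t))) (lower (lower (w t)))))"
      by (intro *[rule_format] L2_matrix w)
    then show "\<Psi> w" by (simp only: stack_upper_lower)
  qed (simp add: L2_stack)
  show ?thesis
    unfolding similar_def open_loop_dissipative_def split
    by (intro ex_cong1 conj_cong refl ball_cong bex_cong) (rule pointwise; simp)
qed

text \<open>The system is block diagonal: both halves of an eigenvector satisfy the eigenvalue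
  equation, and one of them is nonzero.\<close>

lemma hurwitz_lmiA:
  fixes S1 :: "('n1::finite, 'm::finite, 'q1::finite, 'p::finite) lti"
    and S2 :: "('n2::finite, 'm, 'q2::finite, 'p) lti"
  assumes "hurwitz (matA S1)" "hurwitz (matA S2)"
  shows "hurwitz (lmiA S1 S2)"
  unfolding hurwitz_def
proof (intro allI impI)
  fix l :: complex and v :: "complex^('n1 + 'n2)"
  assume v: "v \<noteq> 0" and ev: "(\<chi> i j. complex_of_real (lmiA S1 S2 $ i $ j)) *v v = l *s v"
  define v1 v2 where "v1 = (\<chi> i. v $ Inl i)" and "v2 = (\<chi> i. v $ Inr i)"
  have "(\<chi> i j. complex_of_real (matA S1 $ i $ j)) *v v1 = l *s v1"
    unfolding vec_eq_iff
  proof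
    fix i
    show "((\<chi> i j. complex_of_real (matA S1 $ i $ j)) *v v1) $ i = (l *s v1) $ i"
      using arg_cong[OF ev, of "\<lambda>y. y $ Inl i"]
      by (simp add: matrix_vector_mult_def lmiA_def vcat_def hcat_def sum_UNIV_Plus v1_def)
  qed
  moreover have "(\<chi> i j. complex_of_real (matA S2 $ i $ j)) *v v2 = l *s v2"
    unfolding vec_eq_iff
  proof
    fix i
    show "((\<chi> i j. complex_of_real (matA S2 $ i $ j)) *v v2) $ i = (l *s v2) $ i"
      using arg_cong[OF ev, of "\<lambda>y. y $ Inr i"]
      by (simp add: matrix_vector_mult_def lmiA_def vcat_def hcat_def sum_UNIV_Plus v2_def)
  qed
  moreover have "v1 \<noteq> 0 \<or> v2 \<noteq> 0"
  proof (rule ccontr)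
    assume "\<not> ?thesis"
    then have "v $ k = 0" for k by (cases k) (auto simp: vec_eq_iff v1_def v2_def)
    then show False using v by (simp add: vec_eq_iff)
  qed
  ultimately show "Re l < 0" using assms unfolding hurwitz_def by blast
qed

section \<open>The matrix inequality as a quadratic form\<close>

lemma transpose_hcat: "transpose (hcat M N) = vcat (transpose M) (transpose N)"
  by (simp add: vec_eq_iff transpose_def hcat_def vcat_def split: sum.split)

lemma transpose_vcat: "transpose (vcat M N) = hcat (transpose M) (transpose N)"
  by (simp add: vec_eq_iff transpose_def hcat_def vcat_def split: sum.split)

lemma transpose_add: "transpose (M + N) = transpose M + transpose N"
  by (simp add: vec_eq_iff transpose_def)

lemma transpose_uminus: "transpose (- M) = - transpose M"
  by (simp add: vec_eq_iff transpose_def)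

lemma transpose_zero: "transpose 0 = 0"
  by (simp add: vec_eq_iff transpose_def)

lemmas block_transpose = transpose_hcat transpose_vcat transpose_add transpose_uminus transpose_zero transpose_mat

lemma uminus_matrix_vector: "(- M) *v x = - (M *v x)" for M :: "real^'n^'m"
  by (simp add: vec_eq_iff matrix_vector_mult_def sum_negf)

lemma symmetric_Qtilde: "transpose (Qtilde \<gamma> \<delta> \<mu>) = Qtilde \<gamma> \<delta> \<mu>"
  by (simp add: Qtilde_def block_transpose) (simp add: vec_eq_iff hcat_def vcat_def split: sum.split)

lemma symmetric_Rtilde: "transpose (Rtilde \<eta>) = Rtilde \<eta>"
  by (simp add: Rtilde_def block_transpose) (simp add: vec_eq_iff hcat_def vcat_def split: sum.split)

text \<open>Each off-diagonal block meets its transpose and counts twice. \<open>lmiC\<close> and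
  \<open>lmiD\<close> have complementary zero blocks, so \<open>G\<close> separates into
  \<open>error_matrix\<close> times \<open>X\<close>, paired with \<open>r1\<close>, and
  \<open>Pi\<close>, paired with \<open>r2\<close>.\<close>

lemma negative_definite_lmi_iff:
  fixes S1 :: "('n1::finite, 'm::finite, 'q1::finite, 'p::finite) lti"
    and S2 :: "('n2::finite, 'm, 'q2::finite, 'p) lti"
    and X :: "real^('n1 + 'n2)^('n1 + 'n2)" and Pi :: "real^('n1 + 'n2)^'q2"
  defines "A \<equiv> lmiA S1 S2" and "B \<equiv> lmiB S1 S2" and "E \<equiv> lmiE S1 S2"
  assumes F: "F = A ** X + B ** Pi" and G: "G = lmiC S1 S2 ** X + lmiD S1 S2 ** Pi"
  shows "negative_definite
      (block_col3
         (block_row3 (F + transpose F) E (transpose G))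
         (block_row3 (transpose E) (- (Qtilde \<gamma> \<delta> \<mu>)) 0)
         (block_row3 G 0 (- (Rtilde \<eta>)))) \<longleftrightarrow>
    (\<forall>\<xi> w r1 r2. \<xi> \<noteq> 0 \<or> w \<noteq> 0 \<or> r1 \<noteq> 0 \<or> r2 \<noteq> 0 \<longrightarrow>
       lmi_form A B E (error_matrix S1 S2) (Qtilde \<gamma> \<delta> \<mu>) \<eta> X Pi \<xi> w r1 r2 < 0)"
    (is "negative_definite ?M \<longleftrightarrow> ?R")
proof -
  have sym: "transpose ?M = ?M"
    by (simp add: block_transpose symmetric_Qtilde symmetric_Rtilde)
      (simp add: vec_eq_iff hcat_def vcat_def split: sum.split)
  have form: "stack \<xi> (stack w (stack r1 r2)) \<bullet> (?M *v stack \<xi> (stack w (stack r1 r2))) =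
      lmi_form A B E (error_matrix S1 S2) (Qtilde \<gamma> \<delta> \<mu>) \<eta> X Pi \<xi> w r1 r2" for \<xi> w r1 r2
  proof -
    have Gv: "G *v \<xi> = stack (error_matrix S1 S2 *v (X *v \<xi>)) (Pi *v \<xi>)"
    proof -
      have "(hcat 0 0 :: real^('n1 + 'n2)^'q2) *v y = 0" for y
        by (subst stack_upper_lower[of y, symmetric]) (simp only: hcat_stack, simp)
      then show ?thesis
        by (simp add: G lmiC_def lmiD_def matrix_vector_mult_add_rdistrib matrix_vector_mul_assoc[symmetric]
            vcat_vector stack_add error_matrix_def)
    qed
    have R: "Rtilde \<eta> *v stack r1 r2 = stack r1 (\<eta> *\<^sub>R r2)"
      by (simp add: Rtilde_def vcat_vector hcat_stack mat_vector_mult)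
    have "stack \<xi> (stack w (stack r1 r2)) \<bullet> (?M *v stack \<xi> (stack w (stack r1 r2))) =
      \<xi> \<bullet> (F *v \<xi>) + \<xi> \<bullet> (transpose F *v \<xi>) + \<xi> \<bullet> (E *v w) + \<xi> \<bullet> (transpose G *v stack r1 r2)
      + w \<bullet> (transpose E *v \<xi>) - w \<bullet> (Qtilde \<gamma> \<delta> \<mu> *v w)
      + stack r1 r2 \<bullet> (G *v \<xi>) - stack r1 r2 \<bullet> (Rtilde \<eta> *v stack r1 r2)"
      by (simp add: vcat_vector hcat_stack inner_stack matrix_vector_mult_add_rdistrib inner_add_right
          inner_diff_right uminus_matrix_vector del: transpose_matrix_vector)
    also have "\<dots> = 2 * (\<xi> \<bullet> (F *v \<xi>)) + 2 * (\<xi> \<bullet> (E *v w)) + 2 * (stack r1 r2 \<bullet> (G *v \<xi>))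
      - w \<bullet> (Qtilde \<gamma> \<delta> \<mu> *v w) - stack r1 r2 \<bullet> (Rtilde \<eta> *v stack r1 r2)"
      by (simp add: inner_transpose inner_commute del: transpose_matrix_vector)
    finally show ?thesis
      unfolding Gv R lmi_form_def
      by (simp add: F inner_stack matrix_vector_mult_add_rdistrib matrix_vector_mul_assoc[symmetric]
          inner_add_right power2_norm_eq_inner distrib_left)
  qed
  show ?thesis
  proof
    assume M: "negative_definite ?M"
    show ?R
    proof (intro allI impI)
      fix \<xi> :: "real^('n1 + 'n2)" and w :: "real^('m + 'm + 'q1)" and r1 :: "real^'p" and r2 :: "real^'q2"
      assume "\<xi> \<noteq> 0 \<or> w \<noteq> 0 \<or> r1 \<noteq> 0 \<or> r2 \<noteq> 0"
      then have "stack \<xi> (stack w (stack r1 r2)) \<noteq> 0" by (simp add: stack_eq_0_iff)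
      then show "lmi_form A B E (error_matrix S1 S2) (Qtilde \<gamma> \<delta> \<mu>) \<eta> X Pi \<xi> w r1 r2 < 0"
        using M unfolding negative_definite_def form[symmetric] by blast
    qed
  next
    assume R: ?R
    show "negative_definite ?M"
      unfolding negative_definite_def
    proof (intro conjI allI impI sym)
      fix v :: "real^(('n1 + 'n2) + ('m + 'm + 'q1) + ('p + 'q2))" assume v: "v \<noteq> 0"
      define \<xi> w r1 r2 where "\<xi> = upper v" and "w = upper (lower v)"
        and "r1 = upper (lower (lower v))" and "r2 = lower (lower (lower v))"
      have v_eq: "v = stack \<xi> (stack w (stack r1 r2))"
        by (simp only: \<xi>_def w_def r1_def r2_def stack_upper_lower)
      then have "\<xi> \<noteq> 0 \<or> w \<noteq> 0 \<or> r1 \<noteq> 0 \<or> r2 \<noteq> 0" using v by (simp add: stack_eq_0_iff)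
      then show "v \<bullet> (?M *v v) < 0" using R unfolding v_eq form by blast
    qed
  qed
qed

text \<open>Subtracting the same number from \<open>\<delta>\<close> and \<open>\<mu>\<close> lowers
  exactly the diagonal, so the slack of similarity is a multiple of the identity.\<close>

lemma Qtilde_mat: "Qtilde \<gamma> (\<delta> - c) (\<mu> - c) = Qtilde \<gamma> \<delta> \<mu> - mat c"
  by (simp add: vec_eq_iff Qtilde_def hcat_def vcat_def mat_def split: sum.split)

lemma positive_definite_Qtilde:
  assumes "\<gamma> > 0" "\<delta> > 0" "\<mu> > 0"
  shows "positive_definite (Qtilde \<gamma> \<delta> \<mu>)"
  unfolding positive_definite_def
proof (intro conjI allI impI symmetric_Qtilde)
  fix v :: "real^('a + 'a + 'b)" assume v: "v \<noteq> 0"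
  define u1 u2 d1 where "u1 = upper v" and "u2 = upper (lower v)" and "d1 = lower (lower v)"
  have v_eq: "v = stack u1 (stack u2 d1)" by (simp only: u1_def u2_def d1_def stack_upper_lower)
  have "u1 \<noteq> 0 \<or> u2 \<noteq> 0 \<or> d1 \<noteq> 0" using v v_eq by (auto simp: stack_eq_0_iff)
  then have "\<delta> * (norm (stack u1 u2))\<^sup>2 + \<mu> * (norm d1)\<^sup>2 > 0"
    using assms by (auto simp: stack_eq_0_iff add_pos_nonneg add_nonneg_pos)
  moreover have "\<gamma> * (norm (u1 - u2))\<^sup>2 \<ge> 0" using assms by simp
  ultimately show "v \<bullet> (Qtilde \<gamma> \<delta> \<mu> *v v) > 0" unfolding v_eq Qtilde_form by linarith
qed

text \<open>Allows the slack to be reduced until the supply form is positive definite.\<close>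

lemma open_loop_dissipative_mono:
  fixes Q Q' :: "real^'w^'w"
  assumes diss: "open_loop_dissipative A B E C Q \<eta>" and le: "\<And>w. w \<bullet> (Q *v w) \<le> w \<bullet> (Q' *v w)"
  shows "open_loop_dissipative A B E C Q' \<eta>"
proof -
  have "integral {0..} (\<lambda>t. w t \<bullet> (Q *v w t)) \<le> integral {0..} (\<lambda>t. w t \<bullet> (Q' *v w t))" if "w \<in> L2" for w
    by (intro integral_le L2_inner_integrable L2_matrix that le)
  then show ?thesis using diss unfolding open_loop_dissipative_def
    by (meson diff_right_mono order_trans)
qed

theorem theorem2:
  fixes S1 :: "('n1::finite, 'm::finite, 'q1::finite, 'p::finite) lti"
    and S2 :: "('n2::finite, 'm, 'q2::finite, 'p) lti"
    and \<gamma> \<delta> :: real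
  assumes "zero_asymptotically_stable S1" and "zero_asymptotically_stable S2"
    and "\<gamma> > 0" and "\<delta> > 0"
  shows "similar \<gamma> \<delta> S1 S2 \<longleftrightarrow>
    (\<exists>(X :: real^('n1 + 'n2)^('n1 + 'n2)) (Pi :: real^('n1 + 'n2)^'q2) (\<eta> :: real) (\<mu> :: real).
       positive_definite X \<and> \<eta> > 0 \<and> \<mu> > 0 \<and>
       (let A = lmiA S1 S2; B = lmiB S1 S2; E = lmiE S1 S2; C = lmiC S1 S2; D = lmiD S1 S2;
            F = A ** X + B ** Pi;
            G = C ** X + D ** Pi
        in negative_definite
             (block_col3
                (block_row3 (F + transpose F) E                          (transpose G))
                (block_row3 (transpose E)     (- (Qtilde \<gamma> \<delta> \<mu>)) 0)
                (block_row3 G                 0                          (- (Rtilde \<eta>))))))"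
  (is "_ \<longleftrightarrow> ?lmi")
proof -
  let ?diss = "open_loop_dissipative (lmiA S1 S2) (lmiB S1 S2) (lmiE S1 S2) (error_matrix S1 S2)"
  let ?form = "lmi_form (lmiA S1 S2) (lmiB S1 S2) (lmiE S1 S2) (error_matrix S1 S2)"
  have lmi: "?lmi \<longleftrightarrow> (\<exists>X Pi \<eta> \<mu>. positive_definite X \<and> \<eta> > 0 \<and> \<mu> > 0 \<and>
      (\<forall>\<xi> w r1 r2. \<xi> \<noteq> 0 \<or> w \<noteq> 0 \<or> r1 \<noteq> 0 \<or> r2 \<noteq> 0 \<longrightarrow> ?form (Qtilde \<gamma> \<delta> \<mu>) \<eta> X Pi \<xi> w r1 r2 < 0))"
    unfolding Let_def negative_definite_lmi_iff[OF refl refl] ..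
  show ?thesis
  proof
    assume "similar \<gamma> \<delta> S1 S2"
    then obtain \<epsilon> \<eta> \<mu> where pos: "\<epsilon> > 0" "\<eta> > 0" "\<mu> > 0" and diss: "?diss (Qtilde \<gamma> (\<delta> - \<epsilon>) (\<mu> - \<epsilon>)) \<eta>"
      unfolding similar_iff_open_loop_dissipative by blast
    \<comment> \<open>The halves keep \<open>\<delta> - \<epsilon>'\<close> and
      \<open>\<mu> - \<epsilon>'\<close> positive, as positive definiteness of the supply form
      demands.\<close>
    define \<epsilon>' where "\<epsilon>' = min \<epsilon> (min (\<delta> / 2) (\<mu> / 2))"
    have \<epsilon>': "\<epsilon>' > 0" "\<epsilon>' \<le> \<epsilon>" "\<delta> - \<epsilon>' > 0" "\<mu> - \<epsilon>' > 0"
      using pos assms by (auto simp: \<epsilon>'_def min_def)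
    have "?diss (Qtilde \<gamma> (\<delta> - \<epsilon>') (\<mu> - \<epsilon>')) \<eta>"
    proof (rule open_loop_dissipative_mono[OF diss])
      fix w :: "real^('m + 'm + 'q1)"
      have "\<epsilon>' * (w \<bullet> w) \<le> \<epsilon> * (w \<bullet> w)" using \<epsilon>' by (intro mult_right_mono) auto
      then show "w \<bullet> (Qtilde \<gamma> (\<delta> - \<epsilon>) (\<mu> - \<epsilon>) *v w) \<le> w \<bullet> (Qtilde \<gamma> (\<delta> - \<epsilon>') (\<mu> - \<epsilon>') *v w)"
        by (simp add: Qtilde_mat matrix_vector_mult_diff_rdistrib mat_vector_mult inner_diff_right)
    qed
    then obtain X Pi where X: "positive_definite X"
      "\<And>\<xi> w r1 r2. \<xi> \<noteq> 0 \<or> w \<noteq> 0 \<or> r1 \<noteq> 0 \<or> r2 \<noteq> 0 \<Longrightarrow>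
         ?form (Qtilde \<gamma> (\<delta> - \<epsilon>') (\<mu> - \<epsilon>') + mat \<epsilon>') (1 / \<eta>) X Pi \<xi> w r1 r2 < 0"
      using open_loop_dissipative_imp_lmi[OF hurwitz_lmiA \<epsilon>'(1) pos(2) positive_definite_Qtilde] assms \<epsilon>'
      unfolding zero_asymptotically_stable_def by metis
    \<comment> \<open>Returning the whole slack restores the original form: \<open>\<mu>\<close> is
      taken over unchanged, and the weight in \<open>Rtilde\<close> is
      \<open>1 / \<eta>\<close>.\<close>
    have "Qtilde \<gamma> (\<delta> - \<epsilon>') (\<mu> - \<epsilon>') + mat \<epsilon>' = Qtilde \<gamma> \<delta> \<mu>" by (simp add: Qtilde_mat)
    moreover have "1 / \<eta> > 0" using pos by simp
    ultimately show ?lmi unfolding lmi using X pos by metis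
  next
    assume ?lmi
    then obtain X Pi \<eta> \<mu> where X: "positive_definite X" and pos: "\<eta> > 0" "\<mu> > 0"
      and neg: "\<And>\<xi> w r1 r2. \<xi> \<noteq> 0 \<or> w \<noteq> 0 \<or> r1 \<noteq> 0 \<or> r2 \<noteq> 0 \<Longrightarrow> ?form (Qtilde \<gamma> \<delta> \<mu>) \<eta> X Pi \<xi> w r1 r2 < 0"
      unfolding lmi by blast
    \<comment> \<open>The margin \<open>c\<close> of the strict inequality serves as the slack of
      similarity, for \<open>\<delta>\<close> and \<open>\<mu>\<close> at once.\<close>
    obtain c where "c > 0" "?diss (Qtilde \<gamma> \<delta> \<mu> - mat c) (1 / \<eta>)"
      using lmi_imp_open_loop_dissipative[OF X pos(1) neg] by blast
    moreover have "1 / \<eta> > 0" using pos by simp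
    ultimately show "similar \<gamma> \<delta> S1 S2"
      unfolding similar_iff_open_loop_dissipative Qtilde_mat using pos by blast
  qed
qed

end
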